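(* For each $n$ let $\sigma_n$ be a uniformly random permutation in $\mathfrak S_n$ with cycle type $\lambda(\sigma_n)\vdash n$, and let $(\nu_n)$, $\nu_n\vdash n$, be a balanced sequence of partitions. Define the random variable $R_n$ by \[ \langle L_{\lambda(\sigma_n)},s_{\nu_n}\rangle=\frac{f^{\nu_n}}{z_{\lambda(\sigma_n)}}(1+R_n). \] Then for every $\varepsilon>0$, $\lim_{n\to\infty}\mathrm{Prob}(|R_n|>\varepsilon)=0$. In particular, the random higher Lie character $\psi^{\lambda(\sigma_n)}$ tends in probability to be regular.
   Context: For $\nu\vdash n$, $f^\nu$ is the number of standard Young tableaux of shape $\nu$, $s_\nu$ the Schur function, $\langle\cdot,\cdot\rangle$ the Hall inner product. For $\lambda=(1^{m_1}2^{m_2}\cdots)\vdash n$, $z_\lambda=\prod_i i^{m_i}m_i!$; let $Z_\lambda\cong\prod_i \mathfrak S_{m_i}[\mathbb Z_i]$ be the centralizer of a permutation of cycle type $\lambda$, where $\mathbb Z_i$ is the cyclic group generated by an $i$-cycle; let $\zeta_i$ be a primitive (faithful) linear character of $\mathbb Z_i$ and $\mathrm{id}_{m_i}[\zeta_i]$ the character of the wreath product $\mathfrak S_{m_i}[\mathbb Z_i]$ obtained from $\zeta_i$ and the trivial character of $\mathfrak S_{m_i}$. The higher Lie character is $\psi^\lambda=\mathrm{Ind}_{Z_\lambda}^{\mathfrak S_n}(\mathrm{id}_{m_1}[\zeta_1]\otimes\mathrm{id}_{m_2}[\zeta_2]\otimes\cdots)$ (degree $n!/z_\lambda$), and $L_\lambda$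 is its Frobenius characteristic. A sequence $\nu_n\vdash n$ is balanced if there is a constant $a$ with $(\nu_n)_1,(\nu_n)'_1\le a\sqrt n$ (first row/column lengths); Plancherel-typical sequences are balanced. A random sequence of characters $\rho_n$ tends in probability to be regular if, writing $\langle\rho_n,\chi^{\nu_n}\rangle=\frac{\rho_n(1)}{n!}f^{\nu_n}(1+R_n)$, one has $\mathrm{Prob}(|R_n|>\varepsilon)\to0$ for every $\varepsilon>0$ and Plancherel-typical $(\nu_n)$. *)

theory Defs
  imports "HOL-Analysis.Analysis" "HOL-Combinatorics.Permutations" "HOL-Library.Multiset"
begin

definition is_partition :: "nat \<Rightarrow> nat list \<Rightarrow> bool" where
  "is_partition n nu \<longleftrightarrow> sorted_wrt (\<ge>) nu \<and> (\<forall>x\<in>set nu. 0 < x) \<and> sum_list nu = n"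

definition first_row :: "nat list \<Rightarrow> nat" where
  "first_row nu = (if nu = [] then 0 else hd nu)"

definition first_col :: "nat list \<Rightarrow> nat" where
  "first_col nu = length nu"

definition balanced :: "(nat \<Rightarrow> nat list) \<Rightarrow> bool" where
  "balanced nu \<longleftrightarrow> (\<exists>a::real. \<forall>n. real (first_row (nu n)) \<le> a * sqrt (real n)
                                   \<and> real (first_col (nu n)) \<le> a * sqrt (real n))"

definition cells :: "nat list \<Rightarrow> (nat \<times> nat) set" where
  "cells nu = {(i, j). i < length nu \<and> j < nu ! i}"

definition num_syt :: "nat list \<Rightarrow> nat" where
  "num_syt nu = card {T. T \<in> cells nu \<rightarrow>\<^sub>E {1..sum_list nu}
      \<and> bij_betw T (cells nu) {1..sum_list nu}
      \<and> (\<forall>i j. (i, j + 1) \<in> cells nu \<longrightarrow> T (i, j) < T (i, j + 1))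
      \<and> (\<forall>i j. (i + 1, j) \<in> cells nu \<longrightarrow> T (i, j) < T (i + 1, j))}"

definition perms :: "nat \<Rightarrow> (nat \<Rightarrow> nat) set" where
  "perms n = {p. p permutes {..<n}}"

definition cyc :: "(nat \<Rightarrow> nat) \<Rightarrow> nat \<Rightarrow> nat set" where
  "cyc p x = {(p ^^ k) x | k. True}"

definition cycle_bases :: "nat \<Rightarrow> (nat \<Rightarrow> nat) \<Rightarrow> nat set" where
  "cycle_bases n p = {x. x < n \<and> x = Min (cyc p x)}"

definition cycle_type :: "nat \<Rightarrow> (nat \<Rightarrow> nat) \<Rightarrow> nat multiset" where
  "cycle_type n p = image_mset (\<lambda>b. card (cyc p b)) (mset_set (cycle_bases n p))"

definition z_const :: "nat multiset \<Rightarrow> nat" where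
  "z_const lam = (\<Prod>i\<in>set_mset lam. i ^ count lam i * fact (count lam i))"

text \<open>For a list mu of parts and an integer vector alpha with l entries,
  <p_mu, h_alpha> = coefficient of x^alpha in p_mu = number of maps sending parts of mu
  to rows 0..l-1 with row sums alpha (zero if some alpha_i < 0).\<close>
definition hall_p_h :: "nat list \<Rightarrow> nat \<Rightarrow> (nat \<Rightarrow> int) \<Rightarrow> nat" where
  "hall_p_h mu l alpha = card {f. f \<in> {..<length mu} \<rightarrow>\<^sub>E {..<l}
      \<and> (\<forall>i<l. int (\<Sum>j | j < length mu \<and> f j = i. mu ! j) = alpha i)}"

text \<open>Jacobi--Trudi: s_nu = det(h_{nu_i - i + j}), hence
  <p_mu, s_nu> = sum_w sign(w) <p_mu, h_{(nu_i - i + w(i))_i}>.\<close>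
definition hall_p_s :: "nat list \<Rightarrow> nat list \<Rightarrow> int" where
  "hall_p_s mu nu = (\<Sum>w | w permutes {..<length nu}.
      sign w * int (hall_p_h mu (length nu) (\<lambda>i. int (nu ! i) - int i + int (w i))))"

definition centralizer :: "nat \<Rightarrow> (nat \<Rightarrow> nat) \<Rightarrow> (nat \<Rightarrow> nat) set" where
  "centralizer n c = {z \<in> perms n. z \<circ> c = c \<circ> z}"

text \<open>For z in the centralizer of c and a cycle with base point b, z maps b to
  c^k(b') where b' is the base point of the image cycle; k is the rotation amount.\<close>
definition rot :: "(nat \<Rightarrow> nat) \<Rightarrow> (nat \<Rightarrow> nat) \<Rightarrow> nat \<Rightarrow> nat" where
  "rot c z b = (LEAST k. (c ^^ k) (Min (cyc c (z b))) = z b)"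

text \<open>The linear character id_{m_1}[zeta_1] \<otimes> id_{m_2}[zeta_2] \<otimes> ... of Z, with
  zeta_i(generator i-cycle) = exp(2 pi i / i).\<close>
definition lie_lin_char :: "nat \<Rightarrow> (nat \<Rightarrow> nat) \<Rightarrow> (nat \<Rightarrow> nat) \<Rightarrow> complex" where
  "lie_lin_char n c z = (\<Prod>b\<in>cycle_bases n c.
      exp (2 * pi * \<i> * of_nat (rot c z b) / of_nat (card (cyc c b))))"

text \<open>Induced character psi = Ind_Z^{S_n} of that linear character, Z = centralizer of c.\<close>
definition higher_lie_char :: "nat \<Rightarrow> (nat \<Rightarrow> nat) \<Rightarrow> (nat \<Rightarrow> nat) \<Rightarrow> complex" where
  "higher_lie_char n c g = (1 / of_nat (card (centralizer n c))) *
      (\<Sum>x\<in>perms n. if x \<circ> g \<circ> inv x \<in> centralizer n c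
                     then lie_lin_char n c (x \<circ> g \<circ> inv x) else 0)"

text \<open><L_lambda, s_nu> where lambda is the cycle type of c:
  L_lambda = ch(psi) = (1/n!) sum_g psi(g) p_{lambda(g)}.\<close>
definition hall_L_s :: "nat \<Rightarrow> (nat \<Rightarrow> nat) \<Rightarrow> nat list \<Rightarrow> complex" where
  "hall_L_s n c nu = (1 / of_nat (fact n)) *
      (\<Sum>g\<in>perms n. higher_lie_char n c g *
          of_int (hall_p_s (sorted_list_of_multiset (cycle_type n g)) nu))"

definition R_var :: "nat \<Rightarrow> nat list \<Rightarrow> (nat \<Rightarrow> nat) \<Rightarrow> complex" where
  "R_var n nu s = hall_L_s n s nu * of_nat (z_const (cycle_type n s))
                         / of_nat (num_syt nu) - 1"

end

theory Submission
  imports Defs "Jordan_Normal_Form.Determinant" "HOL-Combinatorics.Cycles"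
begin

text \<open>
  By Frobenius reciprocity \<open>1 + R\<close> at \<open>\<sigma>\<close> is the sum of \<open>\<omega>(z) \<chi>\<^sup>\<nu>(z) / f\<^sup>\<nu>\<close> over the centralizer of
  \<open>\<sigma>\<close>, where \<open>|\<omega>(z)| = 1\<close> and \<open>z = id\<close> contributes 1. Averaging over \<open>\<sigma>\<close> and counting commuting pairs
  class by class, the mean of \<open>|R|\<close> is at most the sum of \<open>|\<chi>\<^sup>\<nu>| / f\<^sup>\<nu>\<close> over the non-identity classes. Let
  \<open>\<phi>(\<mu>)\<close> be the normalised character at the class whose non-trivial cycles have lengths \<open>\<mu>\<close>, of sum \<open>s\<close>.

  Long types: restricting to the symmetric group on \<open>s\<close> letters, \<open>\<phi>(\<mu>)\<close> is a combination of the
  \<open>\<chi>\<^sup>\<kappa>(\<mu>)\<close>, \<open>|\<kappa>| = s\<close>, with coefficients \<open>f\<^bsup>\<nu>/\<kappa>\<^esup> / f\<^sup>\<nu>\<close>. These are quotients of determinants of falling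
  factorials, and for balanced \<open>\<nu>\<close> they are at most \<open>C\<^sup>s f\<^sup>\<kappa> / s!\<close>. A partition of \<open>s\<close> has
  at most \<open>sqrt (2 s)\<close> removable rim hooks of a given length, so the Murnaghan--Nakayama rule gives
  \<open>f\<^sup>\<kappa> \<le> (2 s) powr (s / 2)\<close> and \<open>|\<chi>\<^sup>\<kappa>(\<mu>)| \<le> (2 s) powr (s / 4)\<close>. Hence \<open>|\<phi>(\<mu>)| \<le> (C / s powr (1/4)) ^ s\<close>, which beats
  the number \<open>\<le> 2 ^ s\<close> of types.

  Short types: along random removal of boxes \<open>\<phi>(\<mu>)\<close> is a bounded martingale, hence nearly constant on most
  windows of \<open>s\<close> steps; removing the hooks of \<open>\<mu>\<close> from such a window shows
  \<open>\<phi>(\<mu>)\<^sup>2 \<le> |\<phi>(\<mu> \<mu>)| + o(1)\<close>. Iterating, \<open>\<phi>(\<mu>)\<close> inherits the decay of long types and tends to 0.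
\<close>

text \<open>Two obstacles shape the proof. Characters enter only as signed counts in Jacobi--Trudi
  sums, so \<open>|chi| <= f\<close> has to be derived. It follows from one comparison, also valid
  for arbitrary nonnegative weights: the removal of a rim hook of \<open>r\<close> cells is
  dominated by the removals of \<open>r\<close> single boxes. With beta sets of fixed cardinality
  both are jumps of one particle, and balancedness only says that all sites lie in
  \<open>{..m}\<close> with \<open>m^2 <= K n\<close>; the resulting \<open>m^(2 s)\<close> is paid
  for by the quotient of \<open>(n - s)!\<close> and \<open>n!\<close>.

  The estimate for long types says nothing for \<open>s\<close> below a constant depending on
  \<open>K\<close>. Doubling repairs this: \<open>k\<close> doublings bound the power
  \<open>2^k\<close> of \<open>phi(mu)\<close>, in the limit, by the estimate for size
  \<open>2^k s\<close>, and taking roots leaves the \<open>s\<close>-th power of a base that tends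
  to 0 with growing \<open>k\<close>. Here \<open>k\<close> is fixed before \<open>n\<close> grows.

  The first moment suffices because class size times centralizer order is \<open>n!\<close>: every
  class has the same weight, so the decay has to beat the number of types, not the number of
  permutations.\<close>

section \<open>Jacobi--Trudi sums\<close>

text \<open>With beta numbers \<open>l\<close> of \<open>\<nu>\<close> and \<open>k\<close> of \<open>\<kappa>\<close> this is the value of the skew character
  \<open>\<nu> / \<kappa>\<close>; the empty \<open>\<kappa>\<close> corresponds to \<open>k i = i\<close>.\<close>
definition jt :: "nat list \<Rightarrow> nat \<Rightarrow> (nat \<Rightarrow> int) \<Rightarrow> (nat \<Rightarrow> int) \<Rightarrow> int" where
  "jt mu L l k = (\<Sum>w | w permutes {..<L}. sign w * int (hall_p_h mu L (\<lambda>i. l i - k (w i))))"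

section \<open>Recursion and symmetry of the coefficients of power sum products\<close>

lemma hall_p_h_Nil: "hall_p_h [] L \<alpha> = (if \<forall>i<L. \<alpha> i = 0 then 1 else 0)"
proof -
  have "{f. f \<in> {..<length ([]::nat list)} \<rightarrow>\<^sub>E {..<L}
      \<and> (\<forall>i<L. int (\<Sum>j | j < length ([]::nat list) \<and> f j = i. [] ! j) = \<alpha> i)} =
     (if \<forall>i<L. \<alpha> i = 0 then {\<lambda>x. undefined} else {})"
    by auto
  then show ?thesis unfolding hall_p_h_def by (auto split: if_splits)
qed

lemma hall_p_h_cong:
  assumes "\<And>i. i < L \<Longrightarrow> \<alpha> i = \<beta> i"
  shows "hall_p_h mu L \<alpha> = hall_p_h mu L \<beta>"
  unfolding hall_p_h_def using assms by (intro arg_cong[where f = card]) auto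

text \<open>The maps are sorted by the row \<open>i\<close> that receives the first part. Exponents
  are integers, so a row with too little room just becomes negative and contributes 0
  (\<open>hall_p_h_neg\<close>); no condition on \<open>i\<close> has to be carried along.\<close>

lemma hall_p_h_Cons:
  "hall_p_h (r # mu) L \<alpha> = (\<Sum>i<L. hall_p_h mu L (\<alpha>(i := \<alpha> i - int r)))"
proof -
  let ?n = "length mu"
  define S where "S mu \<alpha> = {f. f \<in> {..<length mu} \<rightarrow>\<^sub>E {..<L}
      \<and> (\<forall>i<L. int (\<Sum>j | j < length mu \<and> f j = i. mu ! j) = \<alpha> i)}" for mu \<alpha>
  \<comment> \<open>\<open>ext (i, f)\<close> sends position 0 to row \<open>i\<close> and shifts
    \<open>f\<close> by one position; the value \<open>undefined\<close> beyond the end keeps it in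
    the extensional function space.\<close>
  define ext where "ext = (\<lambda>(i, f) j. case j of 0 \<Rightarrow> (i::nat) | Suc j' \<Rightarrow> if j' < ?n then f j' else undefined)"
  have sum_ext: "(\<Sum>j | j < length (r # mu) \<and> ext (i, f) j = i'. (r # mu) ! j) =
      (if i = i' then r else 0) + (\<Sum>j | j < ?n \<and> f j = i'. mu ! j)" for i f i'
  proof -
    have e: "{j. j < length (r # mu) \<and> ext (i, f) j = i'} =
       (if i = i' then {0} else {}) \<union> Suc ` {j. j < ?n \<and> f j = i'}"
    proof (rule Set.set_eqI)
      fix j
      show "j \<in> {j. j < length (r # mu) \<and> ext (i, f) j = i'} \<longleftrightarrow>
        j \<in> (if i = i' then {0} else {}) \<union> Suc ` {j. j < ?n \<and> f j = i'}"
      proof (cases j)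
        case 0
        then show ?thesis by (simp add: ext_def)
      next
        case (Suc j')
        then show ?thesis by (cases "i = i'") (auto simp: ext_def)
      qed
    qed
    have "(\<Sum>j | j < length (r # mu) \<and> ext (i, f) j = i'. (r # mu) ! j) =
      (\<Sum>j\<in>(if i = i' then {0} else {}). (r # mu) ! j) + (\<Sum>j\<in>Suc ` {j. j < ?n \<and> f j = i'}. (r # mu) ! j)"
      unfolding e by (rule sum.union_disjoint) auto
    moreover have "(\<Sum>j\<in>Suc ` {j. j < ?n \<and> f j = i'}. (r # mu) ! j) = (\<Sum>j | j < ?n \<and> f j = i'. mu ! j)"
      by (subst sum.reindex) auto
    moreover have "(\<Sum>j\<in>(if i = i' then {0} else {}). (r # mu) ! j) = (if i = i' then r else 0)"
      by auto
    ultimately show ?thesis by (simp only:)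
  qed
  have inv: "ext (g 0, \<lambda>j. if j < ?n then g (Suc j) else undefined) = g" if "g \<in> S (r # mu) \<alpha>" for g
  proof
    fix j
    have "g (Suc j') = undefined" if "\<not> j' < ?n" for j'
      using \<open>g \<in> _\<close> that unfolding S_def by (auto intro: PiE_arb)
    then show "ext (g 0, \<lambda>j. if j < ?n then g (Suc j) else undefined) j = g j"
      by (cases j) (auto simp: ext_def)
  qed
  have bij: "bij_betw ext (SIGMA i:{..<L}. S mu (\<alpha>(i := \<alpha> i - int r))) (S (r # mu) \<alpha>)"
  proof (rule bij_betw_byWitness[where f' = "\<lambda>g. (g 0, \<lambda>j. if j < ?n then g (Suc j) else undefined)"])
    show "\<forall>a\<in>(SIGMA i:{..<L}. S mu (\<alpha>(i := \<alpha> i - int r))).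
        (\<lambda>g. (g 0, \<lambda>j. if j < ?n then g (Suc j) else undefined)) (ext a) = a"
    proof
      fix a assume a: "a \<in> (SIGMA i:{..<L}. S mu (\<alpha>(i := \<alpha> i - int r)))"
      obtain i f where a': "a = (i, f)" by (cases a)
      have "f \<in> S mu (\<alpha>(i := \<alpha> i - int r))" using a a' by simp
      then have "f j = undefined" if "\<not> j < ?n" for j
        using that unfolding S_def by (blast intro: PiE_arb)
      then show "(ext a 0, \<lambda>j. if j < ?n then ext a (Suc j) else undefined) = a"
        by (auto simp: a' ext_def fun_eq_iff)
    qed
    show "\<forall>a'\<in>S (r # mu) \<alpha>. ext (a' 0, \<lambda>j. if j < ?n then a' (Suc j) else undefined) = a'"
      using inv by blast
    show "ext ` (SIGMA i:{..<L}. S mu (\<alpha>(i := \<alpha> i - int r))) \<subseteq> S (r # mu) \<alpha>"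
    proof (rule image_subsetI)
      fix a assume a: "a \<in> (SIGMA i:{..<L}. S mu (\<alpha>(i := \<alpha> i - int r)))"
      obtain i f where a': "a = (i, f)" by (cases a)
      have i: "i \<in> {..<L}" and f: "f \<in> S mu (\<alpha>(i := \<alpha> i - int r))"
        using a a' by simp_all
      have A: "ext (i, f) \<in> {..<length (r # mu)} \<rightarrow>\<^sub>E {..<L}"
      proof (rule PiE_I)
          have f: "f \<in> {..<?n} \<rightarrow>\<^sub>E {..<L}" using f unfolding S_def by blast
          show "ext (i, f) j \<in> {..<L}" if "j \<in> {..<length (r # mu)}" for j
            using that i f by (cases j) (auto simp: ext_def)
          show "ext (i, f) j = undefined" if "j \<notin> {..<length (r # mu)}" for j
            using that by (cases j) (auto simp: ext_def)
      qed
      have B: "int (\<Sum>j | j < length (r # mu) \<and> ext (i, f) j = i'. (r # mu) ! j) = \<alpha> i'" if "i' < L" for i'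
      proof -
        have "int (\<Sum>j | j < ?n \<and> f j = i'. mu ! j) = (\<alpha>(i := \<alpha> i - int r)) i'"
          using f that unfolding S_def by blast
        then show ?thesis unfolding sum_ext by (simp split: if_splits)
      qed
      show "ext a \<in> S (r # mu) \<alpha>" unfolding a'
        unfolding S_def mem_Collect_eq using A B by blast
    qed
    show "(\<lambda>g. (g 0, \<lambda>j. if j < ?n then g (Suc j) else undefined)) ` S (r # mu) \<alpha>
      \<subseteq> (SIGMA i:{..<L}. S mu (\<alpha>(i := \<alpha> i - int r)))"
    proof (rule image_subsetI)
      fix g assume g: "g \<in> S (r # mu) \<alpha>"
      define f where "f = (\<lambda>j. if j < ?n then g (Suc j) else undefined)"
      have e: "ext (g 0, f) = g"
        using inv[OF g] unfolding f_def .
      have s: "\<forall>i'<L. int ((if g 0 = i' then r else 0) + (\<Sum>j | j < ?n \<and> f j = i'. mu ! j)) = \<alpha> i'"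
        using g unfolding sum_ext[symmetric] e S_def by blast
      have g0: "g 0 \<in> {..<L}" using g by (auto simp: S_def)
      have "f \<in> S mu (\<alpha>(g 0 := \<alpha> (g 0) - int r))"
        unfolding S_def mem_Collect_eq
      proof (intro conjI allI impI)
        show "f \<in> {..<?n} \<rightarrow>\<^sub>E {..<L}" using g unfolding S_def f_def by auto
        fix i' assume "i' < L"
        then show "int (\<Sum>j | j < ?n \<and> f j = i'. mu ! j) = (\<alpha>(g 0 := \<alpha> (g 0) - int r)) i'"
          using s[rule_format, of i'] by auto
      qed
      then show "(g 0, \<lambda>j. if j < ?n then g (Suc j) else undefined) \<in> (SIGMA i:{..<L}. S mu (\<alpha>(i := \<alpha> i - int r)))" using g0 unfolding f_def by auto
    qed
  qed
  have fin: "finite (S mu \<beta>)" for \<beta>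
    unfolding S_def by (rule finite_subset[OF _ finite_PiE[of "{..<length mu}" "\<lambda>_. {..<L}"]]) auto
  have "hall_p_h (r # mu) L \<alpha> = card (S (r # mu) \<alpha>)" by (simp add: hall_p_h_def S_def)
  also have "\<dots> = card (SIGMA i:{..<L}. S mu (\<alpha>(i := \<alpha> i - int r)))"
    using bij_betw_same_card[OF bij] by simp
  also have "\<dots> = (\<Sum>i<L. card (S mu (\<alpha>(i := \<alpha> i - int r))))"
    using fin by (subst card_SigmaI) auto
  finally show ?thesis by (simp add: hall_p_h_def S_def)
qed

text \<open>Power sums are symmetric polynomials, so permuting the exponents does not change a
  coefficient.\<close>

lemma hall_p_h_permute:
  assumes "u permutes {..<L}"
  shows "hall_p_h mu L (\<lambda>i. \<alpha> (u i)) = hall_p_h mu L \<alpha>"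
proof (induction mu arbitrary: \<alpha>)
  case Nil
  have "(\<forall>i<L. \<alpha> (u i) = 0) \<longleftrightarrow> (\<forall>i<L. \<alpha> i = 0)"
    using permutes_in_image[OF assms] permutes_surj[OF assms] by (metis lessThan_iff surjD)
  then show ?case by (simp add: hall_p_h_Nil)
next
  case (Cons r mu)
  have "hall_p_h (r # mu) L (\<lambda>i. \<alpha> (u i)) = (\<Sum>i<L. hall_p_h mu L (\<lambda>j. (\<alpha>(u i := \<alpha> (u i) - int r)) (u j)))"
    unfolding hall_p_h_Cons using permutes_inj[OF assms]
    by (intro sum.cong hall_p_h_cong) (auto simp: inj_eq)
  also have "\<dots> = (\<Sum>i<L. hall_p_h mu L (\<alpha>(u i := \<alpha> (u i) - int r)))"
    by (rule sum.cong[OF refl], rule Cons.IH)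
  also have "\<dots> = (\<Sum>i<L. hall_p_h mu L (\<alpha>(i := \<alpha> i - int r)))"
    using sum.permute[OF assms, of "\<lambda>i. hall_p_h mu L (\<alpha>(i := \<alpha> i - int r))"] by (simp add: o_def)
  finally show ?case by (simp add: hall_p_h_Cons)
qed

text \<open>Placements of two parts commute, so only the multiset of parts matters
  (\<open>hall_p_h_mset\<close>). This later allows fixed points to be removed before or after the
  longer cycles.\<close>

lemma hall_p_h_move: "hall_p_h (xs @ r # ys) L \<alpha> = hall_p_h (r # xs @ ys) L \<alpha>"
proof (induction xs arbitrary: \<alpha>)
  case (Cons x xs)
  have "hall_p_h ((x # xs) @ r # ys) L \<alpha> =
    (\<Sum>i<L. \<Sum>j<L. hall_p_h (xs @ ys) L ((\<alpha>(i := \<alpha> i - int x))(j := (\<alpha>(i := \<alpha> i - int x)) j - int r)))"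
    by (simp only: append_Cons hall_p_h_Cons Cons.IH)
  also have "\<dots> = (\<Sum>i<L. \<Sum>j<L. hall_p_h (xs @ ys) L ((\<alpha>(j := \<alpha> j - int r))(i := (\<alpha>(j := \<alpha> j - int r)) i - int x)))"
    by (intro sum.cong hall_p_h_cong) auto
  also have "\<dots> = hall_p_h (r # (x # xs) @ ys) L \<alpha>"
    by (subst sum.swap) (simp only: append_Cons hall_p_h_Cons)
  finally show ?case .
qed simp

lemma hall_p_h_mset:
  assumes "mset mu = mset mu'"
  shows "hall_p_h mu L \<alpha> = hall_p_h mu' L \<alpha>"
  using assms
proof (induction mu arbitrary: mu' \<alpha>)
  case (Cons r mu)
  then have "r \<in> set mu'" by (metis list.set_intros(1) mset_eq_setD)
  then obtain xs ys where mu': "mu' = xs @ r # ys" by (metis split_list)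
  then have "mset mu = mset (xs @ ys)" using Cons.prems by simp
  then have "hall_p_h mu L \<beta> = hall_p_h (xs @ ys) L \<beta>" for \<beta> by (rule Cons.IH)
  then show ?case unfolding mu' hall_p_h_move hall_p_h_Cons by simp
qed simp

lemma hall_p_h_neg:
  assumes "i < L" "\<alpha> i < 0"
  shows "hall_p_h mu L \<alpha> = 0"
proof -
  have "int x \<noteq> \<alpha> i" for x using assms by linarith
  then have "{f. f \<in> {..<length mu} \<rightarrow>\<^sub>E {..<L}
      \<and> (\<forall>i<L. int (\<Sum>j | j < length mu \<and> f j = i. mu ! j) = \<alpha> i)} = {}"
    using assms(1) by blast
  then show ?thesis unfolding hall_p_h_def by (simp only: card.empty)
qed

section \<open>Determinant-like rules for the alternating sums\<close>

lemma jt_mset: "mset mu = mset mu' \<Longrightarrow> jt mu L l k = jt mu' L l k"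
  unfolding jt_def by (simp add: hall_p_h_mset[of mu mu'])

lemma jt_cong:
  assumes "\<And>i. i < L \<Longrightarrow> l i = l' i" "\<And>i. i < L \<Longrightarrow> k i = k' i"
  shows "jt mu L l k = jt mu L l' k'"
  unfolding jt_def
proof (intro sum.cong refl arg_cong2[where f = "(*)"] arg_cong[where f = int] hall_p_h_cong)
  fix w i assume "w \<in> {w. w permutes {..<L}}" "i < L"
  then have "w i < L" using permutes_in_image by fastforce
  then show "l i - k (w i) = l' i - k' (w i)" using assms \<open>i < L\<close> by simp
qed

text \<open>Placing the part \<open>r\<close> in row \<open>i\<close> lowers \<open>l i\<close> and
  leaves the permutation \<open>w\<close> untouched, so the two sums can be exchanged.\<close>

lemma jt_Cons: "jt (r # mu) L l k = (\<Sum>i<L. jt mu L (l(i := l i - int r)) k)"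
proof -
  have "jt (r # mu) L l k = (\<Sum>w | w permutes {..<L}. \<Sum>i<L. sign w * int (hall_p_h mu L (\<lambda>j. (l(i := l i - int r)) j - k (w j))))"
    unfolding jt_def hall_p_h_Cons of_nat_sum sum_distrib_left
    by (intro sum.cong refl arg_cong2[where f = "(*)"] arg_cong[where f = int] hall_p_h_cong) auto
  then show ?thesis unfolding jt_def by (subst (asm) sum.swap)
qed

text \<open>By substituting \<open>v o w o u^-1\<close> for \<open>w\<close>. The sum alternates in
  rows and columns like a determinant, although its terms are not products of entries.\<close>

lemma jt_permute:
  assumes u: "u permutes {..<L}" and v: "v permutes {..<L}"
  shows "jt mu L (\<lambda>i. l (u i)) (\<lambda>i. k (v i)) = sign u * sign v * jt mu L l k"
proof -
  let ?g = "\<lambda>w. v \<circ> w \<circ> inv_into UNIV u"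
  have bij: "bij_betw ?g {w. w permutes {..<L}} {w. w permutes {..<L}}"
    by (rule bij_betw_byWitness[where f' = "\<lambda>w. inv_into UNIV v \<circ> w \<circ> u"])
       (use u v in \<open>auto simp: fun_eq_iff permutes_inverses intro!: permutes_compose permutes_inv\<close>)
  have sg: "sign (?g w) = sign u * sign v * sign w" if "w permutes {..<L}" for w
  proof -
    have p: "permutation w" "permutation v" "permutation (inv_into UNIV u)" "permutation u"
      using that u v permutes_inv[OF u] by (auto intro: permutes_imp_permutation[of "{..<L}"])
    then show ?thesis
      by (simp add: sign_compose sign_inverse permutation_compose)
  qed
  have "jt mu L l k = (\<Sum>w | w permutes {..<L}. sign (?g w) * int (hall_p_h mu L (\<lambda>i. l i - k (?g w i))))"
    unfolding jt_def by (rule sum.reindex_bij_betw[OF bij, symmetric])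
  also have "\<dots> = (\<Sum>w | w permutes {..<L}. sign u * sign v * (sign w * int (hall_p_h mu L (\<lambda>i. l (u i) - k (v (w i))))))"
  proof (intro sum.cong refl)
    fix w assume "w \<in> {w. w permutes {..<L}}"
    then have w: "w permutes {..<L}" by simp
    have "hall_p_h mu L (\<lambda>i. l i - k (?g w i)) = hall_p_h mu L (\<lambda>i. l (u i) - k (?g w (u i)))"
      by (rule hall_p_h_permute[OF u, symmetric])
    also have "\<dots> = hall_p_h mu L (\<lambda>i. l (u i) - k (v (w i)))"
      using permutes_inverses(2)[OF u] by simp
    finally show "sign (?g w) * int (hall_p_h mu L (\<lambda>i. l i - k (?g w i))) =
      sign u * sign v * (sign w * int (hall_p_h mu L (\<lambda>i. l (u i) - k (v (w i)))))"
      by (simp add: sg[OF w])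
  qed
  also have "\<dots> = sign u * sign v * jt mu L (\<lambda>i. l (u i)) (\<lambda>i. k (v i))"
    by (simp add: jt_def sum_distrib_left)
  finally have "sign u * sign v * jt mu L l k = (sign u * sign u) * (sign v * sign v) * jt mu L (\<lambda>i. l (u i)) (\<lambda>i. k (v i))"
    by (simp add: algebra_simps)
  then show ?thesis by (simp add: sign_idempotent)
qed

lemma jt_repeat:
  assumes "i < L" "j < L" "i \<noteq> j" "l i = l j"
  shows "jt mu L l k = 0"
proof -
  have t: "Transposition.transpose i j permutes {..<L}" using assms by (intro permutes_swap_id) auto
  have "(\<lambda>x. l (Transposition.transpose i j x)) = l"
    using assms(4) by (auto simp: Transposition.transpose_def)
  then have "jt mu L l k = sign (Transposition.transpose i j) * jt mu L l k"
    using jt_permute[OF t permutes_id[of "{..<L}"], where l = l and k = k] by (simp add: sign_id)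
  then show ?thesis using assms(3) by (simp add: sign_swap_id)
qed

lemma jt_neg:
  assumes "i < L" "l i < 0" "\<And>j. j < L \<Longrightarrow> 0 \<le> k j"
  shows "jt mu L l k = 0"
  unfolding jt_def
proof (intro sum.neutral ballI)
  fix w assume "w \<in> {w. w permutes {..<L}}"
  then have "w i < L" using permutes_in_image assms(1) by fastforce
  then have "l i - k (w i) < 0" using assms(2) assms(3)[of "w i"] by simp
  then show "sign w * int (hall_p_h mu L (\<lambda>i. l i - k (w i))) = 0"
    using hall_p_h_neg[OF assms(1), where \<alpha> = "\<lambda>i. l i - k (w i)"] by simp
qed

text \<open>Partitions are encoded by their beta sets \<open>X\<close>, all of the same cardinality: removing a rim hook of
  length \<open>r\<close> means moving an element \<open>x\<close> of \<open>X\<close> to the free site \<open>x - r\<close>.\<close>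

definition enum :: "nat set \<Rightarrow> nat \<Rightarrow> int" where
  "enum X i = int (sorted_list_of_set X ! i)"

definition jts :: "nat list \<Rightarrow> nat set \<Rightarrow> nat set \<Rightarrow> int" where
  "jts mu X Y = jt mu (card X) (enum X) (enum Y)"

definition legal :: "nat \<Rightarrow> nat set \<Rightarrow> nat set" where
  "legal r X = {x \<in> X. r \<le> x \<and> x - r \<notin> X}"

definition mv :: "nat \<Rightarrow> nat \<Rightarrow> nat set \<Rightarrow> nat set" where
  "mv r x X = insert (x - r) (X - {x})"

section \<open>Beta sets and the Murnaghan--Nakayama rule\<close>

lemma enum_strict_mono:
  assumes "i < j" "j < card X"
  shows "enum X i < enum X j"
proof -
  have "finite X" using assms by (metis card.infinite not_less_zero)
  then show ?thesis using assms unfolding enum_def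
    by (simp add: strict_sorted_list_of_set sorted_wrt_nth_less)
qed

lemma enum_image:
  assumes "finite X"
  shows "enum X ` {..<card X} = int ` X"
proof -
  have "X = set (sorted_list_of_set X)" using assms by simp
  also have "\<dots> = (\<lambda>i. sorted_list_of_set X ! i) ` {..<card X}"
    using assms by (simp add: set_conv_nth image_def Bex_def) (metis sorted_list_of_set.length_sorted_key_list_of_set)
  finally have "int ` X = int ` (\<lambda>i. sorted_list_of_set X ! i) ` {..<card X}" by simp
  then show ?thesis unfolding image_image enum_def by simp
qed

lemma enum_inj: "inj_on (enum X) {..<card X}"
  by (rule linorder_inj_onI) (use enum_strict_mono in \<open>fastforce+\<close>)

lemma enum_nonneg: "0 \<le> enum X i"
  by (simp add: enum_def)

lemma enum_unique:
  assumes "\<And>i j. i < j \<Longrightarrow> j < L \<Longrightarrow> l i < l j" "l ` {..<L} = int ` X" "i < L"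
  shows "l i = enum X i"
proof -
  have nn: "0 \<le> l j" if "j < L" for j
    using assms(2) that by (metis imageE imageI lessThan_iff of_nat_0_le_iff)
  let ?xs = "map (\<lambda>i. nat (l i)) [0..<L]"
  have "sorted_wrt (<) ?xs"
    using assms(1) nn by (auto simp: sorted_wrt_iff_nth_less zless_nat_conj) (metis le_less_trans less_trans)+
  moreover have "set ?xs = X"
  proof -
    have "set ?xs = nat ` l ` {..<L}" by (simp add: image_image atLeast0LessThan)
    also have "\<dots> = X" unfolding assms(2) by (simp add: image_image)
    finally show ?thesis .
  qed
  ultimately have "?xs = sorted_list_of_set X"
    by (metis List.finite_set sorted_list_of_set.idem_if_sorted_distinct strict_sorted_iff strict_sorted_equal strict_sorted_list_of_set set_sorted_list_of_set)
  then have "sorted_list_of_set X ! i = nat (l i)" using assms(3) by (metis (no_types, lifting) add_0 diff_zero length_upt nth_map nth_upt)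
  then show ?thesis using nn[OF assms(3)] by (simp add: enum_def)
qed

text \<open>The sorting permutation; its sign becomes the sign of a hook in
  \<open>jts_Cons\<close>.\<close>

lemma enum_permute:
  assumes X: "finite X" "card X = L" and l: "inj_on l {..<L}" "l ` {..<L} = int ` X"
  shows "\<exists>u. u permutes {..<L} \<and> (\<forall>i<L. l i = enum X (u i))"
proof -
  define u where "u i = (if i < L then inv_into {..<L} (enum X) (l i) else i)" for i
  have im: "enum X ` {..<L} = int ` X" using enum_image[OF X(1)] X(2) by simp
  have inj: "inj_on (enum X) {..<L}" using enum_inj[of X] X(2) by simp
  have "bij_betw (enum X) {..<L} (int ` X)" using im inj by (simp add: bij_betw_def)
  then have "bij_betw (inv_into {..<L} (enum X)) (int ` X) {..<L}" by (rule bij_betw_inv_into)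
  moreover have "bij_betw l {..<L} (int ` X)" using l by (simp add: bij_betw_def)
  ultimately have "bij_betw (inv_into {..<L} (enum X) \<circ> l) {..<L} {..<L}"
    using bij_betw_trans by blast
  then have "bij_betw u {..<L} {..<L}"
    by (rule bij_betw_cong[THEN iffD1, rotated]) (simp add: u_def)
  then have "u permutes {..<L}" by (rule bij_imp_permutes) (simp add: u_def)
  moreover have "l i = enum X (u i)" if "i < L" for i
  proof -
    have "l i \<in> enum X ` {..<L}" using that l(2) im by blast
    then show ?thesis using that by (simp add: u_def f_inv_into_f)
  qed
  ultimately show ?thesis by blast
qed

lemma legal_subset: "legal r X \<subseteq> X"
  by (auto simp: legal_def)

lemma finite_legal: "finite X \<Longrightarrow> finite (legal r X)"
  by (rule finite_subset[OF legal_subset])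

lemma finite_mv: "finite X \<Longrightarrow> finite (mv r x X)"
  by (simp add: mv_def)

lemma card_mv: "finite X \<Longrightarrow> x \<in> legal r X \<Longrightarrow> card (mv r x X) = card X"
  by (auto simp: mv_def legal_def card_insert_if card_Diff_singleton_if) (metis Suc_pred card_gt_0_iff empty_iff)

lemma jts_mset: "mset mu = mset mu' \<Longrightarrow> jts mu X Y = jts mu' X Y"
  unfolding jts_def by (rule jt_mset)

text \<open>The Murnaghan--Nakayama rule before sorting. A jump below 0 gives a negative row
  (\<open>jt_neg\<close>) and a jump onto an occupied site two equal rows
  (\<open>jt_repeat\<close>), so only legal particles survive. The lowered row is named by its value
  \<open>x\<close> and not by its index, so that the sum runs over sites.\<close>

lemma jt_sum_legal:
  assumes X: "finite X" and r: "0 < r" and Y: "card Y = card X"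
  shows "jts (r # mu) X Y =
    (\<Sum>x\<in>legal r X. jt mu (card X) (\<lambda>j. if enum X j = int x then enum X j - int r else enum X j) (enum Y))"
proof -
  let ?L = "card X"
  define I where "I = {i. i < ?L \<and> enum X i \<in> int ` legal r X}"
  define G where "G y = jt mu ?L (\<lambda>j. if enum X j = y then enum X j - int r else enum X j) (enum Y)" for y
  have eq: "jt mu ?L ((enum X)(i := enum X i - int r)) (enum Y) = G (enum X i)" if "i < ?L" for i
    unfolding G_def using that enum_inj[of X] by (intro jt_cong) (auto simp: inj_on_def)
  have "jts (r # mu) X Y = (\<Sum>i<?L. G (enum X i))"
    unfolding jts_def jt_Cons using eq by (intro sum.cong) auto
  also have "\<dots> = (\<Sum>i\<in>I. G (enum X i))"
  proof (rule sum.mono_neutral_right)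
    show "\<forall>i\<in>{..<?L} - I. G (enum X i) = 0"
    proof
      fix i assume i: "i \<in> {..<?L} - I"
      then have iL: "i < ?L" by simp
      have "enum X i \<in> int ` X" using enum_image[OF X] iL by blast
      then obtain x where x: "x \<in> X" "enum X i = int x" by blast
      then have "x \<notin> legal r X" using i by (auto simp: I_def)
      then consider "x < r" | "r \<le> x" "x - r \<in> X" using x(1) unfolding legal_def by fastforce
      then show "G (enum X i) = 0"
      proof cases
        case 1
        then show ?thesis unfolding G_def
          using iL x by (intro jt_neg[of i]) (auto simp: enum_nonneg)
      next
        case 2
        then have "int (x - r) \<in> enum X ` {..<?L}" using enum_image[OF X] by blast
        then obtain j where j: "j < ?L" "enum X j = int (x - r)" by auto
        have "enum X j \<noteq> enum X i" using j x 2 r by auto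
        then show ?thesis unfolding G_def
          using iL x j 2 by (intro jt_repeat[of i _ j]) (auto simp: of_nat_diff)
      qed
    qed
  qed (auto simp: I_def)
  also have "\<dots> = (\<Sum>y\<in>int ` legal r X. G y)"
  proof (rule sum.reindex_bij_betw)
    have "enum X ` I = int ` legal r X"
    proof
      show "int ` legal r X \<subseteq> enum X ` I"
      proof
        fix y assume y: "y \<in> int ` legal r X"
        then have "y \<in> enum X ` {..<?L}" using enum_image[OF X] legal_subset by blast
        then show "y \<in> enum X ` I" using y by (auto simp: I_def)
      qed
    qed (auto simp: I_def)
    moreover have "inj_on (enum X) I" by (rule inj_on_subset[OF enum_inj]) (auto simp: I_def)
    ultimately show "bij_betw (enum X) I (int ` legal r X)" by (simp add: bij_betw_def)
  qed
  also have "\<dots> = (\<Sum>x\<in>legal r X. G (int x))" by (subst sum.reindex) auto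
  finally show ?thesis unfolding G_def .
qed

lemma shifted_enum_image:
  assumes X: "finite X" and x: "x \<in> legal r X" and r: "0 < r"
  defines "l \<equiv> \<lambda>j. if enum X j = int x then enum X j - int r else enum X j"
  shows "inj_on l {..<card X}" "l ` {..<card X} = int ` mv r x X"
proof -
  have im: "enum X ` {..<card X} = int ` X" by (rule enum_image[OF X])
  have xl: "x \<in> X" "r \<le> x" "x - r \<notin> X" using x by (auto simp: legal_def)
  have "l ` {..<card X} = (\<lambda>y. if y = int x then y - int r else y) ` enum X ` {..<card X}"
    unfolding l_def by (rule image_image[symmetric])
  also have "\<dots> = int ` (\<lambda>y. if y = x then x - r else y) ` X"
    unfolding im using xl by (auto simp: image_image of_nat_diff intro!: image_cong)
  also have "(\<lambda>y. if y = x then x - r else y) ` X = mv r x X"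
    using xl by (auto simp: mv_def)
  finally show "l ` {..<card X} = int ` mv r x X" .
  then have "card (l ` {..<card X}) = card {..<card X}"
    using card_mv[OF X x] by (simp add: card_image)
  then show "inj_on l {..<card X}" by (simp add: eq_card_imp_inj_on)
qed

text \<open>Sorting the lowered row into place costs the sign of a permutation that depends on
  \<open>X\<close>, \<open>r\<close> and \<open>x\<close> only. The order of the quantifiers records
  exactly this, and \<open>hook_sign\<close> relies on it.\<close>

lemma jts_Cons:
  assumes X: "finite X" and r: "0 < r"
  shows "\<exists>sg. (\<forall>x. sg x \<in> {1, -1::int}) \<and>
    (\<forall>mu Y. card Y = card X \<longrightarrow> jts (r # mu) X Y = (\<Sum>x\<in>legal r X. sg x * jts mu (mv r x X) Y))"
proof -
  let ?l = "\<lambda>x j. if enum X j = int x then enum X j - int r else enum X j"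
  have "\<forall>x. \<exists>s\<in>{1, -1::int}. x \<in> legal r X \<longrightarrow> (\<forall>mu Y. jt mu (card X) (?l x) (enum Y) = s * jts mu (mv r x X) Y)"
  proof
    fix x
    show "\<exists>s\<in>{1, -1::int}. x \<in> legal r X \<longrightarrow> (\<forall>mu Y. jt mu (card X) (?l x) (enum Y) = s * jts mu (mv r x X) Y)"
    proof (cases "x \<in> legal r X")
      case True
      note l = shifted_enum_image[OF X True r]
      obtain u where u: "u permutes {..<card X}" "\<And>i. i < card X \<Longrightarrow> ?l x i = enum (mv r x X) (u i)"
        using enum_permute[OF finite_mv[OF X] card_mv[OF X True] l] by blast
      have "jt mu (card X) (?l x) (enum Y) = sign u * jts mu (mv r x X) Y" for mu Y
      proof -
        have "jt mu (card X) (?l x) (enum Y) = jt mu (card X) (\<lambda>i. enum (mv r x X) (u i)) (\<lambda>i. enum Y (id i))"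
          by (rule jt_cong) (use u(2) in auto)
        also have "\<dots> = sign u * jts mu (mv r x X) Y"
          by (subst jt_permute[OF u(1) permutes_id]) (simp add: jts_def card_mv[OF X True])
        finally show ?thesis .
      qed
      moreover have "sign u \<in> {1, -1}" by (auto simp: sign_def)
      ultimately show ?thesis by blast
    qed auto
  qed
  then obtain sg where sg: "\<And>x. sg x \<in> {1, -1::int}"
    "\<And>x mu Y. x \<in> legal r X \<Longrightarrow> jt mu (card X) (?l x) (enum Y) = sg x * jts mu (mv r x X) Y"
    by metis
  then show ?thesis using jt_sum_legal[OF X r] by (intro exI[of _ sg]) simp
qed

text \<open>A jump by one cannot pass another particle, so the rows stay increasing and no sign
  appears: this is the branching rule.\<close>

lemma jts_Cons_1:
  assumes X: "finite X" and Y: "card Y = card X"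
  shows "jts (1 # mu) X Y = (\<Sum>x\<in>legal 1 X. jts mu (mv 1 x X) Y)"
  unfolding jt_sum_legal[OF X less_numeral_extra(1) Y]
proof (rule sum.cong[OF refl])
  fix x assume x: "x \<in> legal 1 X"
  let ?l = "\<lambda>j. if enum X j = int x then enum X j - int 1 else enum X j"
  have "?l i < ?l j" if "i < j" "j < card X" for i j
  proof -
    have "enum X i < enum X j" using that by (rule enum_strict_mono)
    moreover have "enum X i \<noteq> int x - 1"
    proof
      assume "enum X i = int x - 1"
      moreover have "enum X i \<in> int ` X" using enum_image[OF X] that by force
      ultimately obtain y where "y \<in> X" "int y = int x - 1" by auto
      then have "y = x - 1" by linarith
      then show False using \<open>y \<in> X\<close> x by (simp add: legal_def)
    qed
    ultimately show ?thesis by auto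
  qed
  then have "?l i = enum (mv 1 x X) i" if "i < card X" for i
    using enum_unique[of "card X" ?l "mv 1 x X" i] shifted_enum_image(2)[OF X x less_numeral_extra(1)] that by blast
  then show "jt mu (card X) ?l (enum Y) = jts mu (mv 1 x X) Y"
    unfolding jts_def card_mv[OF X x] by (intro jt_cong) auto
qed

text \<open>All exponents must vanish, so \<open>w\<close> has to match two increasing enumerations
  entry by entry; this forces \<open>X = Y\<close> and \<open>w = id\<close>.\<close>

lemma jts_Nil:
  assumes X: "finite X" and Y: "finite Y" "card Y = card X"
  shows "jts [] X Y = (if X = Y then 1 else 0)"
proof -
  let ?L = "card X"
  have z: "hall_p_h [] ?L (\<lambda>i. enum X i - enum Y (w i)) = (if X = Y \<and> w = id then 1 else 0)"
    if w: "w permutes {..<?L}" for w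
  proof -
    have "X = Y \<and> w = id" if h: "\<forall>i<?L. enum X i = enum Y (w i)"
    proof
      have "int ` X = enum X ` {..<?L}" using enum_image[OF X] by simp
      also have "\<dots> = enum Y ` w ` {..<?L}" using h by (auto simp: image_image)
      also have "\<dots> = int ` Y" using enum_image[OF Y(1)] Y(2) permutes_image[OF w] by simp
      finally show XY: "X = Y" by (simp add: inj_image_eq_iff)
      show "w = id"
      proof
        fix i
        show "w i = id i"
        proof (cases "i < ?L")
          case True
          then have "w i < ?L" using permutes_in_image[OF w] by simp
          then show ?thesis using h True enum_inj[of X] XY by (auto simp: inj_on_def)
        qed (use w in \<open>auto simp: permutes_def\<close>)
      qed
    qed
    then show ?thesis by (auto simp: hall_p_h_Nil)
  qed
  have "jts [] X Y = (\<Sum>w | w permutes {..<?L}. if X = Y \<and> w = id then 1 else 0)"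
    unfolding jts_def jt_def using z by (intro sum.cong) (auto simp: sign_id)
  also have "\<dots> = (if X = Y then 1 else 0)"
    by (cases "X = Y") (simp_all add: permutes_id finite_permutations)
  finally show ?thesis .
qed

section \<open>Determinants of falling factorials\<close>

definition ff :: "nat \<Rightarrow> nat \<Rightarrow> real" where
  "ff x k = (\<Prod>i<k. real x - real i)"

lemma ff_0 [simp]: "ff x 0 = 1"
  by (simp add: ff_def)

lemma ff_Suc: "ff x (Suc k) = ff x k * (real x - real k)"
  by (simp add: ff_def mult.commute)

lemma ff_eq_0: "x < k \<Longrightarrow> ff x k = 0"
  unfolding ff_def by (rule prod_zero) auto

text \<open>The discrete analogue of the derivative of \<open>x^k\<close>; summed up in
  \<open>ff_sum_diff\<close>, it provides the interlacing expansion.\<close>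

lemma ff_diff: "ff (Suc x) k - ff x k = real k * ff x (k - 1)"
proof (induction k)
  case (Suc k)
  show ?case
  proof (cases k)
    case (Suc k')
    have "ff (Suc x) (Suc k) - ff x (Suc k)
      = (ff (Suc x) k - ff x k) * (real x + 1 - real k) + ff x k"
      by (simp add: ff_Suc algebra_simps)
    also have "\<dots> = real (Suc k) * ff x k"
      unfolding Suc.IH using Suc by (simp add: ff_Suc algebra_simps)
    finally show ?thesis by simp
  qed (simp add: ff_Suc)
qed simp

lemma ff_sum_diff:
  assumes "a \<le> b"
  shows "ff b k - ff a k = real k * (\<Sum>x=a..<b. ff x (k - 1))"
  using assms
proof (induction b rule: dec_induct)
  case (step b)
  have "ff (Suc b) k - ff a k = (ff (Suc b) k - ff b k) + (ff b k - ff a k)" by simp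
  also have "\<dots> = real k * (\<Sum>x=a..<Suc b. ff x (k - 1))"
    unfolding step.IH ff_diff using step.hyps by (simp add: algebra_simps)
  finally show ?case .
qed simp

lemma ff_add:
  assumes "c \<le> x"
  shows "ff x (c + k) = ff x c * ff (x - c) k"
  by (induction k) (use assms in \<open>auto simp: ff_Suc of_nat_diff algebra_simps\<close>)

lemma ff_fact:
  assumes "k \<le> x"
  shows "ff x k * fact (x - k) = fact x"
  using assms
proof (induction k)
  case (Suc k)
  then have "x - k = Suc (x - Suc k)" by simp
  then have "fact (x - k) = (real x - real k) * fact (x - Suc k)"
    using Suc.prems by (simp add: of_nat_diff)
  then show ?case using Suc by (simp add: ff_Suc mult.assoc)
qed simp

lemma ff_nonneg: "0 \<le> ff x k"
proof (cases "x < k")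
  case False
  then show ?thesis unfolding ff_def by (intro prod_nonneg) auto
qed (simp add: ff_eq_0)

lemma ff_le_power:
  assumes "x \<le> m"
  shows "ff x k \<le> real m ^ k"
proof (cases "x < k")
  case False
  have "ff x k \<le> (\<Prod>i<k. real m)" unfolding ff_def
    using assms False by (intro prod_mono) auto
  then show ?thesis by simp
qed (simp add: ff_eq_0)

text \<open>Up to the factor in \<open>jt_ones\<close> this is Aitken's determinant for the number
  of standard tableaux of the skew shape with beta numbers \<open>l\<close> and
  \<open>k\<close>.\<close>

definition tdet :: "nat \<Rightarrow> (nat \<Rightarrow> nat) \<Rightarrow> (nat \<Rightarrow> nat) \<Rightarrow> real" where
  "tdet L l k = Determinant.det (Matrix.mat L L (\<lambda>(i, j). ff (l i) (k j)))"

section \<open>Determinant rules for matrices given by their entries\<close>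

lemma det_mat_Leibniz:
  fixes f :: "nat \<Rightarrow> nat \<Rightarrow> real"
  shows "Determinant.det (Matrix.mat L L (\<lambda>(i, j). f i j)) =
    (\<Sum>w | w permutes {..<L}. of_int (sign w) * (\<Prod>i<L. f i (w i)))"
proof -
  have "Determinant.det (Matrix.mat L L (\<lambda>(i, j). f i j)) =
    (\<Sum>w | w permutes {0..<L}. signof w * (\<Prod>i=0..<L. Matrix.mat L L (\<lambda>(i, j). f i j) $$ (i, w i)))"
    by (rule det_def') simp
  also have "\<dots> = (\<Sum>w | w permutes {..<L}. of_int (sign w) * (\<Prod>i<L. f i (w i)))"
    unfolding lessThan_atLeast0[symmetric]
  proof (intro sum.cong refl arg_cong2[where f = "(*)"] prod.cong)
    fix w i assume "w \<in> {w. w permutes {..<L}}" "i \<in> {..<L}"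
    then have "w i < L" using permutes_in_image by fastforce
    then show "Matrix.mat L L (\<lambda>(i, j). f i j) $$ (i, w i) = f i (w i)" using \<open>i \<in> _\<close> by simp
  qed
  finally show ?thesis .
qed

lemma det_mat_row_scale:
  fixes f :: "nat \<Rightarrow> nat \<Rightarrow> real"
  shows "Determinant.det (Matrix.mat L L (\<lambda>(i, j). c i * f i j )) =
    (\<Prod>i<L. c i) * Determinant.det (Matrix.mat L L (\<lambda>(i, j). f i j))"
  unfolding det_mat_Leibniz by (simp add: prod.distrib sum_distrib_left mult_ac)

lemma det_mat_col_scale:
  fixes f :: "nat \<Rightarrow> nat \<Rightarrow> real"
  shows "Determinant.det (Matrix.mat L L (\<lambda>(i, j). c j * f i j )) =
    (\<Prod>i<L. c i) * Determinant.det (Matrix.mat L L (\<lambda>(i, j). f i j))"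
proof -
  have "(\<Prod>i<L. c (w i)) = (\<Prod>i<L. c i)" if "w permutes {..<L}" for w
    using prod.permute[OF that, of c] by (simp add: o_def)
  then show ?thesis
    unfolding det_mat_Leibniz by (simp add: prod.distrib sum_distrib_left mult_ac)
qed

lemma det_mat_row_sum:
  fixes g :: "'a \<Rightarrow> nat \<Rightarrow> real"
  assumes "\<And>i. i < L \<Longrightarrow> finite (S i)"
  shows "Determinant.det (Matrix.mat L L (\<lambda>(i, j). \<Sum>x\<in>S i. g x j )) =
    (\<Sum>x\<in>PiE {..<L} S. Determinant.det (Matrix.mat L L (\<lambda>(i, j). g (x i) j)))"
proof -
  have "(\<Prod>i<L. \<Sum>x\<in>S i. g x (w i)) = (\<Sum>x\<in>PiE {..<L} S. \<Prod>i<L. g (x i) (w i))" for w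
    using assms by (subst prod_sum_PiE) auto
  then show ?thesis
    unfolding det_mat_Leibniz sum_distrib_left by (simp add: sum_distrib_left) (rule sum.swap)
qed

lemma det_mat_minor_col:
  fixes f :: "nat \<Rightarrow> nat \<Rightarrow> real"
  assumes "f 0 0 = 1" "\<And>i. i < L \<Longrightarrow> f (Suc i) 0 = 0"
  shows "Determinant.det (Matrix.mat (Suc L) (Suc L) (\<lambda>(i, j). f i j )) =
    Determinant.det (Matrix.mat L L (\<lambda>(i, j). f (Suc i) (Suc j)))"
proof -
  let ?A = "Matrix.mat (Suc L) (Suc L) (\<lambda>(i, j). f i j)"
  have "Determinant.det ?A = (\<Sum>i<Suc L. ?A $$ (i, 0) * cofactor ?A i 0)"
    by (rule laplace_expansion_column) auto
  also have "\<dots> = cofactor ?A 0 0"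
    unfolding sum.lessThan_Suc_shift using assms by simp
  also have "\<dots> = Determinant.det (mat_delete ?A 0 0)" by (simp add: cofactor_def)
  also have "mat_delete ?A 0 0 = Matrix.mat L L (\<lambda>(i, j). f (Suc i) (Suc j))"
    by (rule eq_matI) (auto simp: mat_delete_def)
  finally show ?thesis .
qed

lemma det_mat_transpose:
  fixes f :: "nat \<Rightarrow> nat \<Rightarrow> real"
  shows "Determinant.det (Matrix.mat L L (\<lambda>(i, j). f i j )) =
   Determinant.det (Matrix.mat L L (\<lambda>(i, j). f j i))"
proof -
  have "transpose_mat (Matrix.mat L L (\<lambda>(i, j). f i j)) = Matrix.mat L L (\<lambda>(i, j). f j i)"
    by (rule eq_matI) auto
  then show ?thesis using Determinant.det_transpose[of "Matrix.mat L L (\<lambda>(i, j). f i j)" L] by simp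
qed

text \<open>All rows change at once, each by the old preceding row: this is multiplication from the
  left by a unit lower triangular matrix.\<close>

lemma det_mat_row_op:
  fixes f :: "nat \<Rightarrow> nat \<Rightarrow> real"
  shows "Determinant.det (Matrix.mat L L (\<lambda>(i, j). f i j - (if i = 0 then 0 else c i * f (i - 1) j) )) =
   Determinant.det (Matrix.mat L L (\<lambda>(i, j). f i j))"
proof -
  let ?C = "Matrix.mat L L (\<lambda>(i, j). if i = j then 1 else if i = Suc j then - c i else 0)"
  let ?A = "Matrix.mat L L (\<lambda>(i, j). f i j)"
  have "Matrix.mat L L (\<lambda>(i, j). f i j - (if i = 0 then 0 else c i * f (i - 1) j)) = ?C * ?A"
  proof (rule eq_matI)
    fix i j assume "i < dim_row (?C * ?A)" "j < dim_col (?C * ?A)"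
    then have ij: "i < L" "j < L" by auto
    have "(?C * ?A) $$ (i, j) = (\<Sum>t<L. (if i = t then 1 else if i = Suc t then - c i else 0) * f t j)"
      using ij by (simp add: scalar_prod_def lessThan_atLeast0)
    also have "\<dots> = (\<Sum>t<L. (if t = i then f t j else 0) + (if i = Suc t then - c i * f t j else 0))"
      by (intro sum.cong) auto
    also have "\<dots> = f i j + (\<Sum>t<L. if i = Suc t then - c i * f t j else 0)"
      using ij by (simp add: sum.distrib)
    also have "\<dots> = f i j - (if i = 0 then 0 else c i * f (i - 1) j)"
    proof (cases i)
      case (Suc i')
      have "(\<Sum>t<L. if i = Suc t then - c i * f t j else 0) = (\<Sum>t<L. if t = i' then - c i * f t j else 0)"
        using Suc by (intro sum.cong) auto
      then show ?thesis using Suc ij by simp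
    qed simp
    finally show "Matrix.mat L L (\<lambda>(i, j). f i j - (if i = 0 then 0 else c i * f (i - 1) j)) $$ (i, j) = (?C * ?A) $$ (i, j)"
      using ij by simp
  qed auto
  moreover have "Determinant.det ?C = 1"
  proof -
    have "Determinant.det ?C = prod_list (diag_mat ?C)"
      by (rule det_lower_triangular[of L]) auto
    also have "diag_mat ?C = map (\<lambda>_. 1) [0..<L]" by (auto simp: diag_mat_def)
    finally show ?thesis by (simp add: map_replicate_const)
  qed
  ultimately show ?thesis by (subst \<open>_ = ?C * ?A\<close>, subst Determinant.det_mult[of _ L]) auto
qed

section \<open>Vandermonde products and the bound on skew determinants\<close>

definition vdm :: "nat \<Rightarrow> (nat \<Rightarrow> nat) \<Rightarrow> real" where
  "vdm L l = (\<Prod>i<L. \<Prod>j<i. real (l i) - real (l j))"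

lemma vdm_Suc: "vdm (Suc L) l = (\<Prod>i<L. real (l (Suc i)) - real (l 0)) * vdm L (\<lambda>i. l (Suc i))"
  unfolding vdm_def prod.lessThan_Suc_shift by (simp add: prod.distrib)

lemma vdm_pos:
  assumes "\<And>i j. i < j \<Longrightarrow> j < L \<Longrightarrow> l i < l j"
  shows "0 < vdm L l"
  unfolding vdm_def using assms by (intro prod_pos) auto

lemma vdm_shift:
  assumes "\<And>i. i < L \<Longrightarrow> c \<le> l i"
  shows "vdm L (\<lambda>i. l i - c) = vdm L l"
  unfolding vdm_def using assms by (intro prod.cong refl) (auto simp: of_nat_diff)

text \<open>\<open>ff x j\<close> is monic of degree \<open>j\<close> in \<open>x\<close>, so this
  is the Vandermonde determinant.\<close>

lemma tdet_id: "tdet L l (\<lambda>j. j) = vdm L l"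
proof (induction L arbitrary: l)
  case 0
  then show ?case by (simp add: tdet_def vdm_def)
next
  case (Suc L)
  \<comment> \<open>The multiplier \<open>l 0 - (j - 1)\<close> is chosen so that for
    \<open>j > 0\<close> the entry becomes \<open>(l i - l 0) * ff (l i) (j - 1)\<close>. It
    vanishes for \<open>i = 0\<close>, and one row and one column split off.\<close>
  let ?f = "\<lambda>j i. ff (l i) j - (if j = 0 then 0 else (real (l 0) - real (j - 1)) * ff (l i) (j - 1))"
  have "tdet (Suc L) l (\<lambda>j. j) = Determinant.det (Matrix.mat (Suc L) (Suc L) (\<lambda>(j, i). ff (l i) j))"
    unfolding tdet_def by (subst det_mat_transpose) simp
  also have "\<dots> = Determinant.det (Matrix.mat (Suc L) (Suc L) (\<lambda>(j, i). ?f j i))"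
    by (rule det_mat_row_op[symmetric])
  also have "\<dots> = Determinant.det (Matrix.mat L L (\<lambda>(j, i). ?f (Suc j) (Suc i)))"
    by (rule det_mat_minor_col) (auto simp: ff_Suc)
  also have "\<dots> = Determinant.det (Matrix.mat L L (\<lambda>(j, i). (real (l (Suc i)) - real (l 0)) * ff (l (Suc i)) j))"
    by (intro arg_cong[where f = Determinant.det] cong_mat) (auto simp: ff_Suc algebra_simps)
  also have "\<dots> = (\<Prod>i<L. real (l (Suc i)) - real (l 0)) * Determinant.det (Matrix.mat L L (\<lambda>(j, i). ff (l (Suc i)) j))"
    by (rule det_mat_col_scale)
  also have "Determinant.det (Matrix.mat L L (\<lambda>(j, i). ff (l (Suc i)) j)) = vdm L (\<lambda>i. l (Suc i))"
    unfolding Suc.IH[symmetric] tdet_def by (rule det_mat_transpose)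
  finally show ?case by (simp add: vdm_Suc)
qed

lemma tdet_cong:
  assumes "\<And>i. i < L \<Longrightarrow> l i = l' i" "\<And>i. i < L \<Longrightarrow> k i = k' i"
  shows "tdet L l k = tdet L l' k'"
  unfolding tdet_def using assms by (intro arg_cong[where f = Determinant.det] cong_mat) auto

text \<open>Consecutive rows are subtracted; by multilinearity the differences \<open>ff b k - ff a k\<close> turn into
  a sum over all sequences interlacing with \<open>l\<close>.\<close>
lemma tdet_interlace:
  assumes "k 0 = 0" "\<And>i. i < L \<Longrightarrow> l i \<le> l (Suc i)"
  shows "tdet (Suc L) l k = (\<Prod>j<L. real (k (Suc j))) *
    (\<Sum>x\<in>(\<Pi>\<^sub>E i\<in>{..<L}. {l i..<l (Suc i)}). tdet L x (\<lambda>j. k (Suc j) - 1))"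
proof -
  let ?f = "\<lambda>i j. ff (l i) (k j) - (if i = 0 then 0 else 1 * ff (l (i - 1)) (k j))"
  have "tdet (Suc L) l k = Determinant.det (Matrix.mat (Suc L) (Suc L) (\<lambda>(i, j). ?f i j))"
    unfolding tdet_def by (rule det_mat_row_op[symmetric])
  also have "\<dots> = Determinant.det (Matrix.mat L L (\<lambda>(i, j). ?f (Suc i) (Suc j)))"
    by (rule det_mat_minor_col) (auto simp: assms(1))
  also have "\<dots> = Determinant.det (Matrix.mat L L (\<lambda>(i, j). real (k (Suc j)) * (\<Sum>x\<in>{l i..<l (Suc i)}. ff x (k (Suc j) - 1))))"
    using assms(2) by (intro arg_cong[where f = Determinant.det] cong_mat) (auto simp: ff_sum_diff)
  also have "\<dots> = (\<Prod>j<L. real (k (Suc j))) * Determinant.det (Matrix.mat L L (\<lambda>(i, j). \<Sum>x\<in>{l i..<l (Suc i)}. ff x (k (Suc j) - 1)))"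
    by (rule det_mat_col_scale)
  also have "Determinant.det (Matrix.mat L L (\<lambda>(i, j). \<Sum>x\<in>{l i..<l (Suc i)}. ff x (k (Suc j) - 1))) =
    (\<Sum>x\<in>(\<Pi>\<^sub>E i\<in>{..<L}. {l i..<l (Suc i)}). tdet L x (\<lambda>j. k (Suc j) - 1))"
    unfolding tdet_def by (rule det_mat_row_sum) simp
  finally show ?thesis .
qed

text \<open>From \<open>ff x (c + k) = ff x c * ff (x - c) k\<close>. With \<open>c = k 0\<close> it
  brings the first column to the form that \<open>tdet_interlace\<close> expects.\<close>

lemma tdet_shift:
  assumes "\<And>i. i < L \<Longrightarrow> c \<le> l i" "\<And>i. i < L \<Longrightarrow> c \<le> k i"
  shows "tdet L l k = (\<Prod>i<L. ff (l i) c) * tdet L (\<lambda>i. l i - c) (\<lambda>j. k j - c)"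
proof -
  have "tdet L l k = Determinant.det (Matrix.mat L L (\<lambda>(i, j). ff (l i) c * ff (l i - c) (k j - c)))"
    unfolding tdet_def
  proof (intro arg_cong[where f = Determinant.det] cong_mat refl)
    fix i j assume "i < L" "j < L"
    then show "(case (i, j) of (i, j) \<Rightarrow> ff (l i) (k j)) = (case (i, j) of (i, j) \<Rightarrow> ff (l i) c * ff (l i - c) (k j - c))"
      using ff_add[OF assms(1), of i "k j - c"] assms(2)[of j] by simp
  qed
  then show ?thesis unfolding tdet_def by (simp only: det_mat_row_scale)
qed

lemma tdet_zero_row:
  assumes "i < L" "\<And>j. j < L \<Longrightarrow> l i < k j"
  shows "tdet L l k = 0"
  unfolding tdet_def det_mat_Leibniz
proof (intro sum.neutral ballI)
  fix w assume "w \<in> {w. w permutes {..<L}}"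
  then have "w i < L" using permutes_in_image assms(1) by fastforce
  then have "ff (l i) (k (w i)) = 0" using assms(2) by (intro ff_eq_0)
  then have "(\<Prod>i<L. ff (l i) (k (w i))) = 0" using assms(1) by (intro prod_zero) auto
  then show "of_int (sign w) * (\<Prod>i<L. ff (l i) (k (w i))) = 0" by simp
qed

lemma strict_incr_ge:
  fixes k :: "nat \<Rightarrow> nat"
  assumes "\<And>i j. i < j \<Longrightarrow> j < L \<Longrightarrow> k i < k j" "j < L"
  shows "k 0 + j \<le> k j"
  using assms(2)
proof (induction j)
  case (Suc j)
  then show ?case using assms(1)[of j "Suc j"] by simp
qed simp

text \<open>Equality holds for \<open>k j = j\<close>, where the product of factorials equals
  \<open>vdm L k\<close>. In the induction the interlacing expansion of \<open>tdet\<close> is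
  compared with that of the Vandermonde determinant, which runs over the same sequences; unless a
  row vanishes, \<open>ff x c <= m ^ c\<close> is the only loss. The exponent is the size of the
  partition with beta numbers \<open>k\<close>.\<close>

lemma tdet_le:
  assumes "\<And>i j. i < j \<Longrightarrow> j < L \<Longrightarrow> l i < l j" "\<And>i j. i < j \<Longrightarrow> j < L \<Longrightarrow> k i < k j"
    "\<And>i. i < L \<Longrightarrow> l i \<le> m"
  shows "tdet L l k \<le> real m ^ (\<Sum>j<L. k j - j) * vdm L l * vdm L k / (\<Prod>j<L. fact j)"
  using assms
proof (induction L arbitrary: l k)
  case 0
  then show ?case by (simp add: tdet_def vdm_def)
next
  case (Suc L)
  note l = Suc.prems(1) and k = Suc.prems(2) and m = Suc.prems(3)
  have Vl: "0 < vdm (Suc L) l" and Vk: "0 < vdm (Suc L) k" using vdm_pos l k by blast+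
  define c where "c = k 0"
  have ck: "c \<le> k j" if "j < Suc L" for j 
    using strict_incr_ge[of "Suc L" k j] k that unfolding c_def by (meson add_leD1)
  show ?case
  proof (cases "\<exists>i<Suc L. l i < c")
    \<comment> \<open>Every entry \<open>ff (l i) (k j)\<close> of such a row is 0, because
      \<open>l i < c <= k j\<close>.\<close>
    case True
    then obtain i where i: "i < Suc L" "l i < c" by blast
    have "tdet (Suc L) l k = 0"
      by (rule tdet_zero_row[OF i(1)]) (use ck i(2) in \<open>fastforce intro: less_le_trans\<close>)
    then show ?thesis using Vl Vk by (simp add: prod_nonneg)
  next
    case False
    then have cl: "c \<le> l i" if "i < Suc L" for i using that by (meson not_le)
    define l' where "l' i = l i - c" for i
    \<comment> \<open>First the shift by \<open>c\<close>, then the loss of one degree in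
      \<open>tdet_interlace\<close>.\<close>
    define k'' where "k'' j = k (Suc j) - c - 1" for j
    define P where "P = (\<Pi>\<^sub>E i\<in>{..<L}. {l' i..<l' (Suc i)})"
    have l'mono: "l' i \<le> l' (Suc i)" if "i < L" for i
      using l[of i "Suc i"] that unfolding l'_def by simp
    have k''j: "k (Suc j) - Suc j = c + (k'' j - j)" "j \<le> k'' j" if "j < L" for j
      
      using strict_incr_ge[of "Suc L" k "Suc j"] k that by (auto simp: k''_def c_def)
    have k''mono: "k'' i < k'' j" if "i < j" "j < L" for i j
      using k[of "Suc i" "Suc j"] k[of 0 "Suc i"] that by (simp add: k''_def c_def)
    have xmono: "x i < x j" if x: "x \<in> P" and ij: "i < j" "j < L" for x i j
    proof -
      have "x i < l' (Suc i)" using PiE_mem[OF x[unfolded P_def], of i] ij by simp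
      also have "l' (Suc i) \<le> l' j"
        using l[of "Suc i" j] ij unfolding l'_def by (cases "Suc i = j") auto
      also have "l' j \<le> x j" using PiE_mem[OF x[unfolded P_def], of j] ij by simp
      finally show ?thesis .
    qed
    have xm: "x i \<le> m" if x: "x \<in> P" and i: "i < L" for x i
    proof -
      have "x i < l (Suc i) - c" using PiE_mem[OF x[unfolded P_def], of i] i by (simp add: l'_def)
      then show ?thesis using m[of "Suc i"] i by linarith
    qed
    define K where "K = (\<Prod>j<L. real (k (Suc j) - c))"
    define F where "F = (\<Prod>j<L. fact j :: real)"
    define E where "E = (\<Sum>j<L. k'' j - j)"
    have F0: "0 < F" unfolding F_def by (intro prod_pos) auto
    have K0: "0 \<le> K" unfolding K_def by (intro prod_nonneg) auto
    \<comment> \<open>The factor \<open>K\<close> produced by the expansion is the one by which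
      \<open>vdm\<close> drops when \<open>k 0\<close> is deleted, so the shape of the bound is
      reproduced.\<close>
    have V'': "vdm (Suc L) k = K * vdm L k''"
    proof -
      have "vdm L (\<lambda>i. k (Suc i) - (c + 1)) = vdm L (\<lambda>i. k (Suc i))"
        by (rule vdm_shift) (use k[of 0] in \<open>auto simp: c_def Suc_le_eq\<close>)
      moreover have "real (k (Suc i)) - real (k 0) = real (k (Suc i) - c)" if "i < L" for i
        using ck[of "Suc i"] that by (simp add: of_nat_diff c_def)
      ultimately show ?thesis unfolding vdm_Suc K_def k''_def by simp
    qed
    \<comment> \<open>The case \<open>k j = j\<close> of the expansion, read backwards, evaluates
      the sum over the interlacing sequences exactly.\<close>
    have sumV: "(\<Sum>x\<in>P. vdm L x) = vdm (Suc L) l / fact L"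
    proof -
      have "vdm (Suc L) l = vdm (Suc L) l'"
        unfolding l'_def using cl by (intro vdm_shift[symmetric])
      also have "\<dots> = tdet (Suc L) l' (\<lambda>j. j)" by (rule tdet_id[symmetric])
      also have "\<dots> = (\<Prod>j<L. real (Suc j)) * (\<Sum>x\<in>P. tdet L x (\<lambda>j. Suc j - 1))"
        unfolding P_def by (rule tdet_interlace) (use l'mono in auto)
      also have "\<dots> = fact L * (\<Sum>x\<in>P. vdm L x)"
        by (simp add: tdet_id fact_prod_Suc lessThan_atLeast0)
      finally show ?thesis by simp
    qed
    have "tdet (Suc L) l k = (\<Prod>i<Suc L. ff (l i) c) * tdet (Suc L) l' (\<lambda>j. k j - c)"
      unfolding l'_def using cl ck by (rule tdet_shift)
    also have "tdet (Suc L) l' (\<lambda>j. k j - c) = K * (\<Sum>x\<in>P. tdet L x k'')"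
      unfolding P_def k''_def K_def by (rule tdet_interlace) (use l'mono c_def in auto)
    also have "(\<Prod>i<Suc L. ff (l i) c) * (K * (\<Sum>x\<in>P. tdet L x k'')) \<le>
      (\<Prod>i<Suc L. ff (l i) c) * (K * (\<Sum>x\<in>P. real m ^ E * vdm L x * vdm L k'' / F))"
    proof (intro mult_left_mono sum_mono K0 prod_nonneg ballI ff_nonneg)
      show "tdet L x k'' \<le> real m ^ E * vdm L x * vdm L k'' / F" if "x \<in> P" for x
        unfolding E_def F_def using xmono[OF that] k''mono xm[OF that] by (rule Suc.IH)
    qed
    also have "\<dots> \<le> (\<Prod>i<Suc L. real m ^ c) * (K * (\<Sum>x\<in>P. real m ^ E * vdm L x * vdm L k'' / F))"
    proof (intro mult_right_mono prod_mono conjI ff_nonneg ff_le_power)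
      show "l i \<le> m" if "i \<in> {..<Suc L}" for i using m that by simp
      have "0 < vdm L x" if "x \<in> P" for x using xmono[OF that] by (rule vdm_pos)
      moreover have "0 < vdm L k''" using k''mono by (rule vdm_pos)
      ultimately have "0 \<le> real m ^ E * vdm L x * vdm L k'' / F" if "x \<in> P" for x
        using F0 that by (simp add: less_imp_le)
      then show "0 \<le> K * (\<Sum>x\<in>P. real m ^ E * vdm L x * vdm L k'' / F)"
        using K0 by (intro mult_nonneg_nonneg sum_nonneg) auto
    qed
    also have "\<dots> = real m ^ (c * Suc L + E) * (K * vdm L k'') * (\<Sum>x\<in>P. vdm L x) / F"
    proof -
      have "(\<Prod>i<Suc L. real m ^ c) = real m ^ (c * Suc L)"
        by (simp only: prod_constant card_lessThan power_mult)
      moreover have "(\<Sum>x\<in>P. real m ^ E * vdm L x * vdm L k'' / F) = real m ^ E * vdm L k'' / F * (\<Sum>x\<in>P. vdm L x)"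
        unfolding sum_distrib_left by (intro sum.cong) auto
      ultimately show ?thesis by (simp add: power_add mult_ac)
    qed
    also have "\<dots> = real m ^ (c * Suc L + E) * vdm (Suc L) k * vdm (Suc L) l / (fact L * F)"
      unfolding sumV V'' by simp
    also have "c * Suc L + E = (\<Sum>j<Suc L. k j - j)"
    proof -
      have "(\<Sum>j<Suc L. k j - j) = c + (\<Sum>j<L. c + (k'' j - j))"
        unfolding sum.lessThan_Suc_shift using k''j(1) by (simp add: c_def)
      then show ?thesis by (simp add: E_def sum.distrib algebra_simps)
    qed
    also have "fact L * F = (\<Prod>j<Suc L. fact j)" by (simp add: F_def)
    finally show ?thesis by (simp add: mult_ac)
  qed
qed

section \<open>Standard skew tableaux and degrees\<close>

definition rfact :: "int \<Rightarrow> real" where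
  "rfact a = (if a < 0 then 0 else 1 / fact (nat a))"

text \<open>\<open>rfact a\<close> is the reciprocal of Gamma at \<open>a + 1\<close>. Its recursion
  holds for every integer, also at \<open>a = 0\<close> where both sides vanish, so the induction
  step of \<open>hall_p_h_ones\<close> needs no case distinction.\<close>

lemma rfact_pred: "rfact (a - 1) = of_int a * rfact a"
proof (cases "a \<le> 0")
  case False
  then have "nat a = Suc (nat (a - 1))" by simp
  then have "fact (nat a) = real_of_int a * fact (nat (a - 1))" using False by simp
  then show ?thesis using False by (simp add: rfact_def)
qed (auto simp: rfact_def)

text \<open>Multinomial coefficients: lowering \<open>alpha i\<close> multiplies the product by
  \<open>alpha i\<close>, and these factors add up to the number of parts.\<close>

lemma hall_p_h_ones:
  assumes "(\<Sum>i<L. \<alpha> i) = int p"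
  shows "real (hall_p_h (replicate p 1) L \<alpha>) = fact p * (\<Prod>i<L. rfact (\<alpha> i))"
  using assms
proof (induction p arbitrary: \<alpha>)
  case 0
  show ?case
  proof (cases "\<forall>i<L. \<alpha> i = 0")
    case True
    then show ?thesis by (simp add: hall_p_h_Nil rfact_def)
  next
    case False
    have "\<exists>i<L. \<alpha> i < 0"
    proof (rule ccontr)
      assume "\<not> ?thesis"
      then have "\<forall>i\<in>{..<L}. 0 \<le> \<alpha> i" by (meson lessThan_iff not_less)
      then have "\<forall>i\<in>{..<L}. \<alpha> i = 0" using 0 sum_nonneg_eq_0_iff[of "{..<L}" \<alpha>] by simp
      then show False using False by auto
    qed
    then obtain i where i: "i < L" "\<alpha> i < 0" by blast
    then have "(\<Prod>i<L. rfact (\<alpha> i)) = 0" by (intro prod_zero) (auto simp: rfact_def)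
    then show ?thesis using False by (auto simp: hall_p_h_Nil)
  qed
next
  case (Suc p)
  have "real (hall_p_h (replicate (Suc p) 1) L \<alpha>) = (\<Sum>i<L. real (hall_p_h (replicate p 1) L (\<alpha>(i := \<alpha> i - 1))))"
    by (simp add: hall_p_h_Cons)
  also have "\<dots> = (\<Sum>i<L. fact p * (of_int (\<alpha> i) * (\<Prod>j<L. rfact (\<alpha> j))))"
  proof (rule sum.cong[OF refl])
    fix i assume "i \<in> {..<L}"
    then have i: "i < L" by simp
    have "(\<Sum>j<L. (\<alpha>(i := \<alpha> i - 1)) j) = (\<Sum>j<L. \<alpha> j - (if j = i then 1 else 0))"
      by (intro sum.cong) auto
    also have "\<dots> = int p" using Suc.prems i by (simp add: sum_subtractf)
    finally have "real (hall_p_h (replicate p 1) L (\<alpha>(i := \<alpha> i - 1))) = fact p * (\<Prod>j<L. rfact ((\<alpha>(i := \<alpha> i - 1)) j))"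
      by (rule Suc.IH)
    also have "(\<Prod>j<L. rfact ((\<alpha>(i := \<alpha> i - 1)) j)) = (\<Prod>j<L. (if j = i then of_int (\<alpha> i) else 1) * rfact (\<alpha> j))"
      by (intro prod.cong) (auto simp: rfact_pred)
    also have "\<dots> = of_int (\<alpha> i) * (\<Prod>j<L. rfact (\<alpha> j))"
      using i by (simp add: prod.distrib)
    finally show "real (hall_p_h (replicate p 1) L (\<alpha>(i := \<alpha> i - 1))) = fact p * (of_int (\<alpha> i) * (\<Prod>j<L. rfact (\<alpha> j)))" .
  qed
  also have "\<dots> = fact p * (of_int (\<Sum>i<L. \<alpha> i) * (\<Prod>j<L. rfact (\<alpha> j)))"
    by (simp add: sum_distrib_left sum_distrib_right)
  also have "\<dots> = fact (Suc p) * (\<Prod>j<L. rfact (\<alpha> j))"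
    unfolding Suc.prems by simp
  finally show ?case .
qed

text \<open>Aitken's formula. The entry \<open>1 / (a - b)!\<close> is \<open>ff a b / a!\<close>,
  where for \<open>b > a\<close> both sides are read as 0, and the factors \<open>1 / a!\<close>
  leave the determinant row by row.\<close>

lemma jt_ones:
  assumes "(\<Sum>i<L. l i) = (\<Sum>i<L. k i) + p"
  shows "real_of_int (jt (replicate p 1) L (\<lambda>i. int (l i)) (\<lambda>i. int (k i))) =
    fact p / (\<Prod>i<L. fact (l i)) * tdet L l k"
proof -
  have rf: "rfact (int a - int b) = ff a b / fact a" for a b
  proof (cases "b \<le> a")
    case True
    then have "nat (int a - int b) = a - b" by simp
    then show ?thesis using True ff_fact[OF True] by (simp add: rfact_def field_simps)
  qed (simp add: rfact_def ff_eq_0)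
  have h: "real (hall_p_h (replicate p 1) L (\<lambda>i. int (l i) - int (k (w i)))) =
      fact p * ((\<Prod>i<L. ff (l i) (k (w i))) / (\<Prod>i<L. fact (l i)))" if w: "w permutes {..<L}" for w
  proof -
    have "(\<Sum>i<L. k (w i)) = (\<Sum>i<L. k i)" using sum.permute[OF w, of k] by (simp add: o_def)
    then have "(\<Sum>i<L. int (l i) - int (k (w i))) = int p"
      using assms unfolding sum_subtractf of_nat_sum[symmetric] by simp
    then show ?thesis by (subst hall_p_h_ones) (simp_all add: rf prod_dividef)
  qed
  have "real_of_int (jt (replicate p 1) L (\<lambda>i. int (l i)) (\<lambda>i. int (k i))) =
    (\<Sum>w | w permutes {..<L}. of_int (sign w) * (fact p * ((\<Prod>i<L. ff (l i) (k (w i))) / (\<Prod>i<L. fact (l i)))))"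
    unfolding jt_def using h by (simp add: of_int_sum)
  then show ?thesis
    unfolding tdet_def det_mat_Leibniz by (simp add: sum_distrib_left mult_ac)
qed

text \<open>The size of the partition with beta set \<open>X\<close>, that is the total displacement
  of its particles from the ground state \<open>{..<card X}\<close>. By \<open>sz_eq\<close> the
  subtraction is not truncated.\<close>

definition sz :: "nat set \<Rightarrow> nat" where
  "sz X = \<Sum>X - \<Sum>{..<card X}"

text \<open>The number of standard tableaux, as \<open>num_syt_dm\<close> shows.\<close>

definition dm :: "nat set \<Rightarrow> int" where
  "dm X = jts (replicate (sz X) 1) X {..<card X}"

abbreviation en :: "nat set \<Rightarrow> nat \<Rightarrow> nat" where
  "en X i \<equiv> sorted_list_of_set X ! i"

lemma en_strict_mono: "i < j \<Longrightarrow> j < card X \<Longrightarrow> en X i < en X j"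
  using enum_strict_mono[of i j X] by (simp add: enum_def)

lemma en_bij: "finite X \<Longrightarrow> bij_betw (en X) {..<card X} X"
proof -
  assume X: "finite X"
  have "inj_on (en X) {..<card X}" using enum_inj[of X] by (auto simp: inj_on_def enum_def)
  moreover have "int ` en X ` {..<card X} = int ` X"
    using enum_image[OF X] by (simp add: image_image enum_def[abs_def])
  ultimately show ?thesis by (simp add: bij_betw_def inj_image_eq_iff)
qed

lemma en_lessThan: "i < L \<Longrightarrow> en {..<L} i = i"
  by (simp add: lessThan_atLeast0)

lemma en_sum: "finite X \<Longrightarrow> (\<Sum>i<card X. en X i) = \<Sum>X"
  using sum.reindex_bij_betw[OF en_bij, of X "\<lambda>x. x"] by simp

lemma en_prod_fact: "finite X \<Longrightarrow> (\<Prod>i<card X. fact (en X i) :: real) = (\<Prod>x\<in>X. fact x)"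
  using prod.reindex_bij_betw[OF en_bij, of X "\<lambda>x. fact x :: real"] by simp

lemma en_ge: "j < card X \<Longrightarrow> j \<le> en X j"
  using strict_incr_ge[of "card X" "en X" j] en_strict_mono[of _ _ X] by force

lemma sz_eq:
  assumes "finite X"
  shows "\<Sum>X = \<Sum>{..<card X} + sz X" "(\<Sum>j<card X. en X j - j) = sz X"
proof -
  have "(\<Sum>i<card X. en X i) = (\<Sum>j<card X. en X j - j) + (\<Sum>j<card X. j)"
    unfolding sum.distrib[symmetric] using en_ge by (intro sum.cong) auto
  then show "\<Sum>X = \<Sum>{..<card X} + sz X" "(\<Sum>j<card X. en X j - j) = sz X"
    using en_sum[OF assms] by (simp_all add: sz_def)
qed

lemma jts_ones:
  assumes X: "finite X" "finite Y" "card Y = card X" and s: "sz X = sz Y + p"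
  shows "real_of_int (jts (replicate p 1) X Y) = fact p / (\<Prod>x\<in>X. fact x) * tdet (card X) (en X) (en Y)"
proof -
  have "(\<Sum>i<card X. en X i) = (\<Sum>i<card X. en Y i) + p"
    using en_sum[OF X(1)] en_sum[OF X(2)] sz_eq(1)[OF X(1)] sz_eq(1)[OF X(2)] X(3) s by simp
  from jt_ones[OF this] show ?thesis
    unfolding jts_def enum_def[abs_def] en_prod_fact[OF X(1)] .
qed

lemma sz_lessThan [simp]: "sz {..<L} = 0"
  by (simp add: sz_def)

text \<open>Frobenius's degree formula: Aitken's determinant with an empty inner shape is a
  Vandermonde determinant.\<close>

lemma dm_eq:
  assumes X: "finite X"
  shows "real_of_int (dm X) = fact (sz X) / (\<Prod>x\<in>X. fact x) * vdm (card X) (en X)"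
proof -
  have "tdet (card X) (en X) (en {..<card X}) = tdet (card X) (en X) (\<lambda>j. j)"
    by (rule tdet_cong) (auto simp: en_lessThan)
  then show ?thesis unfolding dm_def using X by (subst jts_ones) (auto simp: tdet_id)
qed

lemma dm_pos:
  assumes X: "finite X"
  shows "0 < dm X"
proof -
  have "0 < vdm (card X) (en X)" by (rule vdm_pos) (rule en_strict_mono)
  then have "0 < real_of_int (dm X)" unfolding dm_eq[OF X] by (simp add: prod_pos)
  then show ?thesis by simp
qed

text \<open>Compares the number of standard tableaux of a skew shape with the degrees of both
  shapes. One factor \<open>m ^ sz Y\<close> comes from \<open>tdet_le\<close>, the other from
  adapting its product of factorials to the degree formula for \<open>Y\<close>.\<close>

lemma jts_ones_le:
  assumes X: "finite X" "finite Y" "card Y = card X" and s: "sz X = sz Y + p"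
    and m: "\<And>x. x \<in> X \<Longrightarrow> x \<le> m" "\<And>y. y \<in> Y \<Longrightarrow> y \<le> m"
  shows "real_of_int (jts (replicate p 1) X Y) \<le>
    real m ^ (2 * sz Y) * fact p / (fact (sz X) * fact (sz Y)) * dm X * dm Y"
proof -
  let ?L = "card X"
  let ?F = "\<Prod>j<?L. fact j :: real" and ?Y = "\<Prod>y\<in>Y. fact y :: real" and ?X = "\<Prod>x\<in>X. fact x :: real"
  let ?VX = "vdm ?L (en X)" and ?VY = "vdm ?L (en Y)"
  have F: "0 < ?F" "0 < ?Y" "0 < ?X" by (simp_all add: prod_pos)
  have enm: "en X i \<le> m" "en Y i \<le> m" if "i < ?L" for i
    using that bij_betwE[OF en_bij[OF X(1)]] bij_betwE[OF en_bij[OF X(2)]] X(3) m by auto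
  have VX: "0 < ?VX" by (rule vdm_pos) (rule en_strict_mono)
  have VY: "0 < ?VY" unfolding X(3)[symmetric] by (rule vdm_pos) (rule en_strict_mono)
  have "tdet ?L (en X) (en Y) \<le> real m ^ (\<Sum>j<?L. en Y j - j) * ?VX * ?VY / ?F"
    by (rule tdet_le) (use enm en_strict_mono[of _ _ X] en_strict_mono[of _ _ Y] X(3) in auto)
  also have "(\<Sum>j<?L. en Y j - j) = sz Y" using sz_eq(2)[OF X(2)] X(3) by simp
  \<comment> \<open>The particle \<open>y\<close> at position \<open>j\<close> satisfies
    \<open>y! <= m^(y - j) * j!\<close>, and the displacements \<open>y - j\<close> add up to
    \<open>sz Y\<close>.\<close>
  also have "real m ^ sz Y * ?VX * ?VY / ?F \<le> real m ^ sz Y * ?VX * ?VY * (real m ^ sz Y / ?Y)"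
  proof -
    have "?Y = (\<Prod>j<?L. fact (en Y j))" using en_prod_fact[OF X(2)] X(3) by simp
    also have "\<dots> \<le> (\<Prod>j<?L. real m ^ (en Y j - j) * fact j)"
    proof (intro prod_mono conjI)
      fix j assume "j \<in> {..<?L}"
      then have j: "j \<le> en Y j" "en Y j \<le> m" using en_ge[of j Y] X(3) enm by auto
      have "fact (en Y j) = ff (en Y j) (en Y j - j) * fact (en Y j - (en Y j - j))"
        by (rule ff_fact[symmetric]) simp
      also have "\<dots> \<le> real m ^ (en Y j - j) * fact j"
        using j by (intro mult_mono ff_le_power) auto
      finally show "(fact (en Y j) :: real) \<le> real m ^ (en Y j - j) * fact j" .
    qed simp
    also have "\<dots> = real m ^ sz Y * ?F"
      using sz_eq(2)[OF X(2)] X(3) by (simp add: prod.distrib power_sum[symmetric])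
    finally have "1 / ?F \<le> real m ^ sz Y / ?Y" using F by (simp add: field_simps)
    then have "real m ^ sz Y * ?VX * ?VY * (1 / ?F) \<le> real m ^ sz Y * ?VX * ?VY * (real m ^ sz Y / ?Y)"
      using VX VY by (intro mult_left_mono) auto
    then show ?thesis by simp
  qed
  finally have "fact p / ?X * tdet ?L (en X) (en Y) \<le> fact p / ?X * (real m ^ sz Y * ?VX * ?VY * (real m ^ sz Y / ?Y))"
    using F by (intro mult_left_mono) auto
  also have "\<dots> = real m ^ (2 * sz Y) * fact p / (fact (sz X) * fact (sz Y)) * dm X * dm Y"
    unfolding dm_eq[OF X(1)] dm_eq[OF X(2)] X(3) mult_2 power_add by (simp add: field_simps)
  finally show ?thesis using jts_ones[OF X s] by simp
qed

section \<open>Removing boxes and hooks\<close>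

text \<open>The branching rule as an operator: \<open>(down ^^ k) H X\<close> sums \<open>H\<close>
  over the ends of all chains of \<open>k\<close> box removals that start at
  \<open>X\<close>.\<close>

definition down :: "(nat set \<Rightarrow> real) \<Rightarrow> nat set \<Rightarrow> real" where
  "down H X = (\<Sum>x\<in>legal 1 X. H (mv 1 x X))"

definition ch :: "nat list \<Rightarrow> nat set \<Rightarrow> real" where
  "ch mu X = real_of_int (jts mu X {..<card X})"

text \<open>A necessary condition for \<open>Y\<close> to arise from \<open>X\<close> by removing
  hooks with \<open>k\<close> cells in total. It keeps only what the estimates use, not the
  existence of a chain.\<close>

definition reach :: "nat \<Rightarrow> nat set \<Rightarrow> nat set \<Rightarrow> bool" where
  "reach k X Y \<longleftrightarrow> finite Y \<and> card Y = card X \<and> sz Y + k = sz X \<and> (\<forall>m. X \<subseteq> {..m} \<longrightarrow> Y \<subseteq> {..m})"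

lemma sum_mv:
  assumes "finite X" "x \<in> legal r X"
  shows "\<Sum>(mv r x X) + r = \<Sum>X"
proof -
  have x: "x \<in> X" "r \<le> x" "x - r \<notin> X" using assms(2) by (auto simp: legal_def)
  have "\<Sum>(mv r x X) = (x - r) + \<Sum>(X - {x})"
    unfolding mv_def using assms(1) x by (subst sum.insert) auto
  moreover have "\<Sum>X = x + \<Sum>(X - {x})" using assms(1) x by (simp add: sum.remove)
  ultimately show ?thesis using x by simp
qed

lemma sz_mv:
  assumes "finite X" "x \<in> legal r X"
  shows "sz (mv r x X) + r = sz X"
  using sum_mv[OF assms] sz_eq(1)[OF assms(1)] sz_eq(1)[OF finite_mv[OF assms(1)], of r x] card_mv[OF assms]
  by simp

lemma down_pow_Suc: "(down ^^ Suc k) H X = (\<Sum>x\<in>legal 1 X. (down ^^ k) H (mv 1 x X))"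
  by (simp add: down_def)

lemma reach_0: "finite X \<Longrightarrow> reach 0 X X"
  by (simp add: reach_def)

lemma reach_mv: "finite X \<Longrightarrow> x \<in> legal r X \<Longrightarrow> reach r X (mv r x X)"
  unfolding reach_def using finite_mv card_mv sz_mv by (fastforce simp: mv_def legal_def)

lemma reach_trans: "reach k X Y \<Longrightarrow> reach j Y Z \<Longrightarrow> reach (k + j) X Z"
  unfolding reach_def by auto

lemma down_pow_mono:
  assumes "finite X" "\<And>Y. reach k X Y \<Longrightarrow> H Y \<le> G Y"
  shows "(down ^^ k) H X \<le> (down ^^ k) G X"
  using assms
proof (induction k arbitrary: X)
  case 0
  then show ?case using reach_0 by simp
next
  case (Suc k)
  show ?case unfolding down_pow_Suc
  proof (rule sum_mono)
    fix x assume x: "x \<in> legal 1 X"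
    have "H Y \<le> G Y" if "reach k (mv 1 x X) Y" for Y
      using reach_trans[OF reach_mv[OF Suc.prems(1) x] that] Suc.prems(2) by simp
    then show "(down ^^ k) H (mv 1 x X) \<le> (down ^^ k) G (mv 1 x X)"
      by (intro Suc.IH finite_mv Suc.prems(1))
  qed
qed

lemma down_pow_cong:
  assumes "finite X" "\<And>Y. reach k X Y \<Longrightarrow> H Y = G Y"
  shows "(down ^^ k) H X = (down ^^ k) G X"
  using assms by (intro antisym down_pow_mono) auto

lemma down_pow_scale: "(down ^^ k) (\<lambda>Y. c * H Y) X = c * (down ^^ k) H X"
  by (induction k arbitrary: X) (simp_all add: down_def sum_distrib_left)

lemma down_pow_add: "(down ^^ k) (\<lambda>Y. H Y + G Y) X = (down ^^ k) H X + (down ^^ k) G X"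
  by (induction k arbitrary: X) (simp_all add: down_def sum.distrib)

lemma down_pow_sum: "(down ^^ k) (\<lambda>Y. \<Sum>i\<in>I. H i Y) X = (\<Sum>i\<in>I. (down ^^ k) (H i) X)"
proof (induction k arbitrary: X)
  case (Suc k)
  show ?case unfolding down_pow_Suc Suc.IH by (rule sum.swap)
qed simp

lemma down_pow_zero: "(down ^^ k) (\<lambda>Y. 0) X = 0"
  using down_pow_scale[of k 0 "\<lambda>_. 0" X] by simp

lemma down_pow_nonneg:
  assumes "finite X" "\<And>Y. reach k X Y \<Longrightarrow> 0 \<le> H Y"
  shows "0 \<le> (down ^^ k) H X"
  using down_pow_mono[of X k "\<lambda>_. 0" H] assms by (simp add: down_pow_zero)

lemma down_pow_abs:
  assumes "finite X"
  shows "\<bar>(down ^^ k) H X\<bar> \<le> (down ^^ k) (\<lambda>Y. \<bar>H Y\<bar>) X"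
  using assms
proof (induction k arbitrary: X)
  case (Suc k)
  have "\<bar>(down ^^ Suc k) H X\<bar> \<le> (\<Sum>x\<in>legal 1 X. \<bar>(down ^^ k) H (mv 1 x X)\<bar>)"
    unfolding down_pow_Suc by (rule sum_abs)
  also have "\<dots> \<le> (\<Sum>x\<in>legal 1 X. (down ^^ k) (\<lambda>Y. \<bar>H Y\<bar>) (mv 1 x X))"
    by (intro sum_mono Suc.IH finite_mv Suc.prems)
  finally show ?case unfolding down_pow_Suc .
qed simp

text \<open>With \<open>ind Y\<close> as weight, iterated \<open>down\<close> counts the chains from
  \<open>X\<close> to \<open>Y\<close>.\<close>

definition ind :: "nat set \<Rightarrow> nat set \<Rightarrow> real" where
  "ind Y Z = (if Z = Y then 1 else 0)"

lemma ind_same [simp]: "ind Y Y = 1"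
  by (simp add: ind_def)

lemma ind_nonneg: "0 \<le> ind Y Z"
  by (simp add: ind_def)

lemma down_nonneg: "(\<And>Y. 0 \<le> H Y) \<Longrightarrow> 0 \<le> down H X"
  unfolding down_def by (rule sum_nonneg)

lemma down_pow_nonneg': "(\<And>Y. 0 \<le> H Y) \<Longrightarrow> 0 \<le> (down ^^ k) H X"
  by (induction k arbitrary: X) (auto intro: down_nonneg)

lemma down_ge:
  assumes "finite X" "x \<in> legal 1 X" "\<And>Y. 0 \<le> H Y"
  shows "H (mv 1 x X) \<le> down H X"
  unfolding down_def using assms by (intro member_le_sum finite_legal)

text \<open>A long move is a product of unit moves: a particle that would have to jump over an occupied site
  is instead relayed by the particle sitting there.\<close>
lemma down_pow_ind_mv:
  assumes "finite X" "x \<in> legal r X" "0 < r"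
  shows "1 \<le> (down ^^ r) (ind (mv r x X)) X"
  using assms
proof (induction r arbitrary: X x)
  case (Suc r)
  have x: "x \<in> X" "Suc r \<le> x" "x - Suc r \<notin> X" using Suc.prems(2) by (auto simp: legal_def)
  have fin: "finite X" by fact
  show ?case
  proof (cases "r = 0")
    case True
    have "ind (mv (Suc r) x X) (mv 1 x X) \<le> down (ind (mv (Suc r) x X)) X"
      using Suc.prems True by (intro down_ge ind_nonneg) auto
    then show ?thesis using True by simp
  next
    case False
    then have r: "0 < r" by simp
    show ?thesis
    proof (cases "x - r \<in> X")
      case False
      let ?X1 = "mv r x X"
      have l: "x \<in> legal r X" using x False by (auto simp: legal_def)
      have l1: "x - r \<in> legal 1 ?X1" using x r by (auto simp: legal_def mv_def)
      have m: "mv 1 (x - r) ?X1 = mv (Suc r) x X" using x False by (auto simp: mv_def)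
      have "ind ?X1 Y \<le> down (ind (mv (Suc r) x X)) Y" for Y
      proof (cases "Y = ?X1")
        case True
        then show ?thesis using down_ge[OF finite_mv[OF fin] l1, of "ind (mv (Suc r) x X)"]
          unfolding m by (simp add: ind_nonneg)
      qed (simp add: ind_def[of ?X1] down_nonneg ind_nonneg)
      then have "(down ^^ r) (ind ?X1) X \<le> (down ^^ r) (down (ind (mv (Suc r) x X))) X"
        by (intro down_pow_mono fin)
      moreover have "1 \<le> (down ^^ r) (ind ?X1) X" using Suc.IH[OF fin l r] .
      ultimately show ?thesis by (simp add: funpow_Suc_right del: funpow.simps)
    next
      case True
      let ?X1 = "mv 1 (x - r) X"
      have y: "x - r \<in> legal 1 X" using x True by (auto simp: legal_def)
      have l: "x \<in> legal r ?X1" using x r True by (auto simp: legal_def mv_def)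
      have m: "mv r x ?X1 = mv (Suc r) x X" using x r True by (auto simp: mv_def)
      have "1 \<le> (down ^^ r) (ind (mv (Suc r) x X)) ?X1"
        using Suc.IH[OF finite_mv[OF fin] l r] m by simp
      also have "\<dots> \<le> down ((down ^^ r) (ind (mv (Suc r) x X))) X"
        by (intro down_ge fin y down_pow_nonneg' ind_nonneg)
      finally show ?thesis by simp
    qed
  qed
qed simp

lemma mv_inj:
  assumes "0 < r"
  shows "inj_on (\<lambda>x. mv r x X) (legal r X)"
proof (rule inj_onI)
  fix x y assume x: "x \<in> legal r X" and y: "y \<in> legal r X" and e: "mv r x X = mv r y X"
  have "X - mv r z X = {z}" if "z \<in> legal r X" for z using that assms by (auto simp: mv_def legal_def)
  then show "x = y" using x y e by (metis singleton_inject)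
qed

text \<open>Every target of a hook removal is also the end of at least one chain of \<open>r\<close>
  box removals, and distinct hooks have distinct targets (\<open>mv_inj\<close>). So the hook sum is
  part of the chain sum.\<close>

lemma sum_legal_le_down_pow:
  assumes X: "finite X" and r: "0 < r" and H: "\<And>Y. 0 \<le> H Y"
  shows "(\<Sum>x\<in>legal r X. H (mv r x X)) \<le> (down ^^ r) H X"
proof -
  let ?S = "(\<lambda>x. mv r x X) ` legal r X"
  have fS: "finite ?S" using finite_legal[OF X] by simp
  have "(\<Sum>x\<in>legal r X. H (mv r x X)) = (\<Sum>Y\<in>?S. H Y)"
    by (subst sum.reindex[OF mv_inj[OF r]]) simp
  also have "\<dots> \<le> (\<Sum>Y\<in>?S. H Y * (down ^^ r) (ind Y) X)"
  proof (rule sum_mono)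
    fix Y assume "Y \<in> ?S"
    then have "1 \<le> (down ^^ r) (ind Y) X" using down_pow_ind_mv[OF X _ r] by blast
    then show "H Y \<le> H Y * (down ^^ r) (ind Y) X" using mult_left_mono[OF _ H[of Y]] by fastforce
  qed
  also have "\<dots> = (down ^^ r) (\<lambda>Z. \<Sum>Y\<in>?S. H Y * ind Y Z) X"
    unfolding down_pow_sum down_pow_scale ..
  also have "\<dots> \<le> (down ^^ r) H X"
  proof (rule down_pow_mono[OF X])
    fix Z
    have "(\<Sum>Y\<in>?S. H Y * ind Y Z) = (\<Sum>Y\<in>?S. if Z = Y then H Y else 0)"
      by (intro sum.cong) (auto simp: ind_def)
    also have "\<dots> \<le> H Z" using fS H[of Z] by (subst sum.delta') auto
    finally show "(\<Sum>Y\<in>?S. H Y * ind Y Z) \<le> H Z" .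
  qed
  finally show ?thesis .
qed

text \<open>The sign does not depend on \<open>mu\<close> and \<open>Y\<close>, which makes hook removal a linear operator; its value
  is irrelevant for the estimates.\<close>
definition hook_sign :: "nat \<Rightarrow> nat set \<Rightarrow> nat \<Rightarrow> int" where
  "hook_sign r X = (SOME sg. (\<forall>x. sg x \<in> {1, -1}) \<and>
    (\<forall>mu Y. card Y = card X \<longrightarrow> jts (r # mu) X Y = (\<Sum>x\<in>legal r X. sg x * jts mu (mv r x X) Y)))"

lemma hook_sign:
  assumes "finite X" "0 < r"
  shows "hook_sign r X x \<in> {1, -1}"
    "card Y = card X \<Longrightarrow> jts (r # mu) X Y = (\<Sum>x\<in>legal r X. hook_sign r X x * jts mu (mv r x X) Y)"
  using someI_ex[OF jts_Cons[OF assms]] unfolding hook_sign_def[symmetric] by blast+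

definition hook :: "nat \<Rightarrow> (nat set \<Rightarrow> real) \<Rightarrow> nat set \<Rightarrow> real" where
  "hook r H X = (\<Sum>x\<in>legal r X. of_int (hook_sign r X x) * H (mv r x X))"

lemma hook_abs:
  assumes "finite X" "0 < r"
  shows "\<bar>hook r H X\<bar> \<le> (\<Sum>x\<in>legal r X. \<bar>H (mv r x X)\<bar>)"
proof -
  have "\<bar>real_of_int (hook_sign r X x)\<bar> = 1" for x using hook_sign(1)[OF assms, of x] by auto
  then show ?thesis unfolding hook_def by (intro order_trans[OF sum_abs]) (simp add: abs_mult)
qed

lemma ch_Cons:
  assumes "finite X" "0 < r"
  shows "ch (r # mu) X = hook r (ch mu) X"
proof -
  have "jts (r # mu) X {..<card X} = (\<Sum>x\<in>legal r X. hook_sign r X x * jts mu (mv r x X) {..<card X})"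
    by (rule hook_sign(2)[OF assms]) simp
  then show ?thesis unfolding ch_def hook_def using card_mv[OF assms(1)] by (simp add: of_int_sum)
qed

definition hooks :: "nat list \<Rightarrow> (nat set \<Rightarrow> real) \<Rightarrow> nat set \<Rightarrow> real" where
  "hooks mu H = foldr hook mu H"

lemma hooks_simps [simp]: "hooks [] H = H" "hooks (r # mu) H = hook r (hooks mu H)"
  by (simp_all add: hooks_def)

lemma ch_append:
  assumes "finite X" "\<forall>r\<in>set mu. 0 < r"
  shows "ch (mu @ tau) X = hooks mu (ch tau) X"
  using assms
proof (induction mu arbitrary: X)
  case (Cons r mu)
  then have "ch ((r # mu) @ tau) X = hook r (ch (mu @ tau)) X" by (simp add: ch_Cons)
  also have "\<dots> = hook r (hooks mu (ch tau)) X"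
    unfolding hook_def using Cons finite_mv by (intro sum.cong) auto
  finally show ?case by simp
qed simp

text \<open>Part by part the signs are dropped and hooks are replaced by chains of boxes. This takes
  the place of \<open>|trace| <= degree\<close>; \<open>phi_double_step\<close> needs it for a
  weight \<open>H\<close> that is not a character.\<close>

lemma hooks_abs:
  assumes "finite X" "\<forall>r\<in>set mu. 0 < r"
  shows "\<bar>hooks mu H X\<bar> \<le> (down ^^ sum_list mu) (\<lambda>Y. \<bar>H Y\<bar>) X"
  using assms
proof (induction mu arbitrary: X)
  case (Cons r mu)
  have r: "0 < r" using Cons.prems by simp
  have "\<bar>hooks (r # mu) H X\<bar> \<le> (\<Sum>x\<in>legal r X. \<bar>hooks mu H (mv r x X)\<bar>)"
    using hook_abs[OF Cons.prems(1) r] by simp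
  also have "\<dots> \<le> (\<Sum>x\<in>legal r X. (down ^^ sum_list mu) (\<lambda>Y. \<bar>H Y\<bar>) (mv r x X))"
    using Cons.prems by (intro sum_mono Cons.IH finite_mv) auto
  also have "\<dots> \<le> (down ^^ r) ((down ^^ sum_list mu) (\<lambda>Y. \<bar>H Y\<bar>)) X"
    by (intro sum_legal_le_down_pow Cons.prems r down_pow_nonneg') simp
  finally show ?case by (simp add: funpow_add)
qed simp

lemma hook_linear: "hook r (\<lambda>Y. G Y - c * H Y) X = hook r G X - c * hook r H X"
  unfolding hook_def sum_distrib_left sum_subtractf[symmetric] by (intro sum.cong) (auto simp: algebra_simps)

lemma hooks_linear: "hooks mu (\<lambda>Y. G Y - c * H Y) X = hooks mu G X - c * hooks mu H X"
proof (induction mu arbitrary: X)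
  case (Cons r mu)
  have "hooks mu (\<lambda>Y. G Y - c * H Y) = (\<lambda>Y. hooks mu G Y - c * hooks mu H Y)"
    using Cons.IH by (intro ext)
  then show ?case by (simp only: hooks_simps hook_linear)
qed simp

lemma hooks_cong:
  assumes "finite X" "\<forall>r\<in>set mu. 0 < r" "\<And>Y. reach (sum_list mu) X Y \<Longrightarrow> H Y = G Y"
  shows "hooks mu H X = hooks mu G X"
  using assms
proof (induction mu arbitrary: X)
  case (Cons r mu)
  have "hooks mu H (mv r x X) = hooks mu G (mv r x X)" if x: "x \<in> legal r X" for x
    using Cons.prems reach_trans[OF reach_mv[OF Cons.prems(1) x]]
    by (intro Cons.IH finite_mv) auto
  then show ?case by (simp add: hook_def)
qed (use reach_0 in simp)

lemma ch_ones:
  assumes "finite X"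
  shows "ch (replicate k 1 @ mu) X = (down ^^ k) (ch mu) X"
  using assms
proof (induction k arbitrary: X)
  case (Suc k)
  have "jts (1 # replicate k 1 @ mu) X {..<card X} = (\<Sum>x\<in>legal 1 X. jts (replicate k 1 @ mu) (mv 1 x X) {..<card X})"
    by (rule jts_Cons_1[OF Suc.prems]) simp
  then have "ch (replicate (Suc k) 1 @ mu) X = (\<Sum>x\<in>legal 1 X. ch (replicate k 1 @ mu) (mv 1 x X))"
    unfolding ch_def using card_mv[OF Suc.prems] by (simp add: of_int_sum)
  also have "\<dots> = (down ^^ Suc k) (ch mu) X"
    unfolding down_pow_Suc by (intro sum.cong refl Suc.IH finite_mv[OF Suc.prems])
  finally show ?case .
qed simp

lemma ch_mset: "mset mu = mset mu' \<Longrightarrow> ch mu X = ch mu' X"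
  unfolding ch_def by (simp add: jts_mset[of mu mu'])

section \<open>Normalised characters under random removal of boxes\<close>

definition rdim :: "nat set \<Rightarrow> real" where
  "rdim X = real_of_int (dm X)"

lemma rdim_ch: "rdim X = ch (replicate (sz X) 1) X"
  by (simp add: rdim_def dm_def ch_def)

lemma rdim_pos: "finite X \<Longrightarrow> 0 < rdim X"
  using dm_pos by (simp add: rdim_def)

text \<open>\<open>rdim\<close> is harmonic for \<open>down\<close>. Hence the weights
  \<open>rdim Y / rdim X\<close>, taken over chains from \<open>X\<close> to \<open>Y\<close>, add
  up to 1 and define the random removal of boxes.\<close>

lemma down_pow_rdim:
  assumes "finite X" "k \<le> sz X"
  shows "(down ^^ k) rdim X = rdim X"
proof -
  have "(down ^^ k) rdim X = (down ^^ k) (ch (replicate (sz X - k) 1)) X"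
  proof (rule down_pow_cong[OF assms(1)])
    fix Y assume "reach k X Y"
    then have "sz Y = sz X - k" by (auto simp: reach_def)
    then show "rdim Y = ch (replicate (sz X - k) 1) Y" by (simp add: rdim_ch)
  qed
  also have "\<dots> = ch (replicate (k + (sz X - k)) 1) X"
    unfolding replicate_add ch_ones[OF assms(1)] ..
  finally show ?thesis using assms(2) by (simp add: rdim_ch)
qed

text \<open>The padding with parts 1 supplies the fixed points, so one list \<open>mu\<close>
  describes a class for every size from \<open>sum_list mu\<close> on.\<close>

definition phi :: "nat list \<Rightarrow> nat set \<Rightarrow> real" where
  "phi mu X = ch (mu @ replicate (sz X - sum_list mu) 1) X / rdim X"

lemma rdim_phi: "finite X \<Longrightarrow> rdim X * phi mu X = ch (mu @ replicate (sz X - sum_list mu) 1) X"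
  using rdim_pos[of X] by (simp add: phi_def)

lemma phi_le_1:
  assumes X: "finite X" and mu: "\<forall>r\<in>set mu. 0 < r" "sum_list mu \<le> sz X"
  shows "\<bar>phi mu X\<bar> \<le> 1"
proof -
  let ?s = "sum_list mu"
  have "\<bar>rdim X * phi mu X\<bar> = \<bar>hooks mu (ch (replicate (sz X - ?s) 1)) X\<bar>"
    unfolding rdim_phi[OF X] ch_append[OF X mu(1)] ..
  also have "\<dots> \<le> (down ^^ ?s) (\<lambda>Y. \<bar>ch (replicate (sz X - ?s) 1) Y\<bar>) X"
    by (rule hooks_abs[OF X mu(1)])
  also have "\<dots> = (down ^^ ?s) rdim X"
  proof (rule down_pow_cong[OF X])
    fix Y assume Y: "reach ?s X Y"
    then have "sz Y = sz X - ?s" by (auto simp: reach_def)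
    then have "ch (replicate (sz X - ?s) 1) Y = rdim Y" by (simp add: rdim_ch)
    moreover have "0 < rdim Y" using Y by (auto intro: rdim_pos simp: reach_def)
    ultimately show "\<bar>ch (replicate (sz X - ?s) 1) Y\<bar> = rdim Y" by simp
  qed
  also have "\<dots> = rdim X" using X mu(2) by (rule down_pow_rdim)
  finally show ?thesis using rdim_pos[OF X] by (simp add: abs_mult)
qed

text \<open>The martingale property: parts may be removed in any order, so removing \<open>k\<close>
  fixed points first does not change the value. The hypothesis leaves room for \<open>mu\<close>
  afterwards.\<close>

lemma down_pow_phi:
  assumes X: "finite X" and k: "sum_list mu + k \<le> sz X"
  shows "(down ^^ k) (\<lambda>Y. rdim Y * phi mu Y) X = rdim X * phi mu X"
proof -
  let ?j = "sz X - k - sum_list mu"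
  have "(down ^^ k) (\<lambda>Y. rdim Y * phi mu Y) X = (down ^^ k) (ch (mu @ replicate ?j 1)) X"
  proof (rule down_pow_cong[OF X])
    fix Y assume "reach k X Y"
    then have "finite Y" "sz Y = sz X - k" by (auto simp: reach_def)
    then show "rdim Y * phi mu Y = ch (mu @ replicate ?j 1) Y" by (simp add: rdim_phi)
  qed
  also have "\<dots> = ch (replicate k 1 @ mu @ replicate ?j 1) X" by (rule ch_ones[OF X, symmetric])
  also have "\<dots> = ch (mu @ replicate (k + ?j) 1) X"
    by (rule ch_mset) (simp add: replicate_add)
  also have "k + ?j = sz X - sum_list mu" using k by simp
  finally show ?thesis using rdim_phi[OF X] by simp
qed

text \<open>\<open>phi mu\<close> is a martingale under \<open>down\<close>; the gap on the right-hand side is its quadratic variation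
  over \<open>sum_list mu\<close> steps and telescopes when the step is iterated.\<close>
lemma phi_double_step:
  assumes X: "finite X" and mu: "\<forall>r\<in>set mu. 0 < r" and s: "2 * sum_list mu \<le> sz X" and eta: "0 < \<eta>"
  defines "q \<equiv> \<lambda>Y. rdim Y * (phi mu Y)\<^sup>2"
  shows "q X - rdim X * phi (mu @ mu) X \<le>
    \<eta> / 2 * rdim X + ((down ^^ sum_list mu) q X - q X) / (2 * \<eta>)"
    and "q X \<le> (down ^^ sum_list mu) q X"
proof -
  let ?s = "sum_list mu"
  define c where "c = phi mu X"
  let ?D = "\<lambda>H. (down ^^ ?s) H X"
  have fin: "finite Y" if "reach ?s X Y" for Y using that by (simp add: reach_def)
  have szY: "sz Y = sz X - ?s" if "reach ?s X Y" for Y using that by (auto simp: reach_def)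
  have F: "?D rdim = rdim X" by (rule down_pow_rdim[OF X]) (use s in simp)
  have Fp: "?D (\<lambda>Y. rdim Y * phi mu Y) = rdim X * c"
    unfolding c_def by (rule down_pow_phi[OF X]) (use s in simp)
  \<comment> \<open>Since \<open>c\<close> is the mean of \<open>phi mu Y\<close>, the variance is
    the growth of the second moment.\<close>
  have sq: "?D (\<lambda>Y. rdim Y * (phi mu Y - c)\<^sup>2) = ?D q - q X"
  proof -
    have "?D (\<lambda>Y. rdim Y * (phi mu Y - c)\<^sup>2) = ?D (\<lambda>Y. q Y + ((- 2 * c) * (rdim Y * phi mu Y) + c\<^sup>2 * rdim Y))"
      by (intro down_pow_cong[OF X]) (simp add: q_def power2_eq_square algebra_simps)
    also have "\<dots> = ?D q + ((- 2 * c) * (rdim X * c) + c\<^sup>2 * rdim X)"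
      unfolding down_pow_add down_pow_scale F Fp ..
    also have "\<dots> = ?D q - q X" by (simp add: q_def c_def power2_eq_square algebra_simps)
    finally show ?thesis .
  qed
  have "0 \<le> ?D (\<lambda>Y. rdim Y * (phi mu Y - c)\<^sup>2)"
    by (rule down_pow_nonneg[OF X]) (use rdim_pos[OF fin] in \<open>simp add: less_imp_le\<close>)
  then show "q X \<le> ?D q" unfolding sq by simp
  \<comment> \<open>Removing \<open>mu\<close> from \<open>X\<close> turns
    \<open>phi (mu @ mu)\<close> at \<open>X\<close> into \<open>phi mu\<close> at \<open>Y\<close>,
    and \<open>phi mu\<close> at \<open>X\<close> into the constant 1. The difference therefore
    measures how far \<open>phi mu Y\<close> is from \<open>c\<close>.\<close>
  have "ch (mu @ mu @ replicate (sz X - 2 * ?s) 1) X - c * ch (mu @ replicate (sz X - ?s) 1) X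
    = hooks mu (\<lambda>Y. ch (mu @ replicate (sz X - 2 * ?s) 1) Y - c * ch (replicate (sz X - ?s) 1) Y) X"
    unfolding hooks_linear ch_append[OF X mu] ..
  also have "\<dots> = hooks mu (\<lambda>Y. rdim Y * (phi mu Y - c)) X"
  proof (rule hooks_cong[OF X mu])
    fix Y assume Y: "reach ?s X Y"
    have "ch (mu @ replicate (sz X - 2 * ?s) 1) Y = rdim Y * phi mu Y"
      unfolding rdim_phi[OF fin[OF Y]] szY[OF Y] by (simp add: mult_2)
    moreover have "ch (replicate (sz X - ?s) 1) Y = rdim Y"
      unfolding rdim_ch szY[OF Y] ..
    ultimately show "ch (mu @ replicate (sz X - 2 * ?s) 1) Y - c * ch (replicate (sz X - ?s) 1) Y = rdim Y * (phi mu Y - c)"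
      by (simp add: algebra_simps)
  qed
  finally have "\<bar>rdim X * phi (mu @ mu) X - c * (rdim X * c)\<bar> = \<bar>hooks mu (\<lambda>Y. rdim Y * (phi mu Y - c)) X\<bar>"
    unfolding rdim_phi[OF X] c_def by (simp add: mult_2)
  also have "\<dots> \<le> ?D (\<lambda>Y. \<bar>rdim Y * (phi mu Y - c)\<bar>)" by (rule hooks_abs[OF X mu])
  also have "\<dots> \<le> ?D (\<lambda>Y. \<eta> / 2 * rdim Y + 1 / (2 * \<eta>) * (rdim Y * (phi mu Y - c)\<^sup>2))"
  proof (rule down_pow_mono[OF X])
    fix Y assume Y: "reach ?s X Y"
    have d: "0 < rdim Y" using rdim_pos fin Y by blast
    \<comment> \<open>Young's inequality with weight \<open>eta\<close> passes from the mean
      deviation to the variance, which telescopes.\<close>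
    have "2 * \<bar>phi mu Y - c\<bar> * \<eta> \<le> \<eta>\<^sup>2 + (phi mu Y - c)\<^sup>2"
      using sum_squares_bound[of "\<bar>phi mu Y - c\<bar>" \<eta>] by (simp add: add.commute)
    then have "\<bar>phi mu Y - c\<bar> \<le> \<eta> / 2 + 1 / (2 * \<eta>) * (phi mu Y - c)\<^sup>2"
      using eta by (simp add: field_simps power2_eq_square)
    then have "rdim Y * \<bar>phi mu Y - c\<bar> \<le> rdim Y * (\<eta> / 2 + 1 / (2 * \<eta>) * (phi mu Y - c)\<^sup>2)"
      using d by (intro mult_left_mono) auto
    then show "\<bar>rdim Y * (phi mu Y - c)\<bar> \<le> \<eta> / 2 * rdim Y + 1 / (2 * \<eta>) * (rdim Y * (phi mu Y - c)\<^sup>2)"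
      using d unfolding abs_mult by (simp add: distrib_left mult_ac)
  qed
  also have "\<dots> = \<eta> / 2 * rdim X + (?D q - q X) / (2 * \<eta>)"
    unfolding down_pow_add down_pow_scale F sq by simp
  finally show "q X - rdim X * phi (mu @ mu) X \<le> \<eta> / 2 * rdim X + (?D q - q X) / (2 * \<eta>)"
    by (simp add: q_def c_def power2_eq_square algebra_simps)
qed

text \<open>The step is averaged over \<open>M\<close> consecutive windows of
  \<open>sum_list mu\<close> boxes. The second moments \<open>Q t\<close> increase and never exceed
  \<open>rdim X\<close>, so their increments are at most \<open>rdim X / M\<close> on average. The
  factor \<open>M + 1\<close> leaves room for \<open>mu @ mu\<close> in the last window.\<close>

lemma phi_double:
  assumes X: "finite X" and mu: "\<forall>r\<in>set mu. 0 < r" and M: "(M + 1) * sum_list mu \<le> sz X" "0 < M"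
    and eta: "0 < \<eta>"
  shows "(phi mu X)\<^sup>2 \<le> \<bar>phi (mu @ mu) X\<bar> + \<eta> / 2 + 1 / (2 * \<eta> * real M)"
proof -
  let ?s = "sum_list mu"
  define q where "q Y = rdim Y * (phi mu Y)\<^sup>2" for Y
  define Q where "Q t = (down ^^ (t * ?s)) q X" for t
  define P where "P = rdim X * phi (mu @ mu) X"
  have sM: "t * ?s + 2 * ?s \<le> sz X" if "t < M" for t
  proof -
    have "t * ?s + 2 * ?s = (t + 2) * ?s" by (simp add: algebra_simps)
    also have "\<dots> \<le> (M + 1) * ?s" using that by (intro mult_right_mono) auto
    finally show ?thesis using M(1) by simp
  qed
  have Y2: "2 * ?s \<le> sz Y" "finite Y" if "t < M" "reach (t * ?s) X Y" for t Y
    using sM[OF that(1)] that(2) by (auto simp: reach_def)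
  have QSuc: "Q (Suc t) = (down ^^ (t * ?s)) (\<lambda>Y. (down ^^ ?s) q Y) X" for t
  proof -
    have "Suc t * ?s = t * ?s + ?s" by simp
    then show ?thesis unfolding Q_def by (simp only: funpow_add o_apply)
  qed
  have mono: "Q t \<le> Q (Suc t)" if t: "t < M" for t
    unfolding QSuc unfolding Q_def
  proof (rule down_pow_mono[OF X])
    fix Y assume "reach (t * ?s) X Y"
    then show "q Y \<le> (down ^^ ?s) q Y"
      using phi_double_step(2)[OF Y2(2) mu Y2(1) eta, of t Y t] t unfolding q_def by blast
  qed
  have step: "Q t - P \<le> \<eta> / 2 * rdim X + (Q (Suc t) - Q t) / (2 * \<eta>)" if t: "t < M" for t
  proof -
    have "Q t = (down ^^ (t * ?s)) (\<lambda>Y. q Y) X" by (simp add: Q_def)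
    also have "\<dots> \<le> (down ^^ (t * ?s)) (\<lambda>Y. rdim Y * phi (mu @ mu) Y + (\<eta> / 2 * rdim Y +
        (1 / (2 * \<eta>) * (down ^^ ?s) q Y + (- 1 / (2 * \<eta>)) * q Y))) X"
    proof (rule down_pow_mono[OF X])
      fix Y assume "reach (t * ?s) X Y"
      then have "q Y - rdim Y * phi (mu @ mu) Y \<le> \<eta> / 2 * rdim Y + ((down ^^ ?s) q Y - q Y) / (2 * \<eta>)"
        using phi_double_step(1)[OF Y2(2) mu Y2(1) eta, of t Y t] t unfolding q_def by blast
      then show "q Y \<le> rdim Y * phi (mu @ mu) Y + (\<eta> / 2 * rdim Y +
        (1 / (2 * \<eta>) * (down ^^ ?s) q Y + (- 1 / (2 * \<eta>)) * q Y))"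
        by (simp add: diff_divide_distrib)
    qed
    also have "\<dots> = P + (\<eta> / 2 * rdim X + (1 / (2 * \<eta>) * Q (Suc t) + (- 1 / (2 * \<eta>)) * Q t))"
    proof -
      have a: "(down ^^ (t * ?s)) rdim X = rdim X" using sM[OF t] by (intro down_pow_rdim[OF X]) simp
      have b: "(down ^^ (t * ?s)) (\<lambda>Y. rdim Y * phi (mu @ mu) Y) X = P"
        unfolding P_def using sM[OF t] by (intro down_pow_phi[OF X]) simp
      show ?thesis unfolding down_pow_add down_pow_scale a b QSuc[symmetric] by (simp add: Q_def)
    qed
    finally show ?thesis by (simp add: diff_divide_distrib)
  qed
  have Q0: "Q 0 \<le> Q t" if "t \<le> M" for t
    using that 
  proof (induction t)
    case (Suc t)
    then show ?case using mono[of t] by simp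
  qed simp
  have QM: "Q M \<le> rdim X"
  proof -
    have "Q M \<le> (down ^^ (M * ?s)) rdim X" unfolding Q_def
    proof (rule down_pow_mono[OF X])
      fix Y assume "reach (M * ?s) X Y"
      then have Y: "finite Y" "?s \<le> sz Y" using M(1) by (auto simp: reach_def)
      have "(phi mu Y)\<^sup>2 \<le> 1" using phi_le_1[OF Y(1) mu Y(2)] by (simp add: abs_square_le_1)
      then show "q Y \<le> rdim Y" unfolding q_def using rdim_pos[OF Y(1)] by (simp add: mult_le_cancel_left1)
    qed
    also have "\<dots> = rdim X" using M(1) by (intro down_pow_rdim[OF X]) simp
    finally show ?thesis .
  qed
  have "(\<Sum>t<M. Q 0 - P) \<le> (\<Sum>t<M. \<eta> / 2 * rdim X + (Q (Suc t) - Q t) / (2 * \<eta>))"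
  proof (rule sum_mono)
    fix t assume "t \<in> {..<M}"
    then show "Q 0 - P \<le> \<eta> / 2 * rdim X + (Q (Suc t) - Q t) / (2 * \<eta>)"
      using step[of t] Q0[of t] by simp
  qed
  also have "\<dots> = real M * (\<eta> / 2 * rdim X) + (Q M - Q 0) / (2 * \<eta>)"
    by (simp add: sum.distrib sum_divide_distrib[symmetric] sum_lessThan_telescope)
  also have "\<dots> \<le> real M * (\<eta> / 2 * rdim X) + rdim X / (2 * \<eta>)"
  proof -
    have "0 \<le> Q 0" using rdim_pos[OF X] by (simp add: Q_def q_def)
    then show ?thesis using QM eta by (intro add_left_mono divide_right_mono) auto
  qed
  finally have "real M * (Q 0 - P) \<le> real M * (\<eta> / 2 * rdim X) + rdim X / (2 * \<eta>)" by simp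
  then have "Q 0 - P \<le> \<eta> / 2 * rdim X + rdim X / (2 * \<eta>) / real M"
  proof -
    assume a: "real M * (Q 0 - P) \<le> real M * (\<eta> / 2 * rdim X) + rdim X / (2 * \<eta>)"
    have "real M * (\<eta> / 2 * rdim X + rdim X / (2 * \<eta>) / real M) = real M * (\<eta> / 2 * rdim X) + rdim X / (2 * \<eta>)"
      using M(2) by (simp add: distrib_left)
    then have "real M * (Q 0 - P) \<le> real M * (\<eta> / 2 * rdim X + rdim X / (2 * \<eta>) / real M)"
      using a by (simp only:)
    then show ?thesis using M(2) by (simp only: mult_le_cancel_left_pos of_nat_0_less_iff)
  qed
  then have "rdim X * ((phi mu X)\<^sup>2 - phi (mu @ mu) X) \<le> rdim X * (\<eta> / 2 + 1 / (2 * \<eta> * real M))"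
    by (simp add: Q_def P_def q_def algebra_simps)
  then have "(phi mu X)\<^sup>2 - phi (mu @ mu) X \<le> \<eta> / 2 + 1 / (2 * \<eta> * real M)"
    using rdim_pos[OF X] by (simp only: mult_le_cancel_left_pos)
  then show ?thesis using abs_ge_self[of "phi (mu @ mu) X"] by linarith
qed

section \<open>Crude bounds on characters and on the number of shapes\<close>

text \<open>Below the \<open>i\<close>-th removable particle there are at least \<open>i\<close> holes, namely the targets of the
  removable particles up to it.\<close>
lemma card_legal_le:
  assumes X: "finite X" and r: "0 < r"
  shows "(card (legal r X))\<^sup>2 \<le> 2 * sz X"
proof -
  let ?R = "legal r X"
  define A where "A = (SIGMA x:X. {y. y < x \<and> y \<in> X})"
  define B where "B = (SIGMA x:X. {y. y < x \<and> y \<notin> X})"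
  define C where "C = {(x, y). x \<in> ?R \<and> y \<in> ?R \<and> y \<le> x}"
  have fR: "finite ?R" by (rule finite_legal[OF X])
  have fA: "finite A" unfolding A_def using X by auto
  have fB: "finite B" unfolding B_def using X by auto
  have fC: "finite C" unfolding C_def by (rule finite_subset[of _ "?R \<times> ?R"]) (use fR in auto)
  \<comment> \<open>Below the \<open>i\<close>-th smallest particle, counted from 0, there are
    exactly \<open>i\<close> particles. Hence the pairs in \<open>B\<close>, a particle with a hole
    below it, number \<open>sz X\<close>.\<close>
  have "card A = \<Sum>{..<card X}"
  proof -
    have "card A = (\<Sum>x\<in>X. card {y. y < x \<and> y \<in> X})" unfolding A_def using X by (subst card_SigmaI) auto
    also have "\<dots> = (\<Sum>i<card X. card {y. y < en X i \<and> y \<in> X})"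
      by (rule sum.reindex_bij_betw[OF en_bij[OF X], symmetric])
    also have "\<dots> = (\<Sum>i<card X. i)"
    proof (rule sum.cong[OF refl])
      fix i assume i: "i \<in> {..<card X}"
      have "{y. y < en X i \<and> y \<in> X} = en X ` {..<i}"
      proof (intro equalityI subsetI)
        fix y assume y: "y \<in> {y. y < en X i \<and> y \<in> X}"
        then obtain j where j: "j < card X" "y = en X j" using en_bij[OF X] by (auto simp: bij_betw_def)
        then have "j < i" using y i en_strict_mono[of i j X] by (cases j i rule: linorder_cases) auto
        then show "y \<in> en X ` {..<i}" using j by auto
      next
        fix y assume "y \<in> en X ` {..<i}"
        then obtain j where j: "j < i" "y = en X j" by auto
        then show "y \<in> {y. y < en X i \<and> y \<in> X}"
          using i en_strict_mono[of j i X] bij_betwE[OF en_bij[OF X]] by auto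
      qed
      moreover have "inj_on (en X) {..<i}"
        using en_bij[OF X] i by (auto simp: bij_betw_def intro: inj_on_subset)
      ultimately show "card {y. y < en X i \<and> y \<in> X} = i" by (simp add: card_image)
    qed
    finally show ?thesis .
  qed
  moreover have "card A + card B = \<Sum>X"
  proof -
    have "card A + card B = card (A \<union> B)" using fA fB by (subst card_Un_disjoint) (auto simp: A_def B_def)
    also have "A \<union> B = (SIGMA x:X. {..<x})" by (auto simp: A_def B_def)
    also have "card \<dots> = \<Sum>X" using X by (subst card_SigmaI) auto
    finally show ?thesis .
  qed
  ultimately have "card B = sz X" using sz_eq(1)[OF X] by simp
  \<comment> \<open>For \<open>y <= x\<close> the target \<open>y - r\<close> is a hole below
    \<open>x\<close>.\<close>
  moreover have "card C \<le> card B"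
  proof (rule card_inj_on_le[OF _ _ fB])
    show "inj_on (\<lambda>(x, y). (x, y - r)) C"
      by (auto simp: inj_on_def C_def legal_def)
    show "(\<lambda>(x, y). (x, y - r)) ` C \<subseteq> B"
      using r by (auto simp: C_def B_def legal_def)
  qed
  moreover have "card (?R \<times> ?R) \<le> 2 * card C"
  proof -
    have "?R \<times> ?R \<subseteq> C \<union> prod.swap ` C" by (auto simp: C_def image_iff)
    then have "card (?R \<times> ?R) \<le> card (C \<union> prod.swap ` C)" using fC by (intro card_mono) auto
    also have "\<dots> \<le> card C + card (prod.swap ` C)" by (rule card_Un_le)
    also have "\<dots> \<le> 2 * card C" using card_image_le[OF fC, of prod.swap] by simp
    finally show ?thesis .
  qed
  ultimately show ?thesis by (simp add: card_cartesian_product power2_eq_square)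
qed

text \<open>The Murnaghan--Nakayama rule with at most \<open>sqrt (2 * s)\<close> terms per part.
  With all parts equal to 1 it bounds the degree as well.\<close>

lemma abs_ch_le_sqrt_power:
  assumes "finite X" "\<forall>r\<in>set mu. 0 < r" "sz X \<le> s"
  shows "\<bar>ch mu X\<bar> \<le> sqrt (2 * real s) ^ length mu"
  using assms
proof (induction mu arbitrary: X)
  case Nil
  then show ?case by (simp add: ch_def jts_Nil)
next
  case (Cons r mu)
  have r: "0 < r" and X: "finite X" using Cons.prems by auto
  have "\<bar>ch (r # mu) X\<bar> \<le> (\<Sum>x\<in>legal r X. \<bar>ch mu (mv r x X)\<bar>)"
    unfolding ch_Cons[OF X r] by (rule hook_abs[OF X r])
  also have "\<dots> \<le> (\<Sum>x\<in>legal r X. sqrt (2 * real s) ^ length mu)"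
  proof (rule sum_mono)
    fix x assume x: "x \<in> legal r X"
    show "\<bar>ch mu (mv r x X)\<bar> \<le> sqrt (2 * real s) ^ length mu"
      using sz_mv[OF X x] Cons.prems by (intro Cons.IH finite_mv) auto
  qed
  also have "\<dots> = real (card (legal r X)) * sqrt (2 * real s) ^ length mu" by simp
  also have "\<dots> \<le> sqrt (2 * real s) * sqrt (2 * real s) ^ length mu"
  proof (intro mult_right_mono real_le_rsqrt)
    have "(real (card (legal r X)))\<^sup>2 = real ((card (legal r X))\<^sup>2)" by simp
    also have "\<dots> \<le> real (2 * s)"
      using card_legal_le[OF X r] Cons.prems(3) unfolding of_nat_le_iff by linarith
    finally show "(real (card (legal r X)))\<^sup>2 \<le> 2 * real s" by simp
  qed simp
  finally show ?case by simp
qed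

text \<open>The degree is positive, but for size 0 it is the indicator of the ground state.\<close>

lemma sz_0:
  assumes "finite X" "sz X = 0"
  shows "X = {..<card X}"
proof -
  have "ch [] X = rdim X" using assms(2) by (simp add: rdim_ch)
  then have "jts [] X {..<card X} \<noteq> 0" using rdim_pos[OF assms(1)] by (auto simp: ch_def)
  then show ?thesis using assms(1) by (simp add: jts_Nil split: if_splits)
qed

lemma card_Diff_Max:
  assumes "finite Y" "card Y = Suc L"
  shows "sz Y = sz (Y - {Max Y}) + (Max Y - L)" "L \<le> Max Y" "card (Y - {Max Y}) = L"
proof -
  have ne: "Y \<noteq> {}" using assms by auto
  have M: "Max Y \<in> Y" using assms ne by simp
  show c: "card (Y - {Max Y}) = L" using assms M by simp
  have "Y \<subseteq> {..Max Y}" using assms by auto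
  then have "card Y \<le> card {..Max Y}" by (intro card_mono) auto
  then show L: "L \<le> Max Y" using assms by simp
  have "\<Sum>Y = Max Y + \<Sum>(Y - {Max Y})" using assms M by (simp add: sum.remove)
  then show "sz Y = sz (Y - {Max Y}) + (Max Y - L)"
    using sz_eq(1)[OF assms(1)] sz_eq(1)[of "Y - {Max Y}"] assms c L by simp
qed

text \<open>Deleting the largest particle removes the first row, of length \<open>Max Y - L\<close>.
  For \<open>s > 0\<close> this row is nonempty, the rest has size below \<open>s\<close> and
  determines \<open>Y\<close>, and \<open>1 + 2 + ... + 2^(s - 1) < 2^s\<close>.\<close>

lemma card_beta_sets_le:
  "finite {Y. finite Y \<and> card Y = L \<and> sz Y = s} \<and> card {Y. finite Y \<and> card Y = L \<and> sz Y = s} \<le> 2 ^ s"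
proof (induction L arbitrary: s)
  case 0
  have sub: "{Y. finite Y \<and> card Y = 0 \<and> sz Y = s} \<subseteq> {{}}" by auto
  have "card {Y. finite Y \<and> card Y = 0 \<and> sz Y = s} \<le> 1"
    using card_mono[OF _ sub] by simp
  also have "1 \<le> (2::nat) ^ s" by simp
  finally show ?case using finite_subset[OF sub] by simp
next
  case (Suc L)
  define P where "P L s = {Y::nat set. finite Y \<and> card Y = L \<and> sz Y = s}" for L s
  have IH: "finite (P L s)" "card (P L s) \<le> 2 ^ s" for s
    using Suc.IH[of s] by (auto simp: P_def)
  show ?case unfolding P_def[symmetric]
  proof (cases s)
    case 0
    then have "P (Suc L) s \<subseteq> {{..<Suc L}}" using sz_0 unfolding P_def by fastforce
    then have "finite (P (Suc L) s)" "card (P (Suc L) s) \<le> card {{..<Suc L}}"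
      using finite_subset[of "P (Suc L) s" "{{..<Suc L}}"] card_mono[of "{{..<Suc L}}" "P (Suc L) s"] by blast+
    then show "finite (P (Suc L) s) \<and> card (P (Suc L) s) \<le> 2 ^ s" using 0 by simp
  next
    case (Suc s')
    let ?U = "\<Union>i<s. P L i"
    have fU: "finite ?U" using IH(1) by simp
    have inj: "inj_on (\<lambda>Y. Y - {Max Y}) (P (Suc L) s)"
    proof (rule inj_onI)
      fix Y Z assume Y: "Y \<in> P (Suc L) s" and Z: "Z \<in> P (Suc L) s" and e: "Y - {Max Y} = Z - {Max Z}"
      have Y': "finite Y" "card Y = Suc L" "sz Y = s" and Z': "finite Z" "card Z = Suc L" "sz Z = s"
        using Y Z by (auto simp: P_def)
      have "Max Y - L = Max Z - L"
        using card_Diff_Max(1)[OF Y'(1,2)] card_Diff_Max(1)[OF Z'(1,2)] Y'(3) Z'(3) e by simp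
      then have M: "Max Y = Max Z" using card_Diff_Max(2)[OF Y'(1,2)] card_Diff_Max(2)[OF Z'(1,2)] by simp
      have ne: "Y \<noteq> {}" "Z \<noteq> {}" using Y'(2) Z'(2) by auto
      have "Y = insert (Max Y) (Y - {Max Y})" by (rule insert_Diff[OF Max_in[OF Y'(1) ne(1)], symmetric])
      also have "\<dots> = insert (Max Z) (Z - {Max Z})" by (rule arg_cong2[where f = insert, OF M e])
      also have "\<dots> = Z" by (rule insert_Diff[OF Max_in[OF Z'(1) ne(2)]])
      finally show "Y = Z" .
    qed
    have sub: "(\<lambda>Y. Y - {Max Y}) ` P (Suc L) s \<subseteq> ?U"
    proof (rule image_subsetI)
      fix Y assume "Y \<in> P (Suc L) s"
      then have Y: "finite Y" "card Y = Suc L" "sz Y = s" by (auto simp: P_def)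
      have "sz (Y - {Max Y}) < s"
      proof (rule ccontr)
        assume "\<not> ?thesis"
        then have "Max Y = L" using card_Diff_Max[OF Y(1,2)] Y(3) by simp
        then have "Y \<subseteq> {..<Suc L}" using Y(1) by (auto simp: less_Suc_eq_le)
        then have "Y = {..<Suc L}" using Y(2) by (intro card_subset_eq) auto
        then have "sz Y = 0" by simp
        then show False using Y(3) Suc by simp
      qed
      then show "Y - {Max Y} \<in> ?U" using card_Diff_Max(3)[OF Y(1,2)] Y(1) by (auto simp: P_def)
    qed
    have "finite (P (Suc L) s)" using inj sub fU by (meson finite_imageD finite_subset)
    moreover have "card (P (Suc L) s) \<le> card ?U" using inj sub fU by (rule card_inj_on_le)
    moreover have "card ?U \<le> (\<Sum>i<s. card (P L i))" by (rule card_UN_le) simp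
    moreover have "(\<Sum>i<s. card (P L i)) \<le> (\<Sum>i<s. 2 ^ i)" using IH(2) by (intro sum_mono)
    moreover have "(\<Sum>i<s. 2 ^ i) = (2::nat) ^ s - 1" by (simp add: mask_eq_sum_exp_nat lessThan_def[symmetric])
    ultimately show "finite (P (Suc L) s) \<and> card (P (Suc L) s) \<le> 2 ^ s" by linarith
  qed
qed

lemma down_pow_ind_jts:
  assumes "finite X" "finite Y" "card Y = card X"
  shows "(down ^^ k) (ind Y) X = real_of_int (jts (replicate k 1) X Y)"
  using assms
proof (induction k arbitrary: X)
  case 0
  then show ?case by (simp add: jts_Nil ind_def)
next
  case (Suc k)
  have "(down ^^ k) (ind Y) (mv 1 x X) = real_of_int (jts (replicate k 1) (mv 1 x X) Y)" if "x \<in> legal 1 X" for x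
    using Suc.prems card_mv[OF Suc.prems(1) that] by (intro Suc.IH finite_mv) auto
  then show ?case unfolding down_pow_Suc replicate_Suc jts_Cons_1[OF Suc.prems(1,3)] by simp
qed

text \<open>Removing the fixed points first leaves a shape \<open>Y\<close> of size \<open>s\<close>
  inside \<open>{..m}\<close>. The factors stand for the number of such shapes
  (\<open>2 ^ s\<close>), for the character of \<open>Y\<close> at \<open>mu\<close> together with
  its degree (powers of the square root), and for the number of chains from \<open>X\<close> to
  \<open>Y\<close> (\<open>jts_ones_le\<close>).\<close>

lemma phi_le_factorial:
  assumes X: "finite X" "X \<subseteq> {..m}" and mu: "\<forall>r\<in>set mu. 2 \<le> r" "sum_list mu \<le> sz X"
  defines "s \<equiv> sum_list mu"
  shows "\<bar>phi mu X\<bar> \<le> 2 ^ s * sqrt (2 * real s) ^ (length mu + s) * real m ^ (2 * s) * fact (sz X - s) / (fact (sz X) * fact s)"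
proof -
  let ?k = "sz X - s"
  let ?P = "{Y. finite Y \<and> card Y = card X \<and> sz Y = s}"
  let ?c = "sqrt (2 * real s)"
  have fP: "finite ?P" and cP: "card ?P \<le> 2 ^ s" using card_beta_sets_le[of "card X" s] by auto
  have pos: "\<forall>r\<in>set mu. 0 < r" using mu(1) by auto
  have "\<bar>rdim X * phi mu X\<bar> = \<bar>ch (replicate ?k 1 @ mu) X\<bar>"
    unfolding rdim_phi[OF X(1)] s_def by (subst ch_mset[of "mu @ _"]) auto
  also have "\<dots> \<le> (down ^^ ?k) (\<lambda>Y. \<bar>ch mu Y\<bar>) X"
    unfolding ch_ones[OF X(1)] by (rule down_pow_abs[OF X(1)])
  also have "\<dots> \<le> (down ^^ ?k) (\<lambda>Z. \<Sum>Y\<in>?P \<inter> Pow {..m}. ?c ^ length mu * ind Y Z) X"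
  proof (rule down_pow_mono[OF X(1)])
    fix Z assume Z: "reach ?k X Z"
    then have Z': "finite Z" "sz Z = s" "Z \<in> ?P \<inter> Pow {..m}"
      using mu(2) X(2) unfolding s_def reach_def by auto
    have "\<bar>ch mu Z\<bar> \<le> ?c ^ length mu * ind Z Z"
      using abs_ch_le_sqrt_power[OF Z'(1) pos, of s] Z'(2) by simp
    also have "\<dots> \<le> (\<Sum>Y\<in>?P \<inter> Pow {..m}. ?c ^ length mu * ind Y Z)"
      using fP Z'(3) by (intro member_le_sum[of Z _ "\<lambda>Y. ?c ^ length mu * ind Y Z"]) (auto simp: ind_nonneg)
    finally show "\<bar>ch mu Z\<bar> \<le> (\<Sum>Y\<in>?P \<inter> Pow {..m}. ?c ^ length mu * ind Y Z)" .
  qed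
  also have "\<dots> = (\<Sum>Y\<in>?P \<inter> Pow {..m}. ?c ^ length mu * (down ^^ ?k) (ind Y) X)"
    unfolding down_pow_sum down_pow_scale ..
  also have "\<dots> \<le> (\<Sum>Y\<in>?P \<inter> Pow {..m}. ?c ^ length mu *
      (real m ^ (2 * s) * fact ?k / (fact (sz X) * fact s) * rdim X * ?c ^ s))"
  proof (intro sum_mono mult_left_mono)
    fix Y assume "Y \<in> ?P \<inter> Pow {..m}"
    then have Y: "finite Y" "card Y = card X" "sz Y = s" "Y \<subseteq> {..m}" by auto
    have "(down ^^ ?k) (ind Y) X = real_of_int (jts (replicate ?k 1) X Y)"
      using X(1) Y(1,2) by (rule down_pow_ind_jts)
    also have "\<dots> \<le> real m ^ (2 * sz Y) * fact ?k / (fact (sz X) * fact (sz Y)) * dm X * dm Y"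
      using X Y mu(2) unfolding s_def by (intro jts_ones_le) auto
    also have "\<dots> = real m ^ (2 * s) * fact ?k / (fact (sz X) * fact s) * rdim X * rdim Y"
      by (simp add: Y(3) rdim_def)
    also have "\<dots> \<le> real m ^ (2 * s) * fact ?k / (fact (sz X) * fact s) * rdim X * ?c ^ s"
    proof (rule mult_left_mono)
      show "rdim Y \<le> ?c ^ s"
        using abs_ch_le_sqrt_power[OF Y(1), of "replicate s 1" s] Y(3) rdim_ch[of Y] by simp
      show "0 \<le> real m ^ (2 * s) * fact ?k / (fact (sz X) * fact s) * rdim X"
        using rdim_pos[OF X(1)] by simp
    qed
    finally show "(down ^^ ?k) (ind Y) X \<le> real m ^ (2 * s) * fact ?k / (fact (sz X) * fact s) * rdim X * ?c ^ s" .
  qed simp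
  also have "\<dots> = real (card (?P \<inter> Pow {..m})) * (?c ^ length mu *
      (real m ^ (2 * s) * fact ?k / (fact (sz X) * fact s) * rdim X * ?c ^ s))" by simp
  also have "\<dots> \<le> 2 ^ s * (?c ^ length mu *
      (real m ^ (2 * s) * fact ?k / (fact (sz X) * fact s) * rdim X * ?c ^ s))"
  proof (rule mult_right_mono)
    have "card (?P \<inter> Pow {..m}) \<le> card ?P" using fP by (intro card_mono) auto
    then have "card (?P \<inter> Pow {..m}) \<le> 2 ^ s" using cP by linarith
    then show "real (card (?P \<inter> Pow {..m})) \<le> 2 ^ s"
      by (metis of_nat_le_iff of_nat_numeral of_nat_power)
  qed (use rdim_pos[OF X(1)] in simp)
  also have "\<dots> = rdim X * (2 ^ s * ?c ^ (length mu + s) * real m ^ (2 * s) * fact ?k / (fact (sz X) * fact s))"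
    by (simp add: power_add)
  finally have "rdim X * \<bar>phi mu X\<bar> \<le> rdim X * (2 ^ s * ?c ^ (length mu + s) * real m ^ (2 * s) * fact ?k / (fact (sz X) * fact s))"
    using rdim_pos[OF X(1)] by (simp add: abs_mult)
  then show ?thesis using rdim_pos[OF X(1)] by (simp only: mult_le_cancel_left_pos)
qed

section \<open>Standard tableaux and beta sets\<close>

definition down_closed :: "(nat \<times> nat) set \<Rightarrow> bool" where
  "down_closed C \<longleftrightarrow> (\<forall>i j. (i, j + 1) \<in> C \<longrightarrow> (i, j) \<in> C) \<and> (\<forall>i j. (i + 1, j) \<in> C \<longrightarrow> (i, j) \<in> C)"

definition tableaux :: "(nat \<times> nat) set \<Rightarrow> (nat \<times> nat \<Rightarrow> nat) set" where
  "tableaux C = {T. T \<in> C \<rightarrow>\<^sub>E {1..card C} \<and> bij_betw T C {1..card C}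
      \<and> (\<forall>i j. (i, j + 1) \<in> C \<longrightarrow> T (i, j) < T (i, j + 1))
      \<and> (\<forall>i j. (i + 1, j) \<in> C \<longrightarrow> T (i, j) < T (i + 1, j))}"

text \<open>The corners, which are the cells that can carry the largest entry.\<close>

definition maxcells :: "(nat \<times> nat) set \<Rightarrow> (nat \<times> nat) set" where
  "maxcells C = {c \<in> C. (fst c, snd c + 1) \<notin> C \<and> (fst c + 1, snd c) \<notin> C}"

lemma tableaux_finite: "finite C \<Longrightarrow> finite (tableaux C)"
  unfolding tableaux_def by (rule finite_subset[OF _ finite_PiE[of C "\<lambda>_. {1..card C}"]]) auto

text \<open>The largest entry is erased from the corner \<open>c\<close>. It can be put back there
  because no cell to the right of \<open>c\<close> or below it has to exceed it.\<close>

lemma card_tableaux_remove: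
  assumes C: "finite C" "down_closed C" and c: "c \<in> maxcells C"
  shows "card {T \<in> tableaux C. T c = card C} = card (tableaux (C - {c}))"
proof -
  let ?D = "C - {c}" and ?n = "card C"
  have cC: "c \<in> C" and cr: "(fst c, snd c + 1) \<notin> C" and cd: "(fst c + 1, snd c) \<notin> C"
    using c by (simp_all add: maxcells_def)
  have nc: "(i, j) \<noteq> c" if "(i, j + 1) \<in> C \<or> (i + 1, j) \<in> C" for i j
    using that cr cd by (cases c) fastforce
  have n: "?n = Suc (card ?D)" using card_Suc_Diff1[OF C(1) cC] by (rule sym)
  have Dd: "(i, j) \<in> ?D" if "(i, j + 1) \<in> C \<or> (i + 1, j) \<in> C" for i j
    using that nc[OF that] C(2) unfolding down_closed_def by blast
  have set: "{1..?n} - {?n} = {1..card ?D}" unfolding n by auto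
  have "bij_betw (\<lambda>T. restrict T ?D) {T \<in> tableaux C. T c = ?n} (tableaux ?D)"
  proof (rule bij_betw_byWitness[where f' = "\<lambda>T. T(c := ?n)"])
    show "\<forall>T\<in>{T \<in> tableaux C. T c = ?n}. (restrict T ?D)(c := ?n) = T"
    proof
      fix T assume "T \<in> {T \<in> tableaux C. T c = ?n}"
      then have T: "T \<in> C \<rightarrow>\<^sub>E {1..?n}" "T c = ?n" by (simp_all add: tableaux_def)
      show "(restrict T ?D)(c := ?n) = T"
      proof
        fix y
        show "((restrict T ?D)(c := ?n)) y = T y"
          using T(2) PiE_arb[OF T(1), of y] by (cases "y = c"; cases "y \<in> C") simp_all
      qed
    qed
    show "\<forall>T\<in>tableaux ?D. restrict (T(c := ?n)) ?D = T"
    proof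
      fix T assume "T \<in> tableaux ?D"
      then have T: "T \<in> ?D \<rightarrow>\<^sub>E {1..card ?D}" by (simp add: tableaux_def)
      show "restrict (T(c := ?n)) ?D = T"
      proof
        fix y
        show "restrict (T(c := ?n)) ?D y = T y"
          using PiE_arb[OF T, of y] by (cases "y \<in> ?D") auto
      qed
    qed
    show "(\<lambda>T. restrict T ?D) ` {T \<in> tableaux C. T c = ?n} \<subseteq> tableaux ?D"
    proof (rule image_subsetI)
      fix T assume T: "T \<in> {T \<in> tableaux C. T c = ?n}"
      have Tb: "bij_betw T C {1..?n}" and Tc: "T c = ?n"
        and Tr: "\<And>i j. (i, j + 1) \<in> C \<Longrightarrow> T (i, j) < T (i, j + 1)"
        and Td: "\<And>i j. (i + 1, j) \<in> C \<Longrightarrow> T (i, j) < T (i + 1, j)"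
        using T by (simp_all add: tableaux_def)
      have inj: "inj_on T C" using Tb by (simp add: bij_betw_def)
      have "T ` ?D = T ` C - T ` {c}" using inj_on_image_set_diff[OF inj, of C "{c}"] cC by simp
      also have "\<dots> = {1..card ?D}" using Tb Tc set by (simp add: bij_betw_def)
      finally have img: "T ` ?D = {1..card ?D}" .
      have b: "bij_betw T ?D {1..card ?D}"
        using img inj_on_subset[OF inj] by (auto simp: bij_betw_def)
      have b': "bij_betw (restrict T ?D) ?D {1..card ?D}"
        using b by (subst bij_betw_cong[of _ _ T]) simp_all
      have "restrict T ?D \<in> ?D \<rightarrow>\<^sub>E {1..card ?D}"
        unfolding PiE_iff using img by (auto simp: extensional_def)
      moreover have "restrict T ?D (i, j) < restrict T ?D (i, j + 1)" if "(i, j + 1) \<in> ?D" for i j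
        using that Dd[of i j] Tr[of i j] by simp
      moreover have "restrict T ?D (i, j) < restrict T ?D (i + 1, j)" if "(i + 1, j) \<in> ?D" for i j
        using that Dd[of i j] Td[of i j] by simp
      ultimately show "restrict T ?D \<in> tableaux ?D" unfolding tableaux_def mem_Collect_eq using b' by blast
    qed
    show "(\<lambda>T. T(c := ?n)) ` tableaux ?D \<subseteq> {T \<in> tableaux C. T c = ?n}"
    proof (rule image_subsetI)
      fix T assume T: "T \<in> tableaux ?D"
      have Tp: "T \<in> ?D \<rightarrow>\<^sub>E {1..card ?D}" and Tb: "bij_betw T ?D {1..card ?D}"
        and Tr: "\<And>i j. (i, j + 1) \<in> ?D \<Longrightarrow> T (i, j) < T (i, j + 1)"
        and Td: "\<And>i j. (i + 1, j) \<in> ?D \<Longrightarrow> T (i, j) < T (i + 1, j)"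
        using T by (simp_all add: tableaux_def)
      have CD: "insert c ?D = C" using cC by blast
      have sn: "insert ?n {1..card ?D} = {1..?n}" unfolding n by auto
      have lt: "T y < ?n" if "y \<in> ?D" for y using PiE_mem[OF Tp that] n by simp
      have le: "T y \<in> {1..?n}" if "y \<in> ?D" for y using PiE_mem[OF Tp that] n by simp
      have "T(c := ?n) \<in> insert c ?D \<rightarrow>\<^sub>E {1..?n}"
      proof (rule PiE_fun_upd)
        show "T \<in> ?D \<rightarrow>\<^sub>E {1..?n}" using le PiE_arb[OF Tp] by (intro PiE_I)
      qed (use n in simp)
      then have p: "T(c := ?n) \<in> C \<rightarrow>\<^sub>E {1..?n}" unfolding CD .
      have "bij_betw (T(c := ?n)) ?D {1..card ?D}"
        using Tb by (subst bij_betw_cong[of _ _ T]) auto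
      then have "bij_betw (T(c := ?n)) (?D \<union> {c}) ({1..card ?D} \<union> {(T(c := ?n)) c})"
        by (intro notIn_Un_bij_betw) (use n in simp_all)
      moreover have "?D \<union> {c} = C" using cC by blast
      moreover have "{1..card ?D} \<union> {(T(c := ?n)) c} = {1..?n}" using sn by simp
      ultimately have b: "bij_betw (T(c := ?n)) C {1..?n}" by (simp only:)
      have "(T(c := ?n)) (i, j) < (T(c := ?n)) (i, j + 1)" if "(i, j + 1) \<in> C" for i j
        using that Dd[of i j] Tr[of i j] lt[of "(i, j)"] by (cases "(i, j + 1) = c") auto
      moreover have "(T(c := ?n)) (i, j) < (T(c := ?n)) (i + 1, j)" if "(i + 1, j) \<in> C" for i j
        using that Dd[of i j] Td[of i j] lt[of "(i, j)"] by (cases "(i + 1, j) = c") auto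
      ultimately show "T(c := ?n) \<in> {T \<in> tableaux C. T c = ?n}"
        unfolding tableaux_def mem_Collect_eq using p b by auto
    qed
  qed
  then show ?thesis by (rule bij_betw_same_card)
qed

lemma card_tableaux_rec:
  assumes C: "finite C" "down_closed C" "C \<noteq> {}"
  shows "card (tableaux C) = (\<Sum>c\<in>maxcells C. card (tableaux (C - {c})))"
proof -
  let ?n = "card C"
  have fm: "finite (maxcells C)" using C(1) by (simp add: maxcells_def)
  have n: "0 < ?n" using C by (simp add: card_gt_0_iff)
  have "tableaux C = (\<Union>c\<in>maxcells C. {T \<in> tableaux C. T c = ?n})"
  proof (intro equalityI subsetI)
    fix T assume T: "T \<in> tableaux C"
    have Tp: "T \<in> C \<rightarrow>\<^sub>E {1..?n}" and Tb: "bij_betw T C {1..?n}"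
      and Tr: "\<And>i j. (i, j + 1) \<in> C \<Longrightarrow> T (i, j) < T (i, j + 1)"
      and Td: "\<And>i j. (i + 1, j) \<in> C \<Longrightarrow> T (i, j) < T (i + 1, j)"
      using T by (simp_all add: tableaux_def)
    have "?n \<in> T ` C" using Tb n by (simp add: bij_betw_def)
    then obtain c where c: "c \<in> C" "T c = ?n" by auto
    have le: "T y \<le> ?n" if "y \<in> C" for y using PiE_mem[OF Tp that] by simp
    have "c \<in> maxcells C"
      unfolding maxcells_def using c Tr[of "fst c" "snd c"] Td[of "fst c" "snd c"] le by fastforce
    then show "T \<in> (\<Union>c\<in>maxcells C. {T \<in> tableaux C. T c = ?n})" using T c(2) by blast
  qed blast
  then have "card (tableaux C) = card (\<Union>c\<in>maxcells C. {T \<in> tableaux C. T c = ?n})" by simp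
  also have "\<dots> = (\<Sum>c\<in>maxcells C. card {T \<in> tableaux C. T c = ?n})"
  proof (rule card_UN_disjoint[OF fm])
    show "\<forall>c\<in>maxcells C. finite {T \<in> tableaux C. T c = ?n}" using tableaux_finite[OF C(1)] by simp
    show "\<forall>c\<in>maxcells C. \<forall>d\<in>maxcells C. c \<noteq> d \<longrightarrow> {T \<in> tableaux C. T c = ?n} \<inter> {T \<in> tableaux C. T d = ?n} = {}"
    proof (intro ballI impI)
      fix c d assume cd: "c \<in> maxcells C" "d \<in> maxcells C" "c \<noteq> d"
      have False if "T \<in> tableaux C" "T c = ?n" "T d = ?n" for T
      proof -
        have "inj_on T C" using that(1) by (simp add: tableaux_def bij_betw_def)
        then show False using cd that(2,3) unfolding inj_on_def maxcells_def by auto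
      qed
      then show "{T \<in> tableaux C. T c = ?n} \<inter> {T \<in> tableaux C. T d = ?n} = {}" by blast
    qed
  qed
  also have "\<dots> = (\<Sum>c\<in>maxcells C. card (tableaux (C - {c})))"
    using card_tableaux_remove[OF C(1,2)] by simp
  finally show ?thesis .
qed

lemma card_tableaux_empty: "card (tableaux {}) = 1"
proof -
  have "tableaux {} = {\<lambda>x. undefined}" by (auto simp: tableaux_def bij_betw_def)
  then show ?thesis by simp
qed

section \<open>Beta sets of partitions\<close>

definition beta_set :: "nat list \<Rightarrow> nat set" where
  "beta_set nu = (\<lambda>i. nu ! i + (length nu - 1 - i)) ` {..<length nu}"

lemma beta_strict:
  assumes "sorted_wrt (\<ge>) nu" "i < j" "j < length nu"
  shows "nu ! j + (length nu - 1 - j) < nu ! i + (length nu - 1 - i)"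
proof -
  have "nu ! j \<le> nu ! i" using assms by (simp add: sorted_wrt_iff_nth_less)
  then show ?thesis using assms(2,3) by linarith
qed

lemma beta_inj:
  assumes "sorted_wrt (\<ge>) nu"
  shows "inj_on (\<lambda>i. nu ! i + (length nu - 1 - i)) {..<length nu}"
  by (rule linorder_inj_onI) (use beta_strict[OF assms] in \<open>fastforce+\<close>)

lemma finite_beta [simp]: "finite (beta_set nu)"
  by (simp add: beta_set_def)

lemma card_beta: "sorted_wrt (\<ge>) nu \<Longrightarrow> card (beta_set nu) = length nu"
  unfolding beta_set_def by (simp only: card_image[OF beta_inj] card_lessThan)

lemma sz_beta:
  assumes "sorted_wrt (\<ge>) nu"
  shows "sz (beta_set nu) = sum_list nu"
proof -
  let ?L = "length nu"
  have "\<Sum>(beta_set nu) = (\<Sum>i<?L. nu ! i + (?L - 1 - i))"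
    unfolding beta_set_def by (subst sum.reindex[OF beta_inj[OF assms]]) simp
  also have "\<dots> = sum_list nu + (\<Sum>i<?L. ?L - Suc i)"
    unfolding sum.distrib by (simp add: sum_list_sum_nth lessThan_atLeast0)
  also have "(\<Sum>i<?L. ?L - Suc i) = \<Sum>{..<?L}" by (rule sum.nat_diff_reindex)
  finally show ?thesis unfolding sz_def card_beta[OF assms] by simp
qed

text \<open>\<open>hall_p_s\<close> lists the rows in decreasing order, while beta sets are
  enumerated increasingly. Reversing rows and columns together costs the square of a sign; the
  constant \<open>L - 1\<close>, added to both sequences, makes them nonnegative and does not change
  their differences.\<close>

lemma hall_p_s_jts:
  assumes "sorted_wrt (\<ge>) nu"
  shows "hall_p_s mu nu = jts mu (beta_set nu) {..<length nu}"
proof -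
  let ?L = "length nu"
  define l where "l i = int (nu ! i) - int i + (int ?L - 1)" for i
  define k where "k j = int ?L - 1 - int j" for j
  define u where "u i = (if i < ?L then ?L - 1 - i else i)" for i
  have u: "u permutes {..<?L}"
  proof (rule bij_imp_permutes)
    show "bij_betw u {..<?L} {..<?L}"
      by (rule bij_betw_byWitness[where f' = u]) (auto simp: u_def)
  qed (simp add: u_def)
  have "hall_p_s mu nu = jt mu ?L l k"
    unfolding hall_p_s_def jt_def l_def k_def by (simp add: algebra_simps)
  also have "\<dots> = jt mu ?L (\<lambda>i. l (u i)) (\<lambda>i. k (u i))"
    unfolding jt_permute[OF u u] by (simp add: sign_idempotent)
  also have "\<dots> = jt mu ?L (enum (beta_set nu)) (enum {..<?L})"
  proof (rule jt_cong)
    have im: "(\<lambda>i. l (u i)) ` {..<?L} = int ` beta_set nu"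
    proof -
      have "(\<lambda>i. l (u i)) ` {..<?L} = l ` u ` {..<?L}" by (simp add: image_image)
      also have "u ` {..<?L} = {..<?L}" by (rule permutes_image[OF u])
      also have "l ` {..<?L} = int ` beta_set nu"
        unfolding beta_set_def image_image by (rule image_cong[OF refl]) (auto simp: l_def of_nat_diff)
      finally show ?thesis .
    qed
    have mono: "l (u i) < l (u j)" if "i < j" "j < ?L" for i j
    proof -
      have "nu ! (?L - 1 - i) \<le> nu ! (?L - 1 - j)"
        using assms that by (intro sorted_wrt_nth_less[of "(\<ge>)", THEN order.trans[OF _ order.refl], of nu]) auto
      then show ?thesis using that by (simp add: l_def u_def of_nat_diff)
    qed
    show "l (u i) = enum (beta_set nu) i" if "i < ?L" for i
      using mono im that by (rule enum_unique)
    show "k (u i) = enum {..<?L} i" if "i < ?L" for i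
      using that by (simp add: k_def u_def enum_def en_lessThan of_nat_diff)
  qed
  finally show ?thesis by (simp add: jts_def card_beta[OF assms])
qed

lemma cells_finite: "finite (cells nu)"
proof (rule finite_subset)
  show "cells nu \<subseteq> (SIGMA i:{..<length nu}. {..<nu ! i})" by (auto simp: cells_def)
qed simp

lemma card_cells: "card (cells nu) = sum_list nu"
proof -
  have "cells nu = (SIGMA i:{..<length nu}. {..<nu ! i})" by (auto simp: cells_def)
  then show ?thesis by (simp add: sum_list_sum_nth lessThan_atLeast0)
qed

lemma num_syt_tableaux: "num_syt nu = card (tableaux (cells nu))"
  unfolding num_syt_def tableaux_def card_cells ..

lemma sorted_wrt_ge_nth: "sorted_wrt (\<ge>) nu \<Longrightarrow> i \<le> j \<Longrightarrow> j < length nu \<Longrightarrow> nu ! j \<le> (nu ! i :: nat)"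
  by (cases "i = j") (auto simp: sorted_wrt_iff_nth_less)

lemma down_closed_cells:
  assumes "sorted_wrt (\<ge>) nu"
  shows "down_closed (cells nu)"
  unfolding down_closed_def cells_def
  using sorted_wrt_ge_nth[OF assms, of i "i + 1" for i] by (auto intro: less_le_trans)

lemma num_syt_dm:
  assumes "sorted_wrt (\<ge>) nu"
  shows "int (num_syt nu) = dm (beta_set nu)"
  using assms
proof (induction "sum_list nu" arbitrary: nu rule: less_induct)
  case less
  note s = less.prems
  let ?L = "length nu" and ?X = "beta_set nu"
  let ?b = "\<lambda>i. nu ! i + (?L - 1 - i)"
  show ?case
  proof (cases "sum_list nu = 0")
    case True
    then have "card (cells nu) = 0" by (simp only: card_cells)
    then have "cells nu = {}" by (simp only: card_0_eq[OF cells_finite])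
    then have n1: "num_syt nu = 1" by (simp add: num_syt_tableaux card_tableaux_empty)
    have "dm ?X = jts [] ?X {..<card ?X}" using sz_beta[OF s] True by (simp add: dm_def)
    then have "dm ?X = (if ?X = {..<card ?X} then 1 else 0)" by (simp add: jts_Nil)
    then show ?thesis using dm_pos[of ?X] n1 by (auto split: if_splits)
  next
    case False
    \<comment> \<open>The rows that end in a corner.\<close>
    define K where "K = {i. i < ?L \<and> 0 < nu ! i \<and> (i + 1 < ?L \<longrightarrow> nu ! (i + 1) < nu ! i)}"
    define nu' where "nu' i = nu[i := nu ! i - 1]" for i
    have KL: "i < ?L" "0 < nu ! i" if "i \<in> K" for i using that by (auto simp: K_def)
    have s': "sorted_wrt (\<ge>) (nu' i)" if i: "i \<in> K" for i
      unfolding sorted_wrt_iff_nth_less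
    proof (intro allI impI)
      fix a b assume ab: "a < b" "b < length (nu' i)"
      then have bL: "b < ?L" by (simp add: nu'_def)
      have "nu ! b \<le> nu ! a" using sorted_wrt_ge_nth[OF s, of a b] ab bL by simp
      moreover have "nu ! b < nu ! a" if "a = i"
      proof -
        have "nu ! b \<le> nu ! (i + 1)" using sorted_wrt_ge_nth[OF s, of "i + 1" b] ab bL that by simp
        also have "\<dots> < nu ! i" using i ab bL that by (auto simp: K_def)
        finally show ?thesis using that by simp
      qed
      ultimately show "nu' i ! b \<le> nu' i ! a"
        using ab bL KL[OF i] by (auto simp: nu'_def nth_list_update)
    qed
    have sum': "sum_list (nu' i) < sum_list nu" if i: "i \<in> K" for i
      using KL[OF i] elem_le_sum_list[of i nu] by (simp add: nu'_def sum_list_update)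
    have cells': "cells nu - {(i, nu ! i - 1)} = cells (nu' i)" if i: "i \<in> K" for i
      using KL[OF i] by (auto simp: cells_def nu'_def nth_list_update split: if_splits)
    have max: "maxcells (cells nu) = (\<lambda>i. (i, nu ! i - 1)) ` K"
    proof (intro equalityI subsetI)
      fix c assume c: "c \<in> maxcells (cells nu)"
      obtain i j where ij: "c = (i, j)" by (cases c)
      have 1: "i < ?L" "j < nu ! i" "\<not> j + 1 < nu ! i" "i + 1 < ?L \<Longrightarrow> \<not> j < nu ! (i + 1)"
        using c unfolding ij by (auto simp: maxcells_def cells_def)
      then have "j = nu ! i - 1" "i \<in> K" by (auto simp: K_def)
      then show "c \<in> (\<lambda>i. (i, nu ! i - 1)) ` K" using ij by blast
    next
      fix c assume "c \<in> (\<lambda>i. (i, nu ! i - 1)) ` K"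
      then obtain i where "i \<in> K" "c = (i, nu ! i - 1)" by blast
      then show "c \<in> maxcells (cells nu)" by (auto simp: maxcells_def cells_def K_def)
    qed
    have b_pos: "0 < ?b i" if "i \<in> K" for i using KL[OF that] by simp
    have legal: "legal 1 ?X = ?b ` K"
    proof (intro equalityI subsetI)
      fix x assume x: "x \<in> legal 1 ?X"
      then obtain i where i: "i < ?L" "x = ?b i" and x1: "1 \<le> x" "x - 1 \<notin> ?X"
        by (auto simp: legal_def beta_set_def)
      have "0 < nu ! i \<and> (i + 1 < ?L \<longrightarrow> nu ! (i + 1) < nu ! i)"
      proof (cases "i + 1 < ?L")
        case True
        have "nu ! (i + 1) \<le> nu ! i" using sorted_wrt_ge_nth[OF s, of i "i + 1"] True by simp
        moreover have "nu ! (i + 1) \<noteq> nu ! i"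
        proof
          assume "nu ! (i + 1) = nu ! i"
          then have "x - 1 = ?b (i + 1)" using i True by simp
          then show False using x1(2) True by (auto simp: beta_set_def)
        qed
        ultimately show ?thesis by simp
      next
        case False
        then have "i = ?L - 1" using i by simp
        then show ?thesis using i x1(1) by simp
      qed
      then show "x \<in> ?b ` K" using i by (auto simp: K_def)
    next
      fix x assume "x \<in> ?b ` K"
      then obtain i where i: "i \<in> K" "x = ?b i" by blast
      have "x - 1 \<noteq> ?b j" if j: "j < ?L" for j
      proof (cases j i rule: linorder_cases)
        case less
        then show ?thesis using beta_strict[OF s, of j i] KL[OF i(1)] i(2) by simp
      next
        case equal
        show ?thesis unfolding equal using b_pos[OF i(1)] i(2) by linarith
      next
        case greater
        have "nu ! j \<le> nu ! (i + 1)" using sorted_wrt_ge_nth[OF s, of "i + 1" j] greater j by simp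
        moreover have "nu ! (i + 1) < nu ! i" using i(1) greater j by (auto simp: K_def)
        ultimately show ?thesis using i(2) greater j by linarith
      qed
      then have "x - 1 \<notin> ?X" by (auto simp: beta_set_def)
      moreover have "x \<in> ?X" "1 \<le> x" using i KL[OF i(1)] by (auto simp: beta_set_def)
      ultimately show "x \<in> legal 1 ?X" by (simp add: legal_def)
    qed
    have mv: "mv 1 (?b i) ?X = beta_set (nu' i)" if i: "i \<in> K" for i
    proof -
      have len: "length (nu' i) = ?L" by (simp add: nu'_def)
      have eq: "nu' i ! j + (?L - 1 - j) = (if j = i then ?b i - 1 else ?b j)" if "j < ?L" for j
        using that KL[OF i] by (simp add: nu'_def nth_list_update)
      have "beta_set (nu' i) = (\<lambda>j. if j = i then ?b i - 1 else ?b j) ` {..<?L}"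
        unfolding beta_set_def len by (rule image_cong[OF refl]) (use eq in simp)
      also have "\<dots> = insert (?b i - 1) (?b ` ({..<?L} - {i}))"
        using KL[OF i] by (auto simp: image_iff)
      also have "?b ` ({..<?L} - {i}) = ?X - {?b i}"
        using inj_on_image_set_diff[OF beta_inj[OF s], of "{..<?L}" "{i}"] KL[OF i] by (simp add: beta_set_def)
      finally show ?thesis by (simp add: mv_def)
    qed
    have injK: "inj_on ?b K" by (rule inj_on_subset[OF beta_inj[OF s]]) (auto simp: K_def)
    have "cells nu \<noteq> {}" using card_cells[of nu] False by auto
    then have "int (num_syt nu) = (\<Sum>c\<in>maxcells (cells nu). int (card (tableaux (cells nu - {c}))))"
      unfolding num_syt_tableaux by (subst card_tableaux_rec[OF cells_finite down_closed_cells[OF s]]) simp_all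
    also have "\<dots> = (\<Sum>i\<in>K. int (num_syt (nu' i)))"
      unfolding max using cells' by (subst sum.reindex) (auto simp: inj_on_def num_syt_tableaux)
    also have "\<dots> = (\<Sum>i\<in>K. dm (mv 1 (?b i) ?X))"
      using less.hyps[OF sum' s'] mv by simp
    also have "\<dots> = (\<Sum>x\<in>legal 1 ?X. dm (mv 1 x ?X))"
      unfolding legal by (subst sum.reindex[OF injK]) simp
    also have "\<dots> = dm ?X"
    proof -
      have "sz (mv 1 x ?X) = sum_list nu - 1" if x: "x \<in> legal 1 ?X" for x
      proof -
        obtain i where i: "i \<in> K" "x = ?b i" using x unfolding legal by blast
        have "sz (mv 1 x ?X) = sum_list (nu' i)" using mv[OF i(1)] i(2) sz_beta[OF s'[OF i(1)]] by simp
        then show ?thesis using KL[OF i(1)] elem_le_sum_list[of i nu] by (simp add: nu'_def sum_list_update)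
      qed
      then have "(\<Sum>x\<in>legal 1 ?X. dm (mv 1 x ?X)) = (\<Sum>x\<in>legal 1 ?X. jts (replicate (sum_list nu - 1) 1) (mv 1 x ?X) {..<card ?X})"
        using card_mv[OF finite_beta] by (intro sum.cong) (auto simp: dm_def)
      also have "\<dots> = jts (1 # replicate (sum_list nu - 1) 1) ?X {..<card ?X}"
        by (rule jts_Cons_1[symmetric]) simp_all
      also have "1 # replicate (sum_list nu - 1) 1 = replicate (sz ?X) (1::nat)"
        using False sz_beta[OF s] by (cases "sum_list nu") simp_all
      finally show ?thesis by (simp add: dm_def)
    qed
    finally show ?thesis .
  qed
qed

section \<open>Cycle types and centralizers\<close>

lemma perms_finite: "finite (perms n)"
  unfolding perms_def by (simp add: finite_permutations)

lemma perms_card: "card (perms n) = fact n"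
  unfolding perms_def by (simp add: card_permutations)

lemma funpow_id_exists:
  assumes "p \<in> perms n"
  shows "\<exists>N>0. p ^^ N = id"
proof -
  have "permutation p"
    using assms by (auto simp: perms_def intro: permutes_imp_permutation[of "{..<n}"])
  then show ?thesis using permutation_is_nilpotent by metis
qed

lemma perms_outside: "p \<in> perms n \<Longrightarrow> \<not> y < n \<Longrightarrow> p y = y"
  unfolding perms_def by (auto intro: permutes_not_in)

lemma cyc_self: "x \<in> cyc p x"
  unfolding cyc_def by (rule CollectI, rule exI[of _ 0]) simp

lemma cyc_funpow: "(p ^^ k) x \<in> cyc p x"
  unfolding cyc_def by blast

text \<open>Injectivity makes the forward orbit purely periodic; with the least period
  \<open>d\<close>, exponents matter only modulo \<open>d\<close>.\<close>

lemma cyc_period: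
  assumes "p \<in> perms n"
  shows "\<exists>d>0. card (cyc p x) = d \<and> cyc p x = (\<lambda>k. (p ^^ k) x) ` {..<d} \<and>
    (\<forall>i j. (p ^^ i) x = (p ^^ j) x \<longleftrightarrow> i mod d = j mod d)"
proof -
  obtain N where N: "0 < N" "p ^^ N = id" using funpow_id_exists[OF assms] by blast
  define d where "d = (LEAST d. 0 < d \<and> (p ^^ d) x = x)"
  have ex: "0 < N \<and> (p ^^ N) x = x" using N by simp
  have d: "0 < d" "(p ^^ d) x = x" using LeastI[of "\<lambda>d. 0 < d \<and> (p ^^ d) x = x", OF ex] by (auto simp: d_def)
  have least: "d \<le> e" if "0 < e" "(p ^^ e) x = x" for e
    unfolding d_def by (rule Least_le) (use that in simp)
  have inj: "inj (p ^^ k)" for k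
    using assms permutes_inj[of p "{..<n}"] by (simp add: perms_def inj_fn)
  have mult: "(p ^^ (d * q)) x = x" for q
    by (induction q) (simp_all add: funpow_add d(2) o_def)
  have md: "(p ^^ i) x = (p ^^ (i mod d)) x" for i
  proof -
    have "(p ^^ i) x = (p ^^ (i mod d + d * (i div d))) x" by simp
    also have "\<dots> = (p ^^ (i mod d)) ((p ^^ (d * (i div d))) x)"
      by (simp only: funpow_add o_apply)
    finally show ?thesis using mult by simp
  qed
  have aux: False if "i < j" "j < d" "(p ^^ i) x = (p ^^ j) x" for i j
  proof -
    have "(p ^^ j) x = (p ^^ i) ((p ^^ (j - i)) x)"
      using that(1) funpow_add[of i "j - i" p] by simp
    then have "(p ^^ (j - i)) x = x" using that(3) inj[of i] by (metis injD)
    then show False using least[of "j - i"] that by simp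
  qed
  have inj': "(p ^^ i) x = (p ^^ j) x \<longleftrightarrow> i mod d = j mod d" for i j
  proof
    assume "(p ^^ i) x = (p ^^ j) x"
    then have e: "(p ^^ (i mod d)) x = (p ^^ (j mod d)) x" using md by metis
    have "i mod d < d" "j mod d < d" using d(1) by auto
    then show "i mod d = j mod d" using aux e by (metis linorder_neqE_nat)
  qed (metis md)
  have im: "cyc p x = (\<lambda>k. (p ^^ k) x) ` {..<d}"
  proof
    show "cyc p x \<subseteq> (\<lambda>k. (p ^^ k) x) ` {..<d}"
    proof
      fix y assume "y \<in> cyc p x"
      then obtain k where "y = (p ^^ k) x" by (auto simp: cyc_def)
      then have "y = (p ^^ (k mod d)) x" using md by simp
      then show "y \<in> (\<lambda>k. (p ^^ k) x) ` {..<d}" using d(1) by auto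
    qed
  qed (auto simp: cyc_def)
  have "inj_on (\<lambda>k. (p ^^ k) x) {..<d}" by (auto simp: inj_on_def inj')
  then have "card (cyc p x) = d" unfolding im by (simp add: card_image)
  then show ?thesis using d(1) im inj' by blast
qed

lemma cyc_finite: "p \<in> perms n \<Longrightarrow> finite (cyc p x)"
  using cyc_period[of p n x] by (metis finite_imageI finite_lessThan)

lemma cyc_card_pos: "p \<in> perms n \<Longrightarrow> 0 < card (cyc p x)"
  using cyc_period[of p n x] by metis

lemma funpow_eq_iff:
  "p \<in> perms n \<Longrightarrow> (p ^^ i) x = (p ^^ j) x \<longleftrightarrow> i mod card (cyc p x) = j mod card (cyc p x)"
  using cyc_period[of p n x] by metis

lemma funpow_in_range:
  assumes "p \<in> perms n" "x < n"
  shows "(p ^^ k) x < n"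
  using assms permutes_in_image[of p "{..<n}"] by (induction k) (auto simp: perms_def)

lemma cyc_subset: "p \<in> perms n \<Longrightarrow> x < n \<Longrightarrow> cyc p x \<subseteq> {..<n}"
  using funpow_in_range by (auto simp: cyc_def)

text \<open>Forward orbits coincide because the inverse of \<open>p ^^ k\<close> is itself a power,
  \<open>p ^^ (N * k - k)\<close> with \<open>p ^^ N = id\<close>.\<close>

lemma cyc_eq:
  assumes "p \<in> perms n" "y \<in> cyc p x"
  shows "cyc p y = cyc p x"
proof -
  obtain N where N: "0 < N" "p ^^ N = id" using funpow_id_exists[OF assms(1)] by blast
  obtain k where k: "y = (p ^^ k) x" using assms(2) by (auto simp: cyc_def)
  have "p ^^ (N * k) = id" by (metis N(2) funpow_mult id_funpow)
  moreover have "(p ^^ (N * k - k)) y = (p ^^ (N * k)) x"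
  proof -
    have "N * k - k + k = N * k" using N(1) by (cases N) auto
    then show ?thesis unfolding k using funpow_add[of "N * k - k" k p] by simp
  qed
  ultimately have x: "x = (p ^^ (N * k - k)) y" by simp
  have sub: "cyc p ((p ^^ j) z) \<subseteq> cyc p z" for j z
  proof
    fix y assume "y \<in> cyc p ((p ^^ j) z)"
    then obtain i where "y = (p ^^ i) ((p ^^ j) z)" unfolding cyc_def by blast
    then have "y = (p ^^ (i + j)) z" by (simp only: funpow_add o_apply)
    then show "y \<in> cyc p z" using cyc_funpow by simp
  qed
  have "cyc p y \<subseteq> cyc p x" using sub[of k x] unfolding k[symmetric] .
  moreover have "cyc p x \<subseteq> cyc p y" using sub[of "N * k - k" y] unfolding x[symmetric] .
  ultimately show ?thesis by (rule equalityI)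
qed

lemma cycle_bases_finite: "finite (cycle_bases n p)"
  unfolding cycle_bases_def by simp

lemma cycle_base:
  assumes "p \<in> perms n" "x < n"
  shows "Min (cyc p x) \<in> cycle_bases n p" "cyc p (Min (cyc p x)) = cyc p x"
    "\<exists>k. (p ^^ k) (Min (cyc p x)) = x"
proof -
  have m: "Min (cyc p x) \<in> cyc p x"
    using cyc_finite[OF assms(1)] cyc_self by (intro Min_in) auto
  then show e: "cyc p (Min (cyc p x)) = cyc p x" by (rule cyc_eq[OF assms(1)])
  show "Min (cyc p x) \<in> cycle_bases n p"
    using m cyc_subset[OF assms] e by (auto simp: cycle_bases_def)
  have "x \<in> cyc p (Min (cyc p x))" using e cyc_self by simp
  then show "\<exists>k. (p ^^ k) (Min (cyc p x)) = x" unfolding cyc_def[of p "Min (cyc p x)"] mem_Collect_eq by metis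
qed

lemma cycle_bases_inj: "inj_on (cyc p) (cycle_bases n p)"
  by (rule inj_onI) (auto simp: cycle_bases_def dest: arg_cong[where f = Min])

lemma cycle_bases_image:
  assumes p: "p \<in> perms n"
  shows "cyc p ` cycle_bases n p = cyc p ` {..<n}"
proof
  show "cyc p ` cycle_bases n p \<subseteq> cyc p ` {..<n}"
    by (rule image_mono) (auto simp: cycle_bases_def)
  show "cyc p ` {..<n} \<subseteq> cyc p ` cycle_bases n p"
  proof (rule image_subsetI)
    fix x assume "x \<in> {..<n}"
    then have x: "x < n" by simp
    show "cyc p x \<in> cyc p ` cycle_bases n p"
      using imageI[OF cycle_base(1)[OF p x], of "cyc p"] unfolding cycle_base(2)[OF p x] .
  qed
qed

lemma count_cycle_type:
  "count (cycle_type n p) i = card {b \<in> cycle_bases n p. card (cyc p b) = i}"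
proof -
  have "count (cycle_type n p) i = (\<Sum>b | b \<in> cycle_bases n p \<and> i = card (cyc p b). count (mset_set (cycle_bases n p)) b)"
    unfolding cycle_type_def count_image_mset' using cycle_bases_finite by simp
  also have "\<dots> = (\<Sum>b | b \<in> cycle_bases n p \<and> card (cyc p b) = i. 1)"
    using cycle_bases_finite by (intro sum.cong) auto
  finally show ?thesis by simp
qed

text \<open>A description without base points, since conjugation need not map the minimum of a cycle
  to the minimum of its image.\<close>

lemma count_cycle_type':
  assumes "p \<in> perms n"
  shows "count (cycle_type n p) i = card {K \<in> cyc p ` {..<n}. card K = i}"
proof -
  have "{K \<in> cyc p ` {..<n}. card K = i} = cyc p ` {b \<in> cycle_bases n p. card (cyc p b) = i}"
    unfolding cycle_bases_image[OF assms, symmetric] by auto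
  moreover have "inj_on (cyc p) {b \<in> cycle_bases n p. card (cyc p b) = i}"
    by (rule inj_on_subset[OF cycle_bases_inj]) auto
  ultimately show ?thesis by (simp add: count_cycle_type card_image)
qed

section \<open>Counting conjugating permutations\<close>

text \<open>For \<open>c = c'\<close> this is the centralizer, and for varying \<open>c'\<close>
  these sets partition \<open>perms n\<close>. One count thus yields both centralizer orders and
  class sizes.\<close>

definition intertwiners :: "nat \<Rightarrow> (nat \<Rightarrow> nat) \<Rightarrow> (nat \<Rightarrow> nat) \<Rightarrow> (nat \<Rightarrow> nat) set" where
  "intertwiners n c c' = {x \<in> perms n. x \<circ> c = c' \<circ> x}"

lemma intertwiner_funpow:
  assumes "x \<circ> c = c' \<circ> x"
  shows "x ((c ^^ k) y) = (c' ^^ k) (x y)"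
  by (induction k) (use fun_cong[OF assms] in \<open>auto simp: o_def\<close>)

lemma intertwiner_cyc:
  assumes "x \<circ> c = c' \<circ> x"
  shows "cyc c' (x y) = x ` cyc c y"
  unfolding cyc_def using intertwiner_funpow[OF assms] by (auto simp: image_iff) metis

lemma cycle_type_intertwiner:
  assumes "c \<in> perms n" "c' \<in> perms n" "x \<in> intertwiners n c c'"
  shows "cycle_type n c = cycle_type n c'"
proof (rule multiset_eqI)
  fix i
  have x: "x permutes {..<n}" "x \<circ> c = c' \<circ> x" using assms(3) by (auto simp: intertwiners_def perms_def)
  have inj: "inj x" using permutes_inj[OF x(1)] .
  have cd: "card (x ` K) = card K" for K using inj by (simp add: card_image inj_on_subset)
  have "cyc c' ` {..<n} = cyc c' ` x ` {..<n}" using permutes_image[OF x(1)] by simp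
  also have "\<dots> = (`) x ` cyc c ` {..<n}" by (simp add: image_image intertwiner_cyc[OF x(2)])
  finally have "{K \<in> cyc c' ` {..<n}. card K = i} = (`) x ` {K \<in> cyc c ` {..<n}. card K = i}"
    using cd by auto
  moreover have "inj_on ((`) x) {K \<in> cyc c ` {..<n}. card K = i}"
    using inj by (simp add: inj_on_def inj_image_eq_iff)
  ultimately show "count (cycle_type n c) i = count (cycle_type n c') i"
    by (simp add: count_cycle_type' assms(1,2) card_image)
qed

text \<open>An intertwiner is determined by the images of the cycle base points, which must lie on
  distinct cycles of the same lengths.\<close>
definition base_maps :: "nat \<Rightarrow> (nat \<Rightarrow> nat) \<Rightarrow> nat set \<Rightarrow> (nat \<Rightarrow> nat) \<Rightarrow> (nat \<Rightarrow> nat) set" where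
  "base_maps n c' A len = {g \<in> A \<rightarrow>\<^sub>E {..<n}. inj_on (\<lambda>b. cyc c' (g b)) A \<and> (\<forall>b\<in>A. card (cyc c' (g b)) = len b)}"

lemma bij_intertwiners_base_maps:
  assumes c: "c \<in> perms n" and c': "c' \<in> perms n"
  shows "bij_betw (\<lambda>x. restrict x (cycle_bases n c)) (intertwiners n c c')
    (base_maps n c' (cycle_bases n c) (\<lambda>b. card (cyc c b)))"
  unfolding bij_betw_def
proof
  let ?B = "cycle_bases n c"
  have Bn: "b < n" if "b \<in> ?B" for b using that by (simp add: cycle_bases_def)
  show "inj_on (\<lambda>x. restrict x ?B) (intertwiners n c c')"
  proof (rule inj_onI)
    fix x x' assume x: "x \<in> intertwiners n c c'" and x': "x' \<in> intertwiners n c c'"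
      and e: "restrict x ?B = restrict x' ?B"
    show "x = x'"
    proof
      fix y
      show "x y = x' y"
      proof (cases "y < n")
        case True
        obtain k where k: "(c ^^ k) (Min (cyc c y)) = y" using cycle_base(3)[OF c True] by blast
        have "x (Min (cyc c y)) = x' (Min (cyc c y))"
          using fun_cong[OF e, of "Min (cyc c y)"] cycle_base(1)[OF c True] by simp
        then have "x ((c ^^ k) (Min (cyc c y))) = x' ((c ^^ k) (Min (cyc c y)))"
          using x x' intertwiner_funpow[of x c c'] intertwiner_funpow[of x' c c'] by (simp add: intertwiners_def)
        then show ?thesis unfolding k .
      next
        case False
        then have "x y = y" "x' y = y"
          using perms_outside[of x n y] perms_outside[of x' n y] x x' by (simp_all add: intertwiners_def)
        then show ?thesis by simp
      qed
    qed
  qed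
  show "(\<lambda>x. restrict x ?B) ` intertwiners n c c' = base_maps n c' ?B (\<lambda>b. card (cyc c b))"
  proof (intro equalityI subsetI)
    fix g assume "g \<in> (\<lambda>x. restrict x ?B) ` intertwiners n c c'"
    then obtain x where g: "g = restrict x ?B" and xp: "x permutes {..<n}" and xc: "x \<circ> c = c' \<circ> x"
      by (auto simp: intertwiners_def perms_def)
    have inj: "inj x" by (rule permutes_inj[OF xp])
    have "inj_on (\<lambda>b. cyc c' (x b)) ?B"
      unfolding intertwiner_cyc[OF xc] using cycle_bases_inj[of c n] inj
      by (simp add: inj_on_def inj_image_eq_iff)
    then have "inj_on (\<lambda>b. cyc c' (restrict x ?B b)) ?B"
      by (rule inj_on_cong[THEN iffD1, rotated]) simp
    moreover have "card (cyc c' (restrict x ?B b)) = card (cyc c b)" if "b \<in> ?B" for b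
      using that inj by (simp add: intertwiner_cyc[OF xc] card_image inj_on_subset)
    moreover have "restrict x ?B \<in> ?B \<rightarrow>\<^sub>E {..<n}"
      using permutes_in_image[OF xp] Bn by auto
    ultimately show "g \<in> base_maps n c' ?B (\<lambda>b. card (cyc c b))"
      unfolding base_maps_def g by blast
  next
    fix g assume g: "g \<in> base_maps n c' ?B (\<lambda>b. card (cyc c b))"
    have gn: "g b < n" and glen: "card (cyc c' (g b)) = card (cyc c b)" if "b \<in> ?B" for b
      using g that by (auto simp: base_maps_def)
    have ginj: "inj_on (\<lambda>b. cyc c' (g b)) ?B" using g by (simp add: base_maps_def)
    define bs where "bs y = Min (cyc c y)" for y
    \<comment> \<open>Every \<open>y\<close> is reached from its base point by some power of
      \<open>c\<close>. Since \<open>g\<close> preserves cycle lengths, the extension of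
      \<open>g\<close> does not depend on which exponent is chosen; this is fact \<open>x\<close>
      below.\<close>
    define kk where "kk y = (SOME k. (c ^^ k) (bs y) = y)" for y
    define x where "x y = (if y < n then (c' ^^ kk y) (g (bs y)) else y)" for y
    have kk: "(c ^^ kk y) (bs y) = y" if "y < n" for y
      unfolding kk_def bs_def using cycle_base(3)[OF c that] by (rule someI_ex)
    have bsB: "bs y \<in> ?B" if "y < n" for y using cycle_base(1)[OF c that] by (simp add: bs_def)
    have x: "x ((c ^^ k) b) = (c' ^^ k) (g b)" if b: "b \<in> ?B" for k b
    proof -
      let ?y = "(c ^^ k) b"
      have y: "?y < n" using funpow_in_range[OF c Bn[OF b]] .
      have "cyc c ?y = cyc c b" by (rule cyc_eq[OF c cyc_funpow])
      then have bb: "bs ?y = b" using b by (simp add: bs_def cycle_bases_def)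
      then have "(c ^^ kk ?y) b = (c ^^ k) b" using kk[OF y] by simp
      then have "(c' ^^ kk ?y) (g b) = (c' ^^ k) (g b)"
        unfolding funpow_eq_iff[OF c] funpow_eq_iff[OF c'] glen[OF b] .
      then show ?thesis using y bb by (simp add: x_def)
    qed
    have rep: "\<exists>k b. b \<in> ?B \<and> y = (c ^^ k) b" if "y < n" for y
      using kk[OF that] bsB[OF that] by metis
    have "inj_on x {..<n}"
    proof (rule inj_onI)
      fix y y' assume "y \<in> {..<n}" "y' \<in> {..<n}" and e: "x y = x y'"
      then obtain k b k' b' where b: "b \<in> ?B" "y = (c ^^ k) b" "b' \<in> ?B" "y' = (c ^^ k') b'"
        using rep by (metis lessThan_iff)
      have e': "(c' ^^ k) (g b) = (c' ^^ k') (g b')" using e b x by simp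
      then have "cyc c' (g b) = cyc c' (g b')"
        using cyc_eq[OF c' cyc_funpow] by metis
      then have bb: "b = b'" using ginj b by (auto simp: inj_on_def)
      then have "(c ^^ k) b = (c ^^ k') b"
        using e' glen[OF b(1)] unfolding funpow_eq_iff[OF c] by (simp add: funpow_eq_iff[OF c'])
      then show "y = y'" using b bb by simp
    qed
    moreover have sub: "x ` {..<n} \<subseteq> {..<n}"
      using funpow_in_range[OF c'] gn bsB by (auto simp: x_def)
    ultimately have "bij_betw x {..<n} {..<n}"
      by (simp add: bij_betw_def endo_inj_surj)
    then have xp: "x permutes {..<n}" by (rule bij_imp_permutes) (simp add: x_def)
    have "x \<circ> c = c' \<circ> x"
    proof
      fix y
      show "(x \<circ> c) y = (c' \<circ> x) y"
      proof (cases "y < n")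
        case True
        then obtain k b where b: "b \<in> ?B" "y = (c ^^ k) b" using rep by blast
        then have "c y = (c ^^ Suc k) b" by simp
        then show ?thesis using x[OF b(1), of "Suc k"] x[OF b(1), of k] b(2) by simp
      next
        case False
        then have "c y = y" "c' y = y" using perms_outside[OF c] perms_outside[OF c'] by simp_all
        then show ?thesis using False by (simp add: x_def)
      qed
    qed
    then have "x \<in> intertwiners n c c'" using xp by (simp add: intertwiners_def perms_def)
    moreover have "restrict x ?B = g"
    proof
      fix b
      show "restrict x ?B b = g b"
      proof (cases "b \<in> ?B")
        case True
        then show ?thesis using x[OF True, of 0] by simp
      next
        case False
        then show ?thesis using g PiE_arb[of g ?B "\<lambda>_. {..<n}" b] by (simp add: base_maps_def)
      qed
    qed
    ultimately show "g \<in> (\<lambda>x. restrict x ?B) ` intertwiners n c c'" by blast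
  qed
qed

lemma base_maps_finite: "finite A \<Longrightarrow> finite (base_maps n c' A len)"
  unfolding base_maps_def by (rule finite_subset[OF _ finite_PiE[of A "\<lambda>_. {..<n}"]]) auto

lemma card_base_maps:
  assumes c': "c' \<in> perms n" and A: "finite A" and I: "finite I" "len ` A \<subseteq> I"
  shows "card (base_maps n c' A len) =
    (\<Prod>b\<in>A. len b) * (\<Prod>i\<in>I. \<Prod>t<card {b \<in> A. len b = i}. count (cycle_type n c') i - t)"
  using A I(2)
proof (induction A rule: finite_induct)
  case empty
  have "base_maps n c' {} len = {\<lambda>x. undefined}" by (auto simp: base_maps_def)
  then show ?case by simp
next
  case (insert b A)
  let ?m = "\<lambda>A i. card {b \<in> A. len b = i}" and ?ct = "\<lambda>i. count (cycle_type n c') i"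
  let ?i = "len b"
  have Ab: "A - {b} = A" using insert.hyps(2) by blast
  define E where "E g = {y \<in> {..<n}. card (cyc c' y) = ?i \<and> cyc c' y \<notin> (\<lambda>a. cyc c' (g a)) ` A}" for g
  have bij: "bij_betw (\<lambda>(g, y). g(b := y)) (SIGMA g:base_maps n c' A len. E g) (base_maps n c' (insert b A) len)"
  proof (rule bij_betw_byWitness[where f' = "\<lambda>h. (restrict h A, h b)"])
    show "\<forall>a\<in>(SIGMA g:base_maps n c' A len. E g). (\<lambda>h. (restrict h A, h b)) (case a of (g, y) \<Rightarrow> g(b := y)) = a"
    proof
      fix a assume "a \<in> (SIGMA g:base_maps n c' A len. E g)"
      then obtain g y where a: "a = (g, y)" "g \<in> base_maps n c' A len" by blast
      have "restrict (g(b := y)) A = restrict g A"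
        using insert.hyps(2) by (intro restrict_ext) auto
      also have "\<dots> = g" using a(2) PiE_restrict[of g A "\<lambda>_. {..<n}"] by (simp add: base_maps_def)
      finally have "restrict (g(b := y)) A = g" .
      then show "(\<lambda>h. (restrict h A, h b)) (case a of (g, y) \<Rightarrow> g(b := y)) = a" using a(1) by simp
    qed
    show "\<forall>h\<in>base_maps n c' (insert b A) len. (\<lambda>(g, y). g(b := y)) (restrict h A, h b) = h"
    proof
      fix h assume h: "h \<in> base_maps n c' (insert b A) len"
      have "(restrict h A)(b := h b) = restrict h (insert b A)"
      proof
        fix a
        show "((restrict h A)(b := h b)) a = restrict h (insert b A) a"
          by (cases "a = b"; cases "a \<in> A") simp_all
      qed
      also have "\<dots> = h" using h PiE_restrict[of h "insert b A" "\<lambda>_. {..<n}"] by (simp add: base_maps_def)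
      finally show "(\<lambda>(g, y). g(b := y)) (restrict h A, h b) = h" by simp
    qed
    show "(\<lambda>(g, y). g(b := y)) ` (SIGMA g:base_maps n c' A len. E g) \<subseteq> base_maps n c' (insert b A) len"
    proof (rule image_subsetI)
      fix a assume "a \<in> (SIGMA g:base_maps n c' A len. E g)"
      then obtain g y where a: "a = (g, y)" "g \<in> base_maps n c' A len" "y \<in> E g" by blast
      have g: "g \<in> A \<rightarrow>\<^sub>E {..<n}" "inj_on (\<lambda>a. cyc c' (g a)) A" "\<And>a. a \<in> A \<Longrightarrow> card (cyc c' (g a)) = len a"
        using a(2) by (simp_all add: base_maps_def)
      have y: "y \<in> {..<n}" "card (cyc c' y) = ?i" "cyc c' y \<notin> (\<lambda>a. cyc c' (g a)) ` A"
        using a(3) by (simp_all add: E_def)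
      have eq: "(g(b := y)) a = g a" if "a \<in> A" for a using that insert.hyps(2) by auto
      have "g(b := y) \<in> insert b A \<rightarrow>\<^sub>E {..<n}" using y(1) g(1) by (rule PiE_fun_upd)
      moreover have "inj_on (\<lambda>a. cyc c' ((g(b := y)) a)) (insert b A)"
      proof -
        have "inj_on (\<lambda>a. cyc c' ((g(b := y)) a)) A = inj_on (\<lambda>a. cyc c' (g a)) A"
          by (rule inj_on_cong) (simp only: eq)
        moreover have "(\<lambda>a. cyc c' ((g(b := y)) a)) ` A = (\<lambda>a. cyc c' (g a)) ` A"
          by (rule image_cong[OF refl]) (simp only: eq)
        ultimately show ?thesis
          unfolding inj_on_insert Ab using g(2) y(3) by simp
      qed
      moreover have "\<forall>a\<in>insert b A. card (cyc c' ((g(b := y)) a)) = len a"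
      proof
        fix a assume "a \<in> insert b A"
        then show "card (cyc c' ((g(b := y)) a)) = len a"
          using y(2) g(3) eq[of a] by (cases "a = b") simp_all
      qed
      ultimately show "(case a of (g, y) \<Rightarrow> g(b := y)) \<in> base_maps n c' (insert b A) len"
        unfolding a(1) base_maps_def by simp
    qed
    show "(\<lambda>h. (restrict h A, h b)) ` base_maps n c' (insert b A) len \<subseteq> (SIGMA g:base_maps n c' A len. E g)"
    proof (rule image_subsetI)
      fix h assume h: "h \<in> base_maps n c' (insert b A) len"
      note hh = h[unfolded base_maps_def mem_Collect_eq]
      have h': "h \<in> insert b A \<rightarrow>\<^sub>E {..<n}" "card (cyc c' (h a)) = len a" if "a \<in> insert b A" for a
        using conjunct1[OF hh] bspec[OF conjunct2[OF conjunct2[OF hh]] that] .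
      note ii = conjunct1[OF conjunct2[OF hh], unfolded inj_on_insert Ab]
      have i: "inj_on (\<lambda>a. cyc c' (h a)) A" "cyc c' (h b) \<notin> (\<lambda>a. cyc c' (h a)) ` A"
        using conjunct1[OF ii] conjunct2[OF ii] .
      have hn: "h a \<in> {..<n}" if "a \<in> insert b A" for a using h'(1)[OF that] that by (rule PiE_mem)
      have "inj_on (\<lambda>a. cyc c' (restrict h A a)) A = inj_on (\<lambda>a. cyc c' (h a)) A"
        by (rule inj_on_cong) simp
      moreover have "restrict h A \<in> A \<rightarrow>\<^sub>E {..<n}" using hn by auto
      ultimately have "restrict h A \<in> base_maps n c' A len"
        unfolding base_maps_def mem_Collect_eq using i(1) h'(2) by simp
      moreover have "(\<lambda>a. cyc c' (restrict h A a)) ` A = (\<lambda>a. cyc c' (h a)) ` A"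
        by (rule image_cong[OF refl]) simp
      then have "h b \<in> E (restrict h A)" using i(2) h'(2)[of b] hn[of b] by (simp add: E_def)
      ultimately show "(restrict h A, h b) \<in> (SIGMA g:base_maps n c' A len. E g)" by simp
    qed
  qed
  have cardE: "card (E g) = ?i * (?ct ?i - ?m A ?i)" if g: "g \<in> base_maps n c' A len" for g
  proof -
    let ?K = "{K \<in> cyc c' ` {..<n}. card K = ?i}"
    let ?G = "(\<lambda>a. cyc c' (g a)) ` {a \<in> A. len a = ?i}"
    have g1: "g \<in> A \<rightarrow>\<^sub>E {..<n}" "inj_on (\<lambda>a. cyc c' (g a)) A" "\<And>a. a \<in> A \<Longrightarrow> card (cyc c' (g a)) = len a"
      using g by (simp_all add: base_maps_def)
    \<comment> \<open>\<open>E g\<close> consists of whole cycles, those of length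
      \<open>len b\<close> not yet used by \<open>g\<close>.\<close>
    have EU: "E g = \<Union>(?K - ?G)"
    proof (intro equalityI subsetI)
      fix y assume y: "y \<in> E g"
      then have "cyc c' y \<in> ?K - ?G" by (auto simp: E_def)
      then show "y \<in> \<Union>(?K - ?G)" using cyc_self by blast
    next
      fix y assume "y \<in> \<Union>(?K - ?G)"
      then obtain z where z: "z < n" "y \<in> cyc c' z" "card (cyc c' z) = ?i" "cyc c' z \<notin> ?G" by auto
      have e: "cyc c' y = cyc c' z" by (rule cyc_eq[OF c' z(2)])
      moreover have "y < n" using cyc_subset[OF c' z(1)] z(2) by auto
      moreover have "cyc c' z \<notin> (\<lambda>a. cyc c' (g a)) ` A"
        using z(3,4) g1(3) by (auto simp: image_iff)
      ultimately show "y \<in> E g" using z(3) by (simp add: E_def)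
    qed
    have "card (E g) = ?i * card (?K - ?G)"
      unfolding EU
    proof (rule card_partition[symmetric])
      show "finite (?K - ?G)" by simp
      then show "finite (\<Union>(?K - ?G))" using cyc_finite[OF c'] by auto
      show "card c = ?i" if "c \<in> ?K - ?G" for c using that by simp
      show "c1 \<inter> c2 = {}" if "c1 \<in> ?K - ?G" "c2 \<in> ?K - ?G" "c1 \<noteq> c2" for c1 c2
      proof (rule ccontr)
        assume "c1 \<inter> c2 \<noteq> {}"
        then obtain z where z: "z \<in> c1" "z \<in> c2" by blast
        from that(1,2) obtain u v where "c1 = cyc c' u" "c2 = cyc c' v" by blast
        then have "c1 = c2" using cyc_eq[OF c', of z u] cyc_eq[OF c', of z v] z by simp
        then show False using that(3) by simp
      qed
    qed
    also have "card (?K - ?G) = card ?K - card ?G"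
    proof (rule card_Diff_subset)
      show "?G \<subseteq> ?K"
      proof (rule image_subsetI)
        fix a assume "a \<in> {a \<in> A. len a = ?i}"
        then have a: "a \<in> A" "len a = ?i" by blast+
        have "g a \<in> {..<n}" by (rule PiE_mem[OF g1(1) a(1)])
        moreover have "card (cyc c' (g a)) = ?i" using g1(3)[OF a(1)] a(2) by (rule trans)
        ultimately show "cyc c' (g a) \<in> ?K" by blast
      qed
      show "finite ?G" using insert.hyps(1) by simp
    qed
    also have "card ?G = ?m A ?i"
    proof (rule card_image, rule inj_on_subset)
      show "inj_on (\<lambda>a. cyc c' (g a)) A" by (rule g1(2))
    qed blast
    also have "card ?K = ?ct ?i" by (rule count_cycle_type'[OF c', symmetric])
    finally show ?thesis .
  qed
  have finE: "finite (E g)" for g by (simp add: E_def)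
  have "card (base_maps n c' (insert b A) len) = card (SIGMA g:base_maps n c' A len. E g)"
    by (rule bij_betw_same_card[OF bij, symmetric])
  also have "\<dots> = (\<Sum>g\<in>base_maps n c' A len. card (E g))"
    by (rule card_SigmaI) (simp_all add: base_maps_finite insert.hyps(1) finE)
  also have "\<dots> = (\<Sum>g\<in>base_maps n c' A len. ?i * (?ct ?i - ?m A ?i))"
    by (rule sum.cong[OF refl cardE])
  also have "\<dots> = card (base_maps n c' A len) * (?i * (?ct ?i - ?m A ?i))"
    by (simp only: sum_constant of_nat_id)
  also have "card (base_maps n c' A len) = (\<Prod>b\<in>A. len b) * (\<Prod>i\<in>I. \<Prod>t<?m A i. ?ct i - t)"
    by (rule insert.IH) (use insert.prems in blast)
  also have "(\<Prod>b\<in>A. len b) * (\<Prod>i\<in>I. \<Prod>t<?m A i. ?ct i - t) * (?i * (?ct ?i - ?m A ?i)) =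
      (\<Prod>a\<in>insert b A. len a) * ((\<Prod>i\<in>I. \<Prod>t<?m A i. ?ct i - t) * (?ct ?i - ?m A ?i))"
    unfolding prod.insert[OF insert.hyps(1,2)] by (simp only: mult_ac)
  also have "(\<Prod>i\<in>I. \<Prod>t<?m A i. ?ct i - t) * (?ct ?i - ?m A ?i) = (\<Prod>i\<in>I. \<Prod>t<?m (insert b A) i. ?ct i - t)"
  proof -
    have m: "?m (insert b A) i = ?m A i + (if i = ?i then 1 else 0)" for i
    proof (cases "i = ?i")
      case True
      then have "{a \<in> insert b A. len a = i} = insert b {a \<in> A. len a = i}" by auto
      then show ?thesis using True insert.hyps by simp
    next
      case False
      then have "{a \<in> insert b A. len a = i} = {a \<in> A. len a = i}" by auto
      then show ?thesis using False by simp
    qed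
    have "(\<Prod>i\<in>I. \<Prod>t<?m (insert b A) i. ?ct i - t) =
      (\<Prod>i\<in>I. (\<Prod>t<?m A i. ?ct i - t) * (if i = ?i then ?ct ?i - ?m A ?i else 1))"
      unfolding m by (intro prod.cong) auto
    also have "\<dots> = (\<Prod>i\<in>I. \<Prod>t<?m A i. ?ct i - t) * (?ct ?i - ?m A ?i)"
      using I(1) insert.prems by (simp add: prod.distrib)
    finally show ?thesis by simp
  qed
  finally show ?case .
qed

lemma card_intertwiners:
  assumes c: "c \<in> perms n" and c': "c' \<in> perms n" and t: "cycle_type n c = cycle_type n c'"
  shows "card (intertwiners n c c') = z_const (cycle_type n c)"
proof -
  let ?B = "cycle_bases n c" and ?len = "\<lambda>b. card (cyc c b)"
  let ?m = "\<lambda>i. count (cycle_type n c) i"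
  have "set_mset (cycle_type n c) = ?len ` ?B"
    by (simp add: cycle_type_def cycle_bases_finite)
  have "card (intertwiners n c c') = card (base_maps n c' ?B ?len)"
    by (rule bij_betw_same_card[OF bij_intertwiners_base_maps[OF c c']])
  also have "\<dots> = (\<Prod>b\<in>?B. ?len b) * (\<Prod>i\<in>?len ` ?B. \<Prod>t<?m i. ?m i - t)"
    using cycle_bases_finite by (subst card_base_maps[OF c', of _ "?len ` ?B"]) (auto simp: count_cycle_type t[symmetric])
  also have "(\<Prod>b\<in>?B. ?len b) = (\<Prod>i\<in>?len ` ?B. i ^ ?m i)"
  proof -
    have "(\<Prod>b\<in>?B. ?len b) = (\<Prod>i\<in>?len ` ?B. \<Prod>b\<in>{b \<in> ?B. ?len b = i}. ?len b)"
      by (rule prod.image_gen[OF cycle_bases_finite])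
    then show ?thesis by (simp add: count_cycle_type)
  qed
  also have "(\<Prod>i\<in>?len ` ?B. \<Prod>t<?m i. ?m i - t) = (\<Prod>i\<in>?len ` ?B. fact (?m i))"
  proof (rule prod.cong[OF refl])
    fix i
    have "(\<Prod>t<k. k - t) = fact k" for k :: nat
      by (simp add: fact_prod_rev lessThan_atLeast0)
    then show "(\<Prod>t<?m i. ?m i - t) = fact (?m i)" .
  qed
  finally show ?thesis
    by (simp add: z_const_def \<open>set_mset _ = _\<close> prod.distrib)
qed

section \<open>From higher Lie characters to sums over conjugacy classes\<close>

abbreviation chi_val :: "nat list \<Rightarrow> nat multiset \<Rightarrow> int" where
  "chi_val nu t \<equiv> hall_p_s (sorted_list_of_multiset t) nu"

lemma perms_conj:
  assumes x: "x \<in> perms n"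
  shows "bij_betw (\<lambda>g. x \<circ> g \<circ> inv_into UNIV x) (perms n) (perms n)"
proof (rule bij_betw_byWitness[where f' = "\<lambda>g. inv_into UNIV x \<circ> g \<circ> x"])
  have xp: "x permutes {..<n}" using x by (simp add: perms_def)
  show "\<forall>g\<in>perms n. inv_into UNIV x \<circ> (x \<circ> g \<circ> inv_into UNIV x) \<circ> x = g"
    using permutes_inverses[OF xp] by (auto simp: fun_eq_iff)
  show "\<forall>g\<in>perms n. x \<circ> (inv_into UNIV x \<circ> g \<circ> x) \<circ> inv_into UNIV x = g"
    using permutes_inverses[OF xp] by (auto simp: fun_eq_iff)
  show "(\<lambda>g. x \<circ> g \<circ> inv_into UNIV x) ` perms n \<subseteq> perms n"
    unfolding perms_def using xp by (auto intro!: permutes_compose permutes_inv)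
  show "(\<lambda>g. inv_into UNIV x \<circ> g \<circ> x) ` perms n \<subseteq> perms n"
    unfolding perms_def using xp by (auto intro!: permutes_compose permutes_inv)
qed

lemma conj_eq_iff:
  assumes x: "x \<in> perms n"
  shows "x \<circ> g \<circ> inv_into UNIV x = h \<longleftrightarrow> x \<circ> g = h \<circ> x"
proof -
  have xp: "x permutes {..<n}" using x by (simp add: perms_def)
  show ?thesis
  proof
    assume "x \<circ> g \<circ> inv_into UNIV x = h"
    then have "h \<circ> x = x \<circ> g \<circ> inv_into UNIV x \<circ> x" by simp
    also have "\<dots> = x \<circ> g" using permutes_inverses[OF xp] by (simp add: fun_eq_iff)
    finally show "x \<circ> g = h \<circ> x" by simp
  next
    assume "x \<circ> g = h \<circ> x"
    then have "x \<circ> g \<circ> inv_into UNIV x = h \<circ> x \<circ> inv_into UNIV x" by simp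
    also have "\<dots> = h" using permutes_inverses[OF xp] by (simp add: fun_eq_iff)
    finally show "x \<circ> g \<circ> inv_into UNIV x = h" .
  qed
qed

lemma cycle_type_conj:
  assumes "x \<in> perms n" "g \<in> perms n"
  shows "cycle_type n (x \<circ> g \<circ> inv_into UNIV x) = cycle_type n g"
proof -
  have "x \<circ> g \<circ> inv_into UNIV x \<in> perms n" using bij_betwE[OF perms_conj[OF assms(1)]] assms(2) by blast
  moreover have "x \<in> intertwiners n g (x \<circ> g \<circ> inv_into UNIV x)"
    using conj_eq_iff[OF assms(1), of g "x \<circ> g \<circ> inv_into UNIV x"] assms(1) by (simp add: intertwiners_def)
  ultimately show ?thesis using cycle_type_intertwiner[OF assms(2)] by metis
qed

lemma centralizer_intertwiners: "centralizer n c = intertwiners n c c"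
  by (simp add: centralizer_def intertwiners_def)

lemma centralizer_finite: "finite (centralizer n c)"
  unfolding centralizer_def using perms_finite by simp

lemma id_in_centralizer: "id \<in> centralizer n c"
  by (simp add: centralizer_def perms_def permutes_id)

lemma card_centralizer: "c \<in> perms n \<Longrightarrow> card (centralizer n c) = z_const (cycle_type n c)"
  unfolding centralizer_intertwiners by (rule card_intertwiners) simp_all

text \<open>Frobenius reciprocity. \<open>chi_val\<close> at the cycle type is a class function, so
  after exchanging the sums every \<open>x\<close> contributes the same sum over the centralizer;
  the order of the latter is \<open>z_const\<close> and cancels.\<close>

lemma hall_L_s_eq:
  assumes c: "c \<in> perms n"
  shows "hall_L_s n c nu * of_nat (z_const (cycle_type n c)) =
    (\<Sum>z\<in>centralizer n c. lie_lin_char n c z * of_int (chi_val nu (cycle_type n z)))"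
proof -
  let ?Z = "centralizer n c"
  define W where "W g = (of_int (chi_val nu (cycle_type n g)) :: complex)" for g
  define h where "h g = (if g \<in> ?Z then lie_lin_char n c g else 0)" for g
  define S where "S = (\<Sum>z\<in>?Z. lie_lin_char n c z * W z)"
  have Z0: "card ?Z \<noteq> 0" using centralizer_finite id_in_centralizer by (metis card_0_eq empty_iff)
  have inner: "(\<Sum>g\<in>perms n. h (x \<circ> g \<circ> inv_into UNIV x) * W g) = S" if x: "x \<in> perms n" for x
  proof -
    have "(\<Sum>g\<in>perms n. h (x \<circ> g \<circ> inv_into UNIV x) * W g) = (\<Sum>g\<in>perms n. h (x \<circ> g \<circ> inv_into UNIV x) * W (x \<circ> g \<circ> inv_into UNIV x))"
      by (rule sum.cong[OF refl]) (simp add: W_def cycle_type_conj[OF x])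
    also have "\<dots> = (\<Sum>g\<in>perms n. h g * W g)"
      by (rule sum.reindex_bij_betw[OF perms_conj[OF x]])
    also have "\<dots> = (\<Sum>g\<in>?Z. h g * W g)"
      by (rule sum.mono_neutral_right[OF perms_finite]) (auto simp: centralizer_def h_def)
    also have "\<dots> = S" unfolding S_def h_def by simp
    finally show ?thesis .
  qed
  have "hall_L_s n c nu = (1 / of_nat (fact n)) *
      (\<Sum>g\<in>perms n. (1 / of_nat (card ?Z)) * (\<Sum>x\<in>perms n. h (x \<circ> g \<circ> inv_into UNIV x) * W g))"
    unfolding hall_L_s_def higher_lie_char_def h_def W_def by (simp add: sum_distrib_right mult.assoc)
  also have "\<dots> = (1 / of_nat (fact n)) * ((1 / of_nat (card ?Z)) * (\<Sum>x\<in>perms n. \<Sum>g\<in>perms n. h (x \<circ> g \<circ> inv_into UNIV x) * W g))"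
    unfolding sum_distrib_left[symmetric] by (subst sum.swap) simp
  also have "(\<Sum>x\<in>perms n. \<Sum>g\<in>perms n. h (x \<circ> g \<circ> inv_into UNIV x) * W g) = (\<Sum>x\<in>perms n. S)"
    by (rule sum.cong[OF refl inner])
  also have "\<dots> = of_nat (fact n) * S" by (simp add: perms_card)
  finally have "hall_L_s n c nu * of_nat (card ?Z) = S" using Z0 by simp
  then show ?thesis unfolding S_def W_def card_centralizer[OF c] .
qed

lemma cmod_lie_lin_char: "cmod (lie_lin_char n c z) = 1"
proof -
  have "cmod (exp (2 * pi * \<i> * of_nat a / of_nat b)) = 1" for a b :: nat
  proof -
    have e: "complex_of_real (2 * pi) * \<i> * of_nat a / of_nat b = \<i> * complex_of_real (2 * pi * real a / real b)"
      by simp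
    show ?thesis unfolding e by (rule norm_exp_i_times)
  qed
  then show ?thesis unfolding lie_lin_char_def by (simp add: prod_norm[symmetric])
qed

lemma lie_lin_char_id:
  assumes c: "c \<in> perms n"
  shows "lie_lin_char n c id = 1"
proof -
  have "rot c id b = 0" if b: "b \<in> cycle_bases n c" for b
  proof -
    have "(c ^^ 0) (Min (cyc c (id b))) = id b" using b by (simp add: cycle_bases_def)
    then show ?thesis unfolding rot_def by (rule Least_eq_0)
  qed
  then show ?thesis unfolding lie_lin_char_def by simp
qed

text \<open>The identity contributes 1. In all other terms the linear character is dropped, its
  values having modulus 1.\<close>

lemma cmod_R_var_le:
  assumes c: "c \<in> perms n" and f: "of_int (chi_val nu (cycle_type n id)) = real (num_syt nu)" "0 < num_syt nu"
  shows "cmod (R_var n nu c) \<le> (\<Sum>z\<in>centralizer n c - {id}. \<bar>of_int (chi_val nu (cycle_type n z))\<bar> / real (num_syt nu))"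
proof -
  let ?Z = "centralizer n c"
  let ?t = "\<lambda>z. lie_lin_char n c z * of_int (chi_val nu (cycle_type n z))"
  have f': "of_int (chi_val nu (cycle_type n id)) = (of_nat (num_syt nu) :: complex)"
    using f(1) by (metis of_int_eq_iff of_int_of_nat_eq)
  have "R_var n nu c = (\<Sum>z\<in>?Z. ?t z) / of_nat (num_syt nu) - 1"
    unfolding R_var_def hall_L_s_eq[OF c] ..
  also have "(\<Sum>z\<in>?Z. ?t z) = of_nat (num_syt nu) + (\<Sum>z\<in>?Z - {id}. ?t z)"
    using sum.remove[OF centralizer_finite id_in_centralizer, of ?t n c] f' lie_lin_char_id[OF c] by simp
  finally have "R_var n nu c = (\<Sum>z\<in>?Z - {id}. ?t z / of_nat (num_syt nu))"
    using f(2) by (simp add: add_divide_distrib sum_divide_distrib)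
  then have "cmod (R_var n nu c) \<le> (\<Sum>z\<in>?Z - {id}. cmod (?t z / of_nat (num_syt nu)))"
    by (simp only: norm_sum)
  then show ?thesis by (simp add: norm_divide norm_mult cmod_lie_lin_char)
qed

text \<open>The fibres of the map that conjugates \<open>z0\<close> by \<open>x\<close> are sets of
  intertwiners, all of the same size.\<close>

lemma card_cycle_type_class:
  assumes z0: "z0 \<in> perms n"
  shows "card {z \<in> perms n. cycle_type n z = cycle_type n z0} * z_const (cycle_type n z0) = fact n"
proof -
  let ?K = "{z \<in> perms n. cycle_type n z = cycle_type n z0}" and ?f = "\<lambda>x. x \<circ> z0 \<circ> inv_into UNIV x"
  have "?f ` perms n \<subseteq> ?K"
  proof (rule image_subsetI)
    fix x assume x: "x \<in> perms n"
    then show "?f x \<in> ?K" using bij_betwE[OF perms_conj[OF x]] z0 cycle_type_conj[OF x z0] by simp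
  qed
  then have "(\<Sum>z\<in>?K. \<Sum>x | x \<in> perms n \<and> ?f x = z. 1) = (\<Sum>x\<in>perms n. 1::nat)"
    using perms_finite by (intro sum.group) auto
  moreover have "(\<Sum>x | x \<in> perms n \<and> ?f x = z. 1) = z_const (cycle_type n z0)" if z: "z \<in> ?K" for z
  proof -
    have "{x \<in> perms n. ?f x = z} = intertwiners n z0 z"
      unfolding intertwiners_def using conj_eq_iff by blast
    then show ?thesis using card_intertwiners[OF z0, of z] z by simp
  qed
  ultimately show ?thesis by (simp add: perms_card)
qed

text \<open>Commuting pairs are counted from the other side: a fixed \<open>z\<close> lies in the
  centralizers of \<open>z_const\<close> permutations. Class size times \<open>z_const\<close> is
  \<open>n!\<close>, so every class has the same weight, however large it is.\<close>

lemma sum_centralizers_le: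
  assumes u: "\<And>t. 0 \<le> (u t :: real)"
  shows "(\<Sum>c\<in>perms n. \<Sum>z\<in>centralizer n c - {id}. u (cycle_type n z)) \<le>
    fact n * (\<Sum>t\<in>cycle_type n ` (perms n - {id}). u t)"
proof -
  let ?P = "perms n - {id}"
  have fP: "finite ?P" using perms_finite by simp
  have "(\<Sum>c\<in>perms n. \<Sum>z\<in>centralizer n c - {id}. u (cycle_type n z)) =
    (\<Sum>c\<in>perms n. \<Sum>z | z \<in> ?P \<and> z \<circ> c = c \<circ> z. u (cycle_type n z))"
    by (intro sum.cong refl) (auto simp: centralizer_def)
  also have "\<dots> = (\<Sum>z\<in>?P. \<Sum>c | c \<in> perms n \<and> z \<circ> c = c \<circ> z. u (cycle_type n z))"
    by (rule sum.swap_restrict[OF perms_finite fP])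
  also have "\<dots> = (\<Sum>z\<in>?P. real (z_const (cycle_type n z)) * u (cycle_type n z))"
  proof (rule sum.cong[OF refl])
    fix z assume "z \<in> ?P"
    moreover have "{c \<in> perms n. z \<circ> c = c \<circ> z} = centralizer n z" unfolding centralizer_def by (auto simp: eq_commute)
    ultimately show "(\<Sum>c | c \<in> perms n \<and> z \<circ> c = c \<circ> z. u (cycle_type n z)) = real (z_const (cycle_type n z)) * u (cycle_type n z)"
      using card_centralizer[of z n] by simp
  qed
  also have "\<dots> = (\<Sum>t\<in>cycle_type n ` ?P. \<Sum>z | z \<in> ?P \<and> cycle_type n z = t. real (z_const (cycle_type n z)) * u (cycle_type n z))"
    by (rule sum.image_gen[OF fP])
  also have "\<dots> = (\<Sum>t\<in>cycle_type n ` ?P. real (card {z \<in> ?P. cycle_type n z = t} * z_const t) * u t)"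
    by (intro sum.cong refl) simp
  also have "\<dots> \<le> (\<Sum>t\<in>cycle_type n ` ?P. fact n * u t)"
  proof (intro sum_mono mult_right_mono u)
    fix t assume "t \<in> cycle_type n ` ?P"
    then obtain z0 where z0: "z0 \<in> perms n" "t = cycle_type n z0" by blast
    have "card {z \<in> ?P. cycle_type n z = t} * z_const t \<le> card {z \<in> perms n. cycle_type n z = t} * z_const t"
      using perms_finite by (intro mult_right_mono card_mono) auto
    also have "\<dots> = fact n" using card_cycle_type_class[OF z0(1)] z0(2) by simp
    finally have "card {z \<in> ?P. cycle_type n z = t} * z_const t \<le> fact n" .
    then show "real (card {z \<in> ?P. cycle_type n z = t} * z_const t) \<le> fact n"
      by (metis of_nat_fact of_nat_le_iff)
  qed
  finally show ?thesis by (simp add: sum_distrib_left)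
qed

lemma cycle_type_facts:
  assumes z: "z \<in> perms n"
  shows "\<forall>i\<in>#cycle_type n z. 0 < i" "sum_mset (cycle_type n z) = n"
    "z \<noteq> id \<Longrightarrow> \<exists>i\<in>#cycle_type n z. i \<noteq> 1"
proof -
  let ?B = "cycle_bases n z"
  have set: "set_mset (cycle_type n z) = (\<lambda>b. card (cyc z b)) ` ?B"
    by (simp add: cycle_type_def cycle_bases_finite)
  show "\<forall>i\<in>#cycle_type n z. 0 < i" unfolding set using cyc_card_pos[OF z] by blast
  have "sum_mset (cycle_type n z) = (\<Sum>b\<in>?B. card (cyc z b))"
    unfolding cycle_type_def by (rule sum_unfold_sum_mset[symmetric])
  also have "\<dots> = (\<Sum>b\<in>?B. \<Sum>y | y \<in> {..<n} \<and> Min (cyc z y) = b. 1)"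
  proof (rule sum.cong[OF refl])
    fix b assume b: "b \<in> ?B"
    have bn: "b < n" "Min (cyc z b) = b" using b by (auto simp: cycle_bases_def)
    have "{y. y \<in> {..<n} \<and> Min (cyc z y) = b} = cyc z b"
    proof (intro equalityI subsetI)
      fix y assume "y \<in> {y. y \<in> {..<n} \<and> Min (cyc z y) = b}"
      then have "cyc z b = cyc z y" using cycle_base(2)[OF z, of y] by auto
      then show "y \<in> cyc z b" using cyc_self by simp
    next
      fix y assume y: "y \<in> cyc z b"
      then show "y \<in> {y. y \<in> {..<n} \<and> Min (cyc z y) = b}"
        using cyc_eq[OF z y] cyc_subset[OF z bn(1)] bn(2) by auto
    qed
    then show "card (cyc z b) = (\<Sum>y | y \<in> {..<n} \<and> Min (cyc z y) = b. 1)" by simp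
  qed
  also have "\<dots> = (\<Sum>y\<in>{..<n}. 1)"
    using cycle_bases_finite cycle_base(1)[OF z] by (intro sum.group) auto
  finally show "sum_mset (cycle_type n z) = n" by simp
  show "\<exists>i\<in>#cycle_type n z. i \<noteq> 1" if "z \<noteq> id"
  proof (rule ccontr)
    assume "\<not> ?thesis"
    then have one: "card (cyc z b) = 1" if "b \<in> ?B" for b using that unfolding set by blast
    have "z y = y" for y
    proof (cases "y < n")
      case True
      have "card (cyc z y) = 1" using one[OF cycle_base(1)[OF z True]] cycle_base(2)[OF z True] by simp
      then obtain w where "cyc z y = {w}" by (auto simp: card_1_singleton_iff)
      moreover have "y \<in> cyc z y" "z y \<in> cyc z y" using cyc_self cyc_funpow[where p = z and k = 1 and x = y] by simp_all
      ultimately show ?thesis by simp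
    qed (rule perms_outside[OF z])
    then show False using that by (simp add: fun_eq_iff)
  qed
qed

section \<open>Asymptotics\<close>

lemma power_le_exp_fact: "real s ^ s \<le> exp (real s) * fact s"
proof -
  have "(\<Sum>i\<in>{s}. real s ^ i /\<^sub>R fact i) \<le> (\<Sum>i. real s ^ i /\<^sub>R fact i)"
    using exp_converges[of "real s"] by (intro sum_le_suminf) (auto simp: sums_iff)
  then have "real s ^ s / fact s \<le> exp (real s)"
    using exp_converges[of "real s"] by (simp add: sums_iff field_simps)
  then show ?thesis by (simp add: field_simps)
qed

text \<open>The base of the estimate in \<open>phi_le_decay\<close>: 2 from the number of shapes,
  \<open>(2 * s) powr (3/4)\<close> from character and degree, \<open>K * n\<close> from
  \<open>m^2\<close>, and \<open>exp 2 / (n * s)\<close> from the factorials. Here \<open>n\<close>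
  cancels and \<open>s powr (- 1/4)\<close> remains.\<close>

definition decay_base :: "real \<Rightarrow> nat \<Rightarrow> real" where
  "decay_base K s = 2 * 2 powr (3/4) * K * exp 2 * real s powr (- 1/4)"

lemma decay_base_nonneg: "0 \<le> K \<Longrightarrow> 0 \<le> decay_base K s"
  by (simp add: decay_base_def)

lemma phi_le_decay:
  assumes X: "finite X" "X \<subseteq> {..m}" and m: "(real m)\<^sup>2 \<le> K * real (sz X)"
    and mu: "\<forall>r\<in>set mu. 2 \<le> r" "sum_list mu = s" "0 < s" "s \<le> sz X"
  shows "\<bar>phi mu X\<bar> \<le> decay_base K s ^ s"
proof -
  let ?n = "sz X"
  have n0: "0 < ?n" using mu by simp
  have K: "0 \<le> K"
  proof -
    have "0 \<le> K * real ?n" using m by (meson order_trans zero_le_power2)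
    then show ?thesis using n0 by (simp add: zero_le_mult_iff)
  qed
  have len: "2 * length mu \<le> s"
  proof -
    have "2 * length mu \<le> sum_list mu" using mu(1) by (induction mu) auto
    then show ?thesis using mu(2) by simp
  qed
  \<comment> \<open>Without parts 1 there are at most \<open>s / 2\<close> parts, hence the exponent
    \<open>(s / 2 + s) / 2 = 3 s / 4\<close>. With parts 1 it could reach \<open>s\<close>, and the
    decay would be lost.\<close>
  have a: "sqrt (2 * real s) ^ (length mu + s) \<le> ((2 * real s) powr (3/4)) ^ s"
  proof -
    have "sqrt (2 * real s) ^ (length mu + s) = (2 * real s) powr (real (length mu + s) / 2)"
      using mu(3) by (simp add: powr_half_sqrt[symmetric] powr_realpow[symmetric] powr_powr)
    also have "\<dots> \<le> (2 * real s) powr (3/4 * real s)"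
      using len mu(3) by (intro powr_mono) auto
    also have "\<dots> = ((2 * real s) powr (3/4)) ^ s"
      using mu(3) by (simp add: powr_realpow[symmetric] powr_powr)
    finally show ?thesis .
  qed
  have b: "real m ^ (2 * s) \<le> (K * real ?n) ^ s"
    unfolding power_mult using m by (intro power_mono) auto
  \<comment> \<open>The quotient is the reciprocal of \<open>(n choose s) * (s!)^2\<close>; the
    binomial coefficient is at least \<open>(n / s)^s\<close> and each \<open>s!\<close> at least
    \<open>(s / e)^s\<close>.\<close>
  have c: "fact (?n - s) / (fact ?n * fact s) \<le> (exp 2 / (real ?n * real s)) ^ s"
  proof -
    have "(real ?n / real s) ^ s \<le> real (?n choose s)" by (rule binomial_ge_n_over_k_pow_k[OF mu(4)])
    then have "(real ?n / real s) ^ s * (real s ^ s / exp (real s)) ^ 2 \<le> real (?n choose s) * (fact s) ^ 2"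
      using power_le_exp_fact[of s] mu(3)
      by (intro mult_mono power_mono) (auto simp: divide_le_eq mult.commute)
    moreover have "(real ?n / real s) ^ s * (real s ^ s / exp (real s)) ^ 2 = (real ?n * real s / exp 2) ^ s"
    proof -
      have "exp (real s) = exp 1 ^ s" by (simp add: exp_of_nat_mult[symmetric])
      moreover have "exp 2 = (exp 1 :: real) * exp 1" by (simp add: exp_add[symmetric])
      ultimately show ?thesis using mu(3)
        by (simp add: power_divide power_mult_distrib power2_eq_square)
    qed
    ultimately have le: "(real ?n * real s / exp 2) ^ s \<le> real (?n choose s) * (fact s) ^ 2" by simp
    have "fact (?n - s) / (fact ?n * fact s) = 1 / (real (?n choose s) * (fact s) ^ 2)"
    proof -
      have "fact ?n = fact s * fact (?n - s) * real (?n choose s)"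
        using binomial_fact_lemma[OF mu(4)] by (metis of_nat_fact of_nat_mult)
      then show ?thesis by (simp add: power2_eq_square)
    qed
    also have "\<dots> \<le> 1 / (real ?n * real s / exp 2) ^ s"
      using le n0 mu(3) by (intro divide_left_mono) (auto intro!: mult_pos_pos simp: mu(4))
    also have "\<dots> = (exp 2 / (real ?n * real s)) ^ s" by (simp add: power_divide)
    finally show ?thesis .
  qed
  have "\<bar>phi mu X\<bar> \<le> 2 ^ s * sqrt (2 * real s) ^ (length mu + s) * real m ^ (2 * s) * (fact (?n - s) / (fact ?n * fact s))"
    using phi_le_factorial[OF X mu(1)] mu(2,4) by simp
  also have "\<dots> \<le> 2 ^ s * ((2 * real s) powr (3/4)) ^ s * (K * real ?n) ^ s * (exp 2 / (real ?n * real s)) ^ s"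
    using a b c K by (intro mult_mono) auto
  also have "\<dots> = (2 * (2 * real s) powr (3/4) * (K * real ?n) * (exp 2 / (real ?n * real s))) ^ s"
    by (simp only: power_mult_distrib)
  also have "2 * (2 * real s) powr (3/4) * (K * real ?n) * (exp 2 / (real ?n * real s)) = decay_base K s"
  proof -
    have "real s powr (3/4) = real s powr (- 1/4) * real s"
      using mu(3) powr_add[of "real s" "- 1/4" 1] by simp
    then show ?thesis using n0 mu(3) by (simp add: decay_base_def powr_mult)
  qed
  finally show ?thesis .
qed

text \<open>\<open>phi_double\<close> with a number \<open>M\<close> of windows that stays fixed
  while \<open>n\<close> grows, followed by a square root.\<close>

lemma phi_eventually_step:
  fixes X :: "nat \<Rightarrow> nat set"
  assumes X: "\<And>n. finite (X n)" "\<And>n. sz (X n) = n" and mu: "\<forall>r\<in>set mu. 0 < r" and x: "0 \<le> x"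
    and ev: "\<And>\<delta>. 0 < \<delta> \<Longrightarrow> \<forall>\<^sub>F n in sequentially. \<bar>phi (mu @ mu) (X n)\<bar> \<le> x\<^sup>2 + \<delta>"
    and d: "0 < \<delta>"
  shows "\<forall>\<^sub>F n in sequentially. \<bar>phi mu (X n)\<bar> \<le> x + \<delta>"
proof -
  \<comment> \<open>With \<open>eta = delta^2 / 2\<close> and \<open>M > 4 / delta^4\<close>, the
    errors \<open>eta\<close>, \<open>eta / 2\<close> and \<open>1 / (2 * eta * M)\<close> add up to
    at most \<open>delta^2\<close>, which \<open>(x + delta)^2\<close> absorbs.\<close>
  define \<eta> where "\<eta> = \<delta>\<^sup>2 / 2"
  have eta: "0 < \<eta>" using d by (simp add: \<eta>_def)
  obtain M :: nat where M: "4 / \<delta> ^ 4 < real M" using reals_Archimedean2 by blast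
  have M0: "0 < M"
  proof -
    have "0 < 4 / \<delta> ^ 4" using d by simp
    then have "0 < real M" using M by linarith
    then show ?thesis by simp
  qed
  have M1: "1 / (2 * \<eta> * real M) \<le> \<delta>\<^sup>2 / 4"
  proof -
    have "4 < real M * \<delta> ^ 4" using M d by (simp add: divide_less_eq)
    then show ?thesis using d M0 by (simp add: \<eta>_def field_simps power2_eq_square power4_eq_xxxx)
  qed
  have "\<forall>\<^sub>F n in sequentially. (M + 1) * sum_list mu \<le> n" by (rule eventually_ge_at_top)
  moreover have "\<forall>\<^sub>F n in sequentially. \<bar>phi (mu @ mu) (X n)\<bar> \<le> x\<^sup>2 + \<eta>" by (rule ev[OF eta])
  ultimately show ?thesis
  proof eventually_elim
    case (elim n)
    have "(phi mu (X n))\<^sup>2 \<le> \<bar>phi (mu @ mu) (X n)\<bar> + \<eta> / 2 + 1 / (2 * \<eta> * real M)"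
      using elim(1) X by (intro phi_double mu M0 eta) auto
    also have "\<dots> \<le> x\<^sup>2 + \<delta>\<^sup>2" using elim(2) M1 by (simp add: \<eta>_def)
    also have "\<dots> \<le> (x + \<delta>)\<^sup>2" using x d by (simp add: power2_sum)
    finally have "\<bar>phi mu (X n)\<bar>\<^sup>2 \<le> (x + \<delta>)\<^sup>2" by simp
    then show ?case using x d by (rule_tac power2_le_imp_le) simp_all
  qed
qed

lemma decay_base_tendsto: "decay_base K \<longlonglongrightarrow> 0"
proof -
  have "(\<lambda>s. real s powr (- 1/4)) \<longlonglongrightarrow> 0"
    by (rule tendsto_neg_powr) (auto simp: filterlim_real_sequentially)
  from tendsto_mult_left[OF this, of "2 * 2 powr (3/4) * K * exp 2"]
  show ?thesis unfolding decay_base_def[abs_def] by simp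
qed

text \<open>A decay for long fpf_types propagates to short fpf_types: \<open>phi mu\<^sup>2\<close> is asymptotically at most
  \<open>phi (mu @ mu)\<close>, and iterating this \<open>k\<close> times gains the decay of the type repeated \<open>2\<^sup>k\<close> times.\<close>
lemma phi_tendsto:
  fixes X :: "nat \<Rightarrow> nat set"
  assumes X: "\<And>n. finite (X n)" "\<And>n. sz (X n) = n"
    and K: "0 \<le> K" "\<And>n. \<exists>m. X n \<subseteq> {..m} \<and> (real m)\<^sup>2 \<le> K * real n"
    and mu: "\<forall>r\<in>set mu. 2 \<le> r" "0 < sum_list mu"
  shows "(\<lambda>n. \<bar>phi mu (X n)\<bar>) \<longlonglongrightarrow> 0"
proof -
  \<comment> \<open>After \<open>k\<close> doublings the type that is estimated directly has size
    \<open>2^k * sum_list tau\<close>; taking \<open>k\<close> square roots leaves the exponent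
    \<open>sum_list tau\<close>. The type is arbitrary so that the induction can pass to
    \<open>tau @ tau\<close>.\<close>
  have ev: "\<forall>\<^sub>F n in sequentially. \<bar>phi tau (X n)\<bar> \<le> decay_base K (2 ^ k * sum_list tau) ^ sum_list tau + \<delta>"
    if "\<forall>r\<in>set tau. 2 \<le> r" "0 < sum_list tau" "0 < \<delta>" for tau k \<delta>
    using that
  proof (induction k arbitrary: tau \<delta>)
    case 0
    have "\<forall>\<^sub>F n in sequentially. sum_list tau \<le> n" by (rule eventually_ge_at_top)
    then show ?case
    proof eventually_elim
      case (elim n)
      obtain m where "X n \<subseteq> {..m}" "(real m)\<^sup>2 \<le> K * real n" using K(2) by blast
      then have "\<bar>phi tau (X n)\<bar> \<le> decay_base K (sum_list tau) ^ sum_list tau"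
        using elim X 0 by (intro phi_le_decay) auto
      then show ?case using 0(3) by simp
    qed
  next
    case (Suc k)
    have pos: "\<forall>r\<in>set tau. 0 < r" using Suc.prems(1) by auto
    let ?s = "sum_list tau"
    have eq: "decay_base K (2 ^ k * sum_list (tau @ tau)) ^ sum_list (tau @ tau) = (decay_base K (2 ^ Suc k * ?s) ^ ?s)\<^sup>2"
    proof -
      have "2 ^ k * sum_list (tau @ tau) = 2 ^ Suc k * ?s" "sum_list (tau @ tau) = ?s + ?s" by simp_all
      then show ?thesis by (simp only: power_add power2_eq_square)
    qed
    have "\<forall>\<^sub>F n in sequentially. \<bar>phi (tau @ tau) (X n)\<bar> \<le> (decay_base K (2 ^ Suc k * ?s) ^ ?s)\<^sup>2 + \<delta>'" if "0 < \<delta>'" for \<delta>'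
      using Suc.IH[of "tau @ tau" \<delta>'] Suc.prems that unfolding eq by auto
    then show ?case
      using Suc.prems decay_base_nonneg[OF K(1)] by (intro phi_eventually_step[OF X pos]) auto
  qed
  let ?s = "sum_list mu"
  \<comment> \<open>The exponent is fixed and the base tends to 0, so \<open>k\<close> can be chosen
    independently of \<open>n\<close>.\<close>
  have "(\<lambda>k. decay_base K (2 ^ k * ?s) ^ ?s) \<longlonglongrightarrow> 0 ^ ?s"
  proof (intro tendsto_power)
    have "filterlim (\<lambda>k::nat. 2 ^ k * ?s) sequentially sequentially"
    proof (rule filterlim_subseq)
      show "strict_mono (\<lambda>k::nat. 2 ^ k * ?s)" using mu(2) by (simp add: strict_mono_def)
    qed
    then show "(\<lambda>k. decay_base K (2 ^ k * ?s)) \<longlonglongrightarrow> 0" by (rule filterlim_compose[OF decay_base_tendsto])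
  qed
  moreover have "(0::real) ^ ?s = 0" using mu(2) by simp
  ultimately have lim: "(\<lambda>k. decay_base K (2 ^ k * ?s) ^ ?s) \<longlonglongrightarrow> 0" by (simp only:)
  show ?thesis
  proof (rule LIMSEQ_I)
    fix r :: real assume r: "0 < r"
    have "\<forall>\<^sub>F k in sequentially. decay_base K (2 ^ k * ?s) ^ ?s < r / 2"
      using order_tendstoD(2)[OF lim, of "r / 2"] r by simp
    from eventually_happens'[OF sequentially_bot this]
    obtain k where k: "decay_base K (2 ^ k * ?s) ^ ?s < r / 2" ..
    have "\<forall>\<^sub>F n in sequentially. \<bar>phi mu (X n)\<bar> \<le> decay_base K (2 ^ k * ?s) ^ ?s + r / 2"
      using ev[OF mu, of "r / 2" k] r by simp
    then have "\<forall>\<^sub>F n in sequentially. norm (\<bar>phi mu (X n)\<bar> - 0) < r"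
      by eventually_elim (use k in auto)
    then show "\<exists>no. \<forall>n\<ge>no. norm (\<bar>phi mu (X n)\<bar> - 0) < r"
      by (simp add: eventually_sequentially)
  qed
qed

section \<open>Summation over all types\<close>

text \<open>Ordered lists stand for cycle types without fixed points. A type may be counted several
  times, which only enlarges an upper bound, and \<open>2 ^ s\<close> still bounds the number of
  lists.\<close>

definition fpf_types :: "nat \<Rightarrow> nat list set" where
  "fpf_types s = {mu. (\<forall>r\<in>set mu. 2 \<le> r) \<and> sum_list mu = s}"

text \<open>For \<open>s > 0\<close> a list is determined by its tail, whose sum is smaller than
  \<open>s\<close>.\<close>

lemma card_fpf_types_le: "finite (fpf_types s) \<and> card (fpf_types s) \<le> 2 ^ s"
proof (induction s rule: less_induct)
  case (less s)
  show ?case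
  proof (cases "s = 0")
    case True
    have sub: "fpf_types s \<subseteq> {[]}"
    proof
      fix mu assume "mu \<in> fpf_types s"
      then show "mu \<in> {[]}" using True by (cases mu) (auto simp: fpf_types_def)
    qed
    show ?thesis using finite_subset[OF sub] card_mono[OF _ sub] True by simp
  next
    case False
    let ?U = "\<Union>i<s. fpf_types i"
    have fU: "finite ?U" using less by simp
    have sub: "fpf_types s \<subseteq> (\<lambda>mu. (s - sum_list mu) # mu) ` ?U"
    proof
      fix mu assume mu: "mu \<in> fpf_types s"
      then obtain r tau where r: "mu = r # tau" using False by (cases mu) (auto simp: fpf_types_def)
      have "2 \<le> r" "r + sum_list tau = s" "\<forall>r\<in>set tau. 2 \<le> r" using mu r by (auto simp: fpf_types_def)
      then have "mu = (s - sum_list tau) # tau" "tau \<in> fpf_types (sum_list tau)" "sum_list tau < s"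
        using r by (auto simp: fpf_types_def)
      then show "mu \<in> (\<lambda>mu. (s - sum_list mu) # mu) ` ?U" by blast
    qed
    have "card (fpf_types s) \<le> card ((\<lambda>mu. (s - sum_list mu) # mu) ` ?U)" using fU sub by (intro card_mono) auto
    also have "\<dots> \<le> card ?U" by (rule card_image_le[OF fU])
    also have "\<dots> \<le> (\<Sum>i<s. card (fpf_types i))" by (rule card_UN_le) simp
    also have "\<dots> \<le> (\<Sum>i<s. 2 ^ i)" using less by (intro sum_mono) simp
    also have "\<dots> \<le> 2 ^ s" by (induction s) auto
    finally show ?thesis using finite_subset[OF sub] fU by simp
  qed
qed

text \<open>Dominated convergence for series: \<open>phi_tendsto\<close> treats each
  \<open>s\<close>, and the majorant \<open>(2 * decay_base K s) ^ s\<close> is summable because its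
  base tends to 0. The factor 2 pays for the number of types.\<close>

lemma sum_phi_tendsto:
  fixes X :: "nat \<Rightarrow> nat set"
  assumes X: "\<And>n. finite (X n)" "\<And>n. sz (X n) = n"
    and K: "0 \<le> K" "\<And>n. \<exists>m. X n \<subseteq> {..m} \<and> (real m)\<^sup>2 \<le> K * real n"
  shows "(\<lambda>n. \<Sum>s=1..n. \<Sum>mu\<in>fpf_types s. \<bar>phi mu (X n)\<bar>) \<longlonglongrightarrow> 0"
proof -
  \<comment> \<open>Extension by 0 beyond \<open>s = n\<close> turns the finite sums into series
    over one index set; \<open>s = 0\<close>, the class of the identity, is left out.\<close>
  define a where "a s n = (if 1 \<le> s \<and> s \<le> n then \<Sum>mu\<in>fpf_types s. \<bar>phi mu (X n)\<bar> else 0)" for s n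
  have lim: "a s \<longlonglongrightarrow> 0" for s
  proof (cases "1 \<le> s")
    case True
    have "(\<lambda>n. \<Sum>mu\<in>fpf_types s. \<bar>phi mu (X n)\<bar>) \<longlonglongrightarrow> (\<Sum>mu\<in>fpf_types s. 0)"
      using True by (intro tendsto_sum phi_tendsto[OF X K]) (auto simp: fpf_types_def)
    moreover have "\<forall>\<^sub>F n in sequentially. (\<Sum>mu\<in>fpf_types s. \<bar>phi mu (X n)\<bar>) = a s n"
      using eventually_ge_at_top[of s] by eventually_elim (use True in \<open>simp add: a_def\<close>)
    ultimately show ?thesis using tendsto_cong by fastforce
  next
    case False
    then have "a s = (\<lambda>n. 0)" by (auto simp: a_def)
    then show ?thesis by simp
  qed
  have bound: "norm (a s n) \<le> (2 * decay_base K s) ^ s" for s n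
  proof (cases "1 \<le> s \<and> s \<le> n")
    case True
    obtain m where m: "X n \<subseteq> {..m}" "(real m)\<^sup>2 \<le> K * real n" using K(2) by blast
    have "(\<Sum>mu\<in>fpf_types s. \<bar>phi mu (X n)\<bar>) \<le> (\<Sum>mu\<in>fpf_types s. decay_base K s ^ s)"
      using True X m by (intro sum_mono phi_le_decay) (auto simp: fpf_types_def)
    also have "\<dots> = real (card (fpf_types s)) * decay_base K s ^ s" by simp
    also have "\<dots> \<le> 2 ^ s * decay_base K s ^ s"
    proof (rule mult_right_mono)
      show "real (card (fpf_types s)) \<le> 2 ^ s" using card_fpf_types_le[of s] by (metis of_nat_le_iff of_nat_numeral of_nat_power)
    qed (simp add: decay_base_nonneg K)
    finally show ?thesis using True by (simp add: a_def power_mult_distrib sum_nonneg)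
  qed (use decay_base_nonneg[OF K(1)] in \<open>auto simp: a_def\<close>)
  have summ: "summable (\<lambda>s. (2 * decay_base K s) ^ s)"
  proof (rule summable_comparison_test_ev)
    have "(\<lambda>s. 2 * decay_base K s) \<longlonglongrightarrow> 0" using tendsto_mult_left[OF decay_base_tendsto, of 2] by simp
    then have "\<forall>\<^sub>F s in sequentially. 2 * decay_base K s < 1 / 2" by (rule order_tendstoD(2)) simp
    then show "\<forall>\<^sub>F s in sequentially. norm ((2 * decay_base K s) ^ s) \<le> (1 / 2) ^ s"
    proof eventually_elim
      case (elim s)
      have "0 \<le> 2 * decay_base K s" using decay_base_nonneg[OF K(1)] by simp
      then have "(2 * decay_base K s) ^ s \<le> (1 / 2) ^ s" using elim by (intro power_mono) auto
      then show ?case using \<open>0 \<le> 2 * decay_base K s\<close> by (simp only: real_norm_def abs_of_nonneg zero_le_power)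
    qed
    show "summable (\<lambda>s. (1 / 2 :: real) ^ s)" by simp
  qed
  have "(\<lambda>n. \<Sum>s. a s n) \<longlonglongrightarrow> (\<Sum>s. 0)"
  proof -
    have "\<forall>\<^sub>F (s, n) in at_top \<times>\<^sub>F sequentially. norm (a s n) \<le> (2 * decay_base K s) ^ s"
    proof (rule always_eventually, rule allI)
      fix p show "case p of (s, n) \<Rightarrow> norm (a s n) \<le> (2 * decay_base K s) ^ s"
        by (cases p) (simp only: prod.case bound)
    qed
    from tannerys_theorem[OF lim this summ sequentially_bot] show ?thesis by blast
  qed
  moreover have "(\<Sum>s. a s n) = (\<Sum>s=1..n. \<Sum>mu\<in>fpf_types s. \<bar>phi mu (X n)\<bar>)" for n
  proof -
    have "(\<Sum>s. a s n) = (\<Sum>s=1..n. a s n)" by (rule suminf_finite) (auto simp: a_def)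
    then show ?thesis by (simp add: a_def)
  qed
  ultimately show ?thesis by simp
qed

section \<open>Cycle types as padded lists and the final estimate\<close>

lemma cycle_type_id: "cycle_type n id = replicate_mset n 1"
proof -
  have "cyc id x = {x}" for x by (auto simp: cyc_def)
  then show ?thesis by (simp add: cycle_type_def cycle_bases_def lessThan_def[symmetric] image_mset_const_eq)
qed

lemma chi_val_ch:
  assumes nu: "sorted_wrt (\<ge>) nu" and t: "t = mset tau"
  shows "real_of_int (chi_val nu t) = ch tau (beta_set nu)"
  unfolding hall_p_s_jts[OF nu] ch_def card_beta[OF nu] t by (subst jts_mset[of _ tau]) simp_all

text \<open>Stripping the parts 1 is injective on cycle types, since their number can be recovered
  from \<open>n\<close>. A permutation other than the identity keeps some part, so \<open>s\<close>
  starts at 1.\<close>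

lemma sum_classes_le:
  assumes nu: "sorted_wrt (\<ge>) nu" "sum_list nu = n"
  shows "(\<Sum>t\<in>cycle_type n ` (perms n - {id}). \<bar>of_int (chi_val nu t)\<bar> / real (num_syt nu)) \<le>
    (\<Sum>s=1..n. \<Sum>mu\<in>fpf_types s. \<bar>phi mu (beta_set nu)\<bar>)"
proof -
  let ?T = "cycle_type n ` (perms n - {id})" and ?X = "beta_set nu"
  define F where "F t = sorted_list_of_multiset (filter_mset (\<lambda>i. i \<noteq> 1) t)" for t :: "nat multiset"
  have split: "t = mset (F t @ replicate (n - sum_list (F t)) 1)" "F t \<in> fpf_types (sum_list (F t))"
    "sum_list (F t) \<in> {1..n}" if "t \<in> ?T" for t
  proof -
    obtain z where z: "z \<in> perms n" "z \<noteq> id" "t = cycle_type n z" using \<open>t \<in> ?T\<close> by blast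
    have t: "\<forall>i\<in>#t. 0 < i" "sum_mset t = n" "\<exists>i\<in>#t. i \<noteq> 1" using cycle_type_facts[OF z(1)] z by simp_all
    have dec: "t = filter_mset (\<lambda>i. i \<noteq> 1) t + replicate_mset (count t 1) 1"
      using multiset_partition[of t "\<lambda>i. i \<noteq> 1"] by (simp add: filter_eq_replicate_mset)
    have sF: "sum_list (F t) = sum_mset (filter_mset (\<lambda>i. i \<noteq> 1) t)"
      unfolding F_def by (metis mset_sorted_list_of_multiset sum_mset_sum_list)
    have sum: "n = sum_list (F t) + count t 1"
      using arg_cong[OF dec, of sum_mset] t(2) unfolding sF by simp
    then have "n - sum_list (F t) = count t 1" by simp
    then show "t = mset (F t @ replicate (n - sum_list (F t)) 1)"
      using dec by (simp add: F_def)
    have ge2: "2 \<le> i" if "i \<in> set (F t)" for i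
    proof -
      have "i \<in># t" "i \<noteq> 1" using that by (simp_all add: F_def)
      moreover have "0 < i" using t(1) \<open>i \<in># t\<close> by blast
      ultimately show ?thesis by linarith
    qed
    then show "F t \<in> fpf_types (sum_list (F t))" by (simp add: fpf_types_def)
    obtain i where "i \<in># t" "i \<noteq> 1" using t(3) by blast
    then have "i \<in> set (F t)" by (simp add: F_def)
    then have "0 < sum_list (F t)" using ge2 member_le_sum_list[of i "F t"] by fastforce
    then show "sum_list (F t) \<in> {1..n}" using sum by simp
  qed
  have val: "\<bar>of_int (chi_val nu t)\<bar> / real (num_syt nu) = \<bar>phi (F t) ?X\<bar>" if t: "t \<in> ?T" for t
  proof -
    have "real_of_int (chi_val nu t) = ch (F t @ replicate (sz ?X - sum_list (F t)) 1) ?X"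
      using chi_val_ch[OF nu(1) split(1)[OF t]] sz_beta[OF nu(1)] nu(2) by simp
    moreover have "real (num_syt nu) = rdim ?X"
      using num_syt_dm[OF nu(1)] unfolding rdim_def by (metis of_int_of_nat_eq)
    ultimately show ?thesis using rdim_pos[of ?X] by (simp add: phi_def)
  qed
  have inj: "inj_on F ?T"
  proof (rule inj_onI)
    fix t t' assume t: "t \<in> ?T" "t' \<in> ?T" "F t = F t'"
    have "t = mset (F t @ replicate (n - sum_list (F t)) 1)" by (rule split(1)[OF t(1)])
    also have "\<dots> = t'" unfolding t(3) by (rule split(1)[OF t(2), symmetric])
    finally show "t = t'" .
  qed
  have fin: "finite (Sigma {1..n} fpf_types)" using card_fpf_types_le by (intro finite_SigmaI) auto
  have "(\<Sum>t\<in>?T. \<bar>of_int (chi_val nu t)\<bar> / real (num_syt nu)) = (\<Sum>t\<in>?T. \<bar>phi (F t) ?X\<bar>)"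
    by (rule sum.cong[OF refl val])
  also have "\<dots> = (\<Sum>p\<in>(\<lambda>t. (sum_list (F t), F t)) ` ?T. \<bar>phi (snd p) ?X\<bar>)"
    using inj by (subst sum.reindex) (auto simp: inj_on_def)
  also have "\<dots> \<le> (\<Sum>p\<in>Sigma {1..n} fpf_types. \<bar>phi (snd p) ?X\<bar>)"
    using split(2,3) by (intro sum_mono2[OF fin]) auto
  also have "\<dots> = (\<Sum>s=1..n. \<Sum>mu\<in>fpf_types s. \<bar>phi mu ?X\<bar>)"
    using card_fpf_types_le by (subst sum.Sigma) (auto simp: case_prod_beta)
  finally show ?thesis .
qed

text \<open>Markov's inequality, with the first moment estimated through commuting pairs.\<close>

lemma prob_R_var_le:
  assumes nu: "is_partition n nu" and e: "0 < \<epsilon>"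
  shows "real (card {\<sigma> \<in> perms n. cmod (R_var n nu \<sigma>) > \<epsilon>}) / fact n \<le>
    (\<Sum>s=1..n. \<Sum>mu\<in>fpf_types s. \<bar>phi mu (beta_set nu)\<bar>) / \<epsilon>"
proof -
  let ?E = "{\<sigma> \<in> perms n. cmod (R_var n nu \<sigma>) > \<epsilon>}"
  let ?u = "\<lambda>t. \<bar>of_int (chi_val nu t)\<bar> / real (num_syt nu)"
  have s: "sorted_wrt (\<ge>) nu" "sum_list nu = n" using nu by (auto simp: is_partition_def)
  have dm: "real (num_syt nu) = rdim (beta_set nu)"
    using num_syt_dm[OF s(1)] unfolding rdim_def by (metis of_int_of_nat_eq)
  have f0: "0 < num_syt nu" using rdim_pos[of "beta_set nu"] dm by simp
  have "real_of_int (chi_val nu (cycle_type n id)) = ch (replicate n 1) (beta_set nu)"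
    by (rule chi_val_ch[OF s(1)]) (simp add: cycle_type_id)
  then have fid: "real_of_int (chi_val nu (cycle_type n id)) = real (num_syt nu)"
    unfolding dm rdim_ch sz_beta[OF s(1)] s(2) .
  have "\<epsilon> * real (card ?E) = (\<Sum>\<sigma>\<in>?E. \<epsilon>)" by simp
  also have "\<dots> \<le> (\<Sum>\<sigma>\<in>?E. cmod (R_var n nu \<sigma>))" by (rule sum_mono) simp
  also have "\<dots> \<le> (\<Sum>\<sigma>\<in>perms n. cmod (R_var n nu \<sigma>))"
    using perms_finite by (intro sum_mono2) auto
  also have "\<dots> \<le> (\<Sum>\<sigma>\<in>perms n. \<Sum>z\<in>centralizer n \<sigma> - {id}. ?u (cycle_type n z))"
    by (intro sum_mono cmod_R_var_le fid f0)
  also have "\<dots> \<le> fact n * (\<Sum>t\<in>cycle_type n ` (perms n - {id}). ?u t)"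
    by (rule sum_centralizers_le) simp
  also have "\<dots> \<le> fact n * (\<Sum>s=1..n. \<Sum>mu\<in>fpf_types s. \<bar>phi mu (beta_set nu)\<bar>)"
    by (intro mult_left_mono sum_classes_le s) simp
  finally show ?thesis using e by (simp add: field_simps)
qed

lemma beta_set_bounded:
  assumes nu: "is_partition n nu"
  shows "beta_set nu \<subseteq> {..first_row nu + first_col nu}"
proof
  fix x assume "x \<in> beta_set nu"
  then obtain i where i: "i < length nu" "x = nu ! i + (length nu - 1 - i)" by (auto simp: beta_set_def)
  have "nu ! i \<le> nu ! 0" using sorted_wrt_ge_nth[of nu 0 i] nu i by (simp add: is_partition_def)
  moreover have "nu ! 0 = first_row nu" using i by (auto simp: first_row_def hd_conv_nth)
  ultimately show "x \<in> {..first_row nu + first_col nu}" using i by (simp add: first_col_def)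
qed

theorem theorem7p2:
  fixes nu :: "nat \<Rightarrow> nat list"
  assumes "\<forall>n. is_partition n (nu n)"
    and "balanced nu"
  shows "\<forall>\<epsilon>>0. (\<lambda>n. real (card {\<sigma> \<in> perms n. cmod (R_var n (nu n) \<sigma>) > \<epsilon>}) / fact n)
           \<longlonglongrightarrow> 0"
proof (intro allI impI)
  fix \<epsilon> :: real assume e: "0 < \<epsilon>"
  obtain a where a: "\<And>n. real (first_row (nu n)) \<le> a * sqrt (real n)"
    "\<And>n. real (first_col (nu n)) \<le> a * sqrt (real n)"
    using assms(2) unfolding balanced_def by blast
  \<comment> \<open>Beta numbers are bounded by first row plus first column, hence by
    \<open>2 * a * sqrt n\<close>. Being a square, \<open>?K\<close> is nonnegative whatever the
    sign of \<open>a\<close>.\<close>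
  let ?X = "\<lambda>n. beta_set (nu n)" and ?K = "(2 * a)\<^sup>2"
  let ?D = "\<lambda>n. \<Sum>s=1..n. \<Sum>mu\<in>fpf_types s. \<bar>phi mu (?X n)\<bar>"
  have s: "sorted_wrt (\<ge>) (nu n)" "sum_list (nu n) = n" for n
    using assms(1) by (simp_all add: is_partition_def)
  have K: "\<exists>m. ?X n \<subseteq> {..m} \<and> (real m)\<^sup>2 \<le> ?K * real n" for n
  proof (intro exI conjI)
    let ?m = "first_row (nu n) + first_col (nu n)"
    show "?X n \<subseteq> {..?m}" using assms(1) by (intro beta_set_bounded) blast
    have "real ?m \<le> 2 * a * sqrt (real n)" using a[of n] by simp
    then have "(real ?m)\<^sup>2 \<le> (2 * a * sqrt (real n))\<^sup>2" by (intro power_mono) auto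
    then show "(real ?m)\<^sup>2 \<le> ?K * real n" by (simp add: power_mult_distrib)
  qed
  have "?D \<longlonglongrightarrow> 0"
    using K by (intro sum_phi_tendsto[of ?X ?K]) (auto simp: sz_beta s)
  then have lim: "(\<lambda>n. ?D n / \<epsilon>) \<longlonglongrightarrow> 0" using tendsto_divide[OF _ tendsto_const, of ?D 0 sequentially \<epsilon>] e by simp
  show "(\<lambda>n. real (card {\<sigma> \<in> perms n. cmod (R_var n (nu n) \<sigma>) > \<epsilon>}) / fact n) \<longlonglongrightarrow> 0"
  proof (rule tendsto_sandwich[OF _ _ tendsto_const lim])
    show "\<forall>\<^sub>F n in sequentially. 0 \<le> real (card {\<sigma> \<in> perms n. cmod (R_var n (nu n) \<sigma>) > \<epsilon>}) / fact n"
      by simp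
    show "\<forall>\<^sub>F n in sequentially. real (card {\<sigma> \<in> perms n. cmod (R_var n (nu n) \<sigma>) > \<epsilon>}) / fact n \<le> ?D n / \<epsilon>"
      using prob_R_var_le[OF _ e] assms(1) by simp
  qed
qed

end
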